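(* Let $S=\{c_1,\dots,c_n\}$ with $0\le c_1<\dots<c_n=\bar c$ and $V^{c_i}(x):=V^S(x,c_i)$. For each $1\le i<n$, $V^{c_i}$ is the smallest viscosity supersolution $u$ of $\max\{\mathcal L^{c_i}(u)(x),V^{c_{i+1}}(x)-u(x)\}=0$ on $(0,\infty)$ satisfying $u(0)=0$ and $\lim_{x\to\infty}u(x)\ge\bar c/q$; that is, $V^{c_i}$ is such a supersolution and $V^{c_i}\le u$ for every such supersolution $u$.
   Context: Fix constants $\mu>0$, $\sigma>0$, $q>0$. Let $W$ be a standard Brownian motion and $X_t=x+\mu t+\sigma W_t$, with $(\mathcal F_t)_{t\ge0}$ the completed filtration generated by $X$. For a set $S\subset[0,\infty)$ with $\bar c=\max S<\infty$, $x\ge0$ and $c\in S$, let $\Pi^S_{x,c}$ be the set of processes $C=(C_t)_{t\ge0}$ that are non-decreasing, right-continuous, $(\mathcal F_t)$-adapted, with $C_t\in S$ and $C_t\ge c$ for all $t$. The controlled surplus is $X^C_t=X_t-\int_0^tC_s\,ds$, the ruin time is $\tau=\inf\{t\ge0:X^C_t<0\}$, $J(x;C)=\mathbb E[\int_0^\tau e^{-qs}C_s\,ds]$, and $V^S(x,c)=\sup_{C\in\Pi^S_{x,c}}J(x;C)$. For $c\ge0$, $\mathcal L^c(W)=\frac{\sigma^2}{2}W''+(\mu-c)W'-qW+c$. A locally Lipschitz $\bar u:[0,\infty)\to\mathbb R$ is a viscosity supersolution of $\max\{\mathcal L^{c_i}(u)(x),V^{c_{i+1}}(x)-u(x)\}=0$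 at $x>0$ if every $C^2$ function $\varphi$ with $\varphi(x)=\bar u(x)$ such that $\bar u-\varphi$ attains its minimum at $x$ satisfies $\max\{\mathcal L^{c_i}(\varphi)(x),V^{c_{i+1}}(x)-\varphi(x)\}\le0$. *)

theory Defs
  imports "HOL-Probability.Probability"
begin

definition std_BM :: "'a measure \<Rightarrow> (real \<Rightarrow> 'a \<Rightarrow> real) \<Rightarrow> bool" where
  "std_BM M W \<longleftrightarrow> prob_space M
     \<and> (\<forall>t\<ge>0. W t \<in> borel_measurable M)
     \<and> (\<forall>\<omega>\<in>space M. W 0 \<omega> = 0 \<and> continuous_on {0..} (\<lambda>t. W t \<omega>))
     \<and> (\<forall>s t. 0 \<le> s \<and> s < t \<longrightarrow>
          distributed M lborel (\<lambda>\<omega>. W t \<omega> - W s \<omega>)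
            (\<lambda>y. ennreal (normal_density 0 (sqrt (t - s)) y)))
     \<and> (\<forall>(k::nat) (ts::nat \<Rightarrow> real). 0 \<le> ts 0 \<and> strict_mono ts \<longrightarrow>
          prob_space.indep_vars M (\<lambda>_. borel) (\<lambda>i \<omega>. W (ts (Suc i)) \<omega> - W (ts i) \<omega>) {..<k})"

definition Xproc :: "real \<Rightarrow> real \<Rightarrow> real \<Rightarrow> (real \<Rightarrow> 'a \<Rightarrow> real) \<Rightarrow> real \<Rightarrow> 'a \<Rightarrow> real" where
  "Xproc x mu sg W t \<omega> = x + mu * t + sg * W t \<omega>"

definition nat_filt :: "'a measure \<Rightarrow> (real \<Rightarrow> 'a \<Rightarrow> real) \<Rightarrow> real \<Rightarrow> 'a set set" where
  "nat_filt M X t = {A \<in> sets M. \<exists>B \<in> sigma_sets (space M)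
        (\<Union>s\<in>{0..t}. {X s -` U \<inter> space M | U. U \<in> sets (borel :: real measure)}).
        (A - B) \<union> (B - A) \<in> null_sets M}"

definition admissible :: "'a measure \<Rightarrow> (real \<Rightarrow> 'a \<Rightarrow> real) \<Rightarrow> real set \<Rightarrow> real
      \<Rightarrow> (real \<Rightarrow> 'a \<Rightarrow> real) \<Rightarrow> bool" where
  "admissible M X S c C \<longleftrightarrow>
     (\<forall>t\<ge>0. \<forall>U\<in>sets (borel :: real measure). C t -` U \<inter> space M \<in> nat_filt M X t)
     \<and> (\<forall>\<omega>\<in>space M. mono_on {0..} (\<lambda>t. C t \<omega>)
          \<and> (\<forall>t\<ge>0. continuous (at_right t) (\<lambda>s. C s \<omega>))
          \<and> (\<forall>t\<ge>0. C t \<omega> \<in> S \<and> c \<le> C t \<omega>))"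

text \<open>Controlled surplus, ruin time (in ereal; Inf of the empty set is infinity),
  and the expected discounted payoff.\<close>
definition surplusC :: "(real \<Rightarrow> 'a \<Rightarrow> real) \<Rightarrow> (real \<Rightarrow> 'a \<Rightarrow> real) \<Rightarrow> real \<Rightarrow> 'a \<Rightarrow> real" where
  "surplusC X C t \<omega> = X t \<omega> - (LINT s:{0..t}|lborel. C s \<omega>)"

definition ruin_time :: "(real \<Rightarrow> 'a \<Rightarrow> real) \<Rightarrow> (real \<Rightarrow> 'a \<Rightarrow> real) \<Rightarrow> 'a \<Rightarrow> ereal" where
  "ruin_time X C \<omega> = Inf (ereal ` {t. 0 \<le> t \<and> surplusC X C t \<omega> < 0})"

definition Jpay :: "'a measure \<Rightarrow> real \<Rightarrow> (real \<Rightarrow> 'a \<Rightarrow> real) \<Rightarrow> (real \<Rightarrow> 'a \<Rightarrow> real) \<Rightarrow> real" where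
  "Jpay M q X C = (\<integral>\<omega>. (LINT s:{s. 0 \<le> s \<and> ereal s < ruin_time X C \<omega>}|lborel.
                        exp (- q * s) * C s \<omega>) \<partial>M)"

definition VS :: "'a measure \<Rightarrow> (real \<Rightarrow> 'a \<Rightarrow> real) \<Rightarrow> real \<Rightarrow> real \<Rightarrow> real
      \<Rightarrow> real set \<Rightarrow> real \<Rightarrow> real \<Rightarrow> real" where
  "VS M W mu sg q S x c =
     (SUP C \<in> {C. admissible M (Xproc x mu sg W) S c C}. Jpay M q (Xproc x mu sg W) C)"

definition Lop :: "real \<Rightarrow> real \<Rightarrow> real \<Rightarrow> real \<Rightarrow> (real \<Rightarrow> real) \<Rightarrow> (real \<Rightarrow> real)
      \<Rightarrow> (real \<Rightarrow> real) \<Rightarrow> real \<Rightarrow> real" where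
  "Lop mu sg q c \<phi> \<phi>' \<phi>'' x = sg\<^sup>2 / 2 * \<phi>'' x + (mu - c) * \<phi>' x - q * \<phi> x + c"

definition loc_lipschitz_nonneg :: "(real \<Rightarrow> real) \<Rightarrow> bool" where
  "loc_lipschitz_nonneg u \<longleftrightarrow> (\<forall>x\<ge>0. \<exists>e>0. \<exists>L. \<forall>y\<in>cball x e \<inter> {0..}. \<forall>z\<in>cball x e \<inter> {0..}.
       \<bar>u y - u z\<bar> \<le> L * \<bar>y - z\<bar>)"

definition visc_super_at :: "real \<Rightarrow> real \<Rightarrow> real \<Rightarrow> real \<Rightarrow> (real \<Rightarrow> real)
      \<Rightarrow> (real \<Rightarrow> real) \<Rightarrow> real \<Rightarrow> bool" where
  "visc_super_at mu sg q c Vn u x \<longleftrightarrow>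
     (\<forall>\<phi> \<phi>' \<phi>''. (\<forall>y. (\<phi> has_real_derivative \<phi>' y) (at y))
        \<and> (\<forall>y. (\<phi>' has_real_derivative \<phi>'' y) (at y))
        \<and> continuous_on UNIV \<phi>''
        \<and> \<phi> x = u x
        \<and> (\<forall>y\<ge>0. u x - \<phi> x \<le> u y - \<phi> y)
        \<longrightarrow> max (Lop mu sg q c \<phi> \<phi>' \<phi>'' x) (Vn x - \<phi> x) \<le> 0)"

definition admissible_super :: "real \<Rightarrow> real \<Rightarrow> real \<Rightarrow> real \<Rightarrow> real \<Rightarrow> (real \<Rightarrow> real)
      \<Rightarrow> (real \<Rightarrow> real) \<Rightarrow> bool" where
  "admissible_super mu sg q c cbar Vn u \<longleftrightarrow>
     loc_lipschitz_nonneg u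
     \<and> (\<forall>x>0. visc_super_at mu sg q c Vn u x)
     \<and> u 0 = 0
     \<and> (\<exists>L. ((\<lambda>x. ereal (u x)) \<longlongrightarrow> L) at_top \<and> ereal (cbar / q) \<le> L)"

end

theory Submission
  imports Defs
begin

text \<open>
  Put K = cbar / q. The value functions are identified with explicitly constructed functions
  v_n, ..., v_1: v_n is the bounded solution of L v = 0 vanishing at 0, and v_j is the pointwise
  infimum of all functions c_j / q + A exp (r1 x) + B exp (r2 x) (the solutions of L h = 0 for the
  rate c_j) that dominate v_(j+1) on the half-line. This is the least concave majorant in the
  coordinate exp ((r1 - r2) x): v_j is touched from above by a solution at every point, and it is
  itself a solution on every interval where it exceeds v_(j+1). Hence at every relevant point v_j is
  touched by a paraboloid on which the generator vanishes, up to a cubic error.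

  A cubic touching error costs d^(3/2) in a Gaussian step of length d, so the verification argument
  can be run along a grid of mesh d with N d fixed, without stochastic calculus. Monotonicity of the
  controls makes the discretisation errors telescope, and ruin is handled by shifting the argument
  of v_j by a small amount eta. Touching from above bounds the payoff of every control;
  touching from below bounds the payoff of the grid control that switches up as soon as
  v_j \<le> v_(j+1) + ep. Both together give V = v.

  With V = v the viscosity statements are elementary. If a supersolution u were below v somewhere,
  then u - v would attain a negative minimum at a point where v exceeds the obstacle (as u does not
  fall below it), and the paraboloid touching v from below there contradicts the supersolution
  property of u.
\<close>

text \<open>No second-order smoothness of the value functions is ever established; all that is
  available at a point is a one-sided paraboloid. The exponent 3/2 is the third absolute moment of a
  Gaussian increment of variance d, while the constant, linear and quadratic terms are integrated
  exactly and reproduce the generator up to terms of order d^2. Over N = T / d steps the errors add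
  up to order T sqrt d. The constants of the touching bounds are shown to be uniform only away from
  0 or away from the contact set. The shift eta takes care of the former and the tolerance ep of the
  latter. Both stay fixed while d tends to 0, then T goes to infinity, and only then do eta and ep
  vanish. All functions are extended by 0 to the negative half-line because a Gaussian step may
  overshoot, and their boundedness is what turns a touching on a window into an inequality on the
  whole line. K is the value of paying the top rate forever; it bounds every v_j and is their common
  limit at infinity, so the growth condition on u makes u - v asymptotically nonnegative.\<close>

section \<open>Solutions of the linear equation\<close>

text \<open>In applications \<open>r1\<close> and \<open>r2\<close> are the characteristic roots of the generator for the rate \<open>c\<close>, and
  \<open>k = c / q\<close>; then \<open>gsol A B\<close> is the general solution of \<open>L h = 0\<close>, and \<open>ivp x a p\<close> is the one with value \<open>a\<close>
  and slope \<open>p\<close> at \<open>x\<close>.\<close>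

locale exp_pair =
  fixes r1 r2 k :: real
  assumes r1: "0 < r1" and r2: "r2 < 0" and k: "0 \<le> k"
begin

definition gsol :: "real \<Rightarrow> real \<Rightarrow> real \<Rightarrow> real" where
  "gsol A B x = k + A * exp (r1 * x) + B * exp (r2 * x)"

definition ivp_value :: "real \<Rightarrow> real" where
  "ivp_value z = (r1 * exp (r2 * z) - r2 * exp (r1 * z)) / (r1 - r2)"

definition ivp_slope :: "real \<Rightarrow> real" where
  "ivp_slope z = (exp (r1 * z) - exp (r2 * z)) / (r1 - r2)"

definition ivp :: "real \<Rightarrow> real \<Rightarrow> real \<Rightarrow> real \<Rightarrow> real" where
  "ivp x a p y = k + (a - k) * ivp_value (y - x) + p * ivp_slope (y - x)"

lemma r2_less_r1: "0 < r1 - r2"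
  using r1 r2 by simp

lemma ivp_eq_gsol:
  "ivp x a p = gsol ((p - r2 * (a - k)) / (r1 - r2) * exp (- (r1 * x)))
                 ((r1 * (a - k) - p) / (r1 - r2) * exp (- (r2 * x)))"
proof
  fix y
  define E1 E2 where "E1 = exp (r1 * (y - x))" and "E2 = exp (r2 * (y - x))"
  have 1: "exp (- (r1 * x)) * exp (r1 * y) = E1" "exp (- (r2 * x)) * exp (r2 * y) = E2"
    by (simp_all add: E1_def E2_def exp_add [symmetric] algebra_simps)
  have "ivp x a p y = k + (p - r2 * (a - k)) / (r1 - r2) * E1 + (r1 * (a - k) - p) / (r1 - r2) * E2"
    using r2_less_r1 unfolding ivp_def ivp_value_def ivp_slope_def E1_def [symmetric] E2_def [symmetric]
    by (simp add: divide_simps) (simp add: algebra_simps)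
  then show "ivp x a p y = gsol ((p - r2 * (a - k)) / (r1 - r2) * exp (- (r1 * x)))
                 ((r1 * (a - k) - p) / (r1 - r2) * exp (- (r2 * x))) y"
    by (simp add: gsol_def mult.assoc 1)
qed

lemma gsol_eq_ivp:
  "gsol A B = ivp x (gsol A B x) (r1 * (A * exp (r1 * x)) + r2 * (B * exp (r2 * x)))"
proof -
  let ?a = "gsol A B x" and ?p = "r1 * (A * exp (r1 * x)) + r2 * (B * exp (r2 * x))"
  have "?p - r2 * (?a - k) = (r1 - r2) * (A * exp (r1 * x))"
    by (simp add: gsol_def algebra_simps)
  moreover have "r1 * (?a - k) - ?p = (r1 - r2) * (B * exp (r2 * x))"
    by (simp add: gsol_def algebra_simps)
  ultimately show ?thesis
    unfolding ivp_eq_gsol using r2_less_r1 by (simp add: mult.assoc exp_minus)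
qed

lemma ivp_value_0 [simp]: "ivp_value 0 = 1" and ivp_slope_0 [simp]: "ivp_slope 0 = 0"
  using r2_less_r1 by (simp_all add: ivp_value_def ivp_slope_def)

lemma ivp_base [simp]: "ivp x a p x = a"
  by (simp add: ivp_def)

text \<open>\<open>ivp_value\<close> is a convex combination of the two exponentials, and under the
  tangent bound \<open>1 + r * z\<close> the linear terms cancel. The inequality lets the terms with
  \<open>k\<close> be dropped in the slope bounds and provides a first majorant.\<close>

lemma ivp_value_ge_1: "1 \<le> ivp_value z"
proof -
  have "r1 * (1 + r2 * z) \<le> r1 * exp (r2 * z)" "- r2 * (1 + r1 * z) \<le> - r2 * exp (r1 * z)"
    using r1 r2 exp_ge_add_one_self by (auto intro!: mult_left_mono simp del: mult_minus_left)
  then have "r1 - r2 \<le> r1 * exp (r2 * z) - r2 * exp (r1 * z)"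
    by (simp add: algebra_simps)
  then show ?thesis using r2_less_r1 by (simp add: ivp_value_def)
qed

lemma ivp_slope_less_iff: "ivp_slope y < ivp_slope z \<longleftrightarrow> y < z"
proof -
  have *: "ivp_slope y < ivp_slope z" if "y < z" for y z
  proof -
    have "exp (r1 * y) < exp (r1 * z)" "exp (r2 * z) < exp (r2 * y)"
      using that r1 r2 by auto
    then show ?thesis unfolding ivp_slope_def using r2_less_r1 by (intro divide_strict_right_mono) linarith+
  qed
  show ?thesis using *[of y z] *[of z y] by (cases y z rule: linorder_cases) auto
qed

lemma ivp_slope_pos_iff: "0 < ivp_slope z \<longleftrightarrow> 0 < z" and ivp_slope_neg_iff: "ivp_slope z < 0 \<longleftrightarrow> z < 0"
  using ivp_slope_less_iff[of 0 z] ivp_slope_less_iff[of z 0] by auto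

lemma ivp_slope_nonneg: "0 \<le> z \<Longrightarrow> 0 \<le> ivp_slope z" and ivp_slope_nonpos: "z \<le> 0 \<Longrightarrow> ivp_slope z \<le> 0"
  using ivp_slope_neg_iff ivp_slope_pos_iff by (metis linorder_not_less)+

lemma continuous_ivp_value [continuous_intros]:
  "continuous_on S f \<Longrightarrow> continuous_on S (\<lambda>x. ivp_value (f x))"
  unfolding ivp_value_def using r2_less_r1 by (auto intro!: continuous_intros)

lemma continuous_ivp_slope [continuous_intros]:
  "continuous_on S f \<Longrightarrow> continuous_on S (\<lambda>x. ivp_slope (f x))"
  unfolding ivp_slope_def using r2_less_r1 by (auto intro!: continuous_intros)

text \<open>Dividing the difference of two solutions by \<open>exp (r2 * y)\<close> leaves an affine
  function of \<open>exp ((r1 - r2) * y)\<close>, and an affine function that is nonnegative at both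
  ends of an interval is nonnegative inside. This is the maximum principle for the equation.\<close>

lemma gsol_le_between:
  assumes "a \<le> x" "x \<le> b" "gsol A B a \<le> gsol A' B' a" "gsol A B b \<le> gsol A' B' b"
  shows "gsol A B x \<le> gsol A' B' x"
proof -
  define E where "E y = exp ((r1 - r2) * y)" for y
  have *: "gsol A' B' y - gsol A B y = exp (r2 * y) * ((A' - A) * E y + (B' - B))" for y
    by (simp add: gsol_def E_def algebra_simps exp_add [symmetric])
  have pos: "0 \<le> (A' - A) * E y + (B' - B) \<longleftrightarrow> gsol A B y \<le> gsol A' B' y" for y
  proof -
    have "gsol A B y \<le> gsol A' B' y \<longleftrightarrow> 0 \<le> exp (r2 * y) * ((A' - A) * E y + (B' - B))"
      unfolding *[of y, symmetric] by simp
    then show ?thesis by (simp add: zero_le_mult_iff)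
  qed
  have a: "0 \<le> (A' - A) * E a + (B' - B)" and b: "0 \<le> (A' - A) * E b + (B' - B)"
    unfolding pos by (fact assms(3), fact assms(4))
  have E: "E a \<le> E x" "E x \<le> E b"
    using assms r2_less_r1 by (auto simp: E_def)
  have "0 \<le> (A' - A) * E x + (B' - B)"
  proof (cases "A \<le> A'")
    case True
    then have "(A' - A) * E a \<le> (A' - A) * E x" using E by (intro mult_left_mono) auto
    then show ?thesis using a by linarith
  next
    case False
    then have "(A' - A) * E b \<le> (A' - A) * E x" using E by (intro mult_left_mono_neg) auto
    then show ?thesis using b by linarith
  qed
  then show ?thesis unfolding pos .
qed

text \<open>Two solutions with a common value at \<open>x\<close> differ by a multiple of
  \<open>ivp_slope\<close>, which changes sign exactly at \<open>x\<close>; the one that is higher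
  on the left is therefore lower on the right.\<close>

lemma ivp_le_right:
  assumes "y < x" "x \<le> z" "ivp x a p y \<ge> ivp x a p' y"
  shows "ivp x a p z \<le> ivp x a p' z"
proof -
  have "ivp_slope (y - x) < 0" using assms ivp_slope_neg_iff by simp
  then have "p \<le> p'" using assms by (simp add: ivp_def)
  then show ?thesis using ivp_slope_nonneg[of "z - x"] assms by (simp add: ivp_def mult_right_mono)
qed

lemma ivp_le_left:
  assumes "x < y" "z \<le> x" "ivp x a p y \<ge> ivp x a p' y"
  shows "ivp x a p z \<le> ivp x a p' z"
proof -
  have "0 < ivp_slope (y - x)" using assms ivp_slope_pos_iff by simp
  then have "p' \<le> p" using assms by (simp add: ivp_def)
  then show ?thesis using ivp_slope_nonpos[of "z - x"] assms by (simp add: ivp_def mult_right_mono_neg)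
qed

lemma ivp_interpolate:
  assumes "x < y" shows "\<exists>p. ivp x a p y = b"
proof -
  have "0 < ivp_slope (y - x)" using assms ivp_slope_pos_iff by simp
  then have "ivp x a ((b - k - (a - k) * ivp_value (y - x)) / ivp_slope (y - x)) y = b"
    by (simp add: ivp_def)
  then show ?thesis ..
qed

text \<open>A solution that is nonnegative at distance \<open>w\<close> cannot descend too steeply
  from a value at most \<open>K\<close>. The bound is uniform in the base point, the value and the
  solution.\<close>

lemma slope_lower:
  assumes "0 < w" "0 \<le> ivp x a p (x + w)" "0 \<le> a" "a \<le> K"
  shows "- (K * ivp_value w / ivp_slope w) \<le> p"
proof -
  have "0 \<le> k + (a - k) * ivp_value w + p * ivp_slope w" using assms by (simp add: ivp_def)
  moreover have "k \<le> k * ivp_value w" using ivp_value_ge_1[of w] k by (metis mult.right_neutral mult_left_mono)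
  moreover have "a * ivp_value w \<le> K * ivp_value w" using assms ivp_value_ge_1[of w] by (intro mult_right_mono) auto
  ultimately have "- (K * ivp_value w) \<le> p * ivp_slope w" by (simp add: algebra_simps)
  moreover have "0 < ivp_slope w" using assms ivp_slope_pos_iff by simp
  ultimately show ?thesis by (simp add: field_simps)
qed

lemma slope_upper:
  assumes "0 < w" "0 \<le> ivp x a p (x - w)" "0 \<le> a" "a \<le> K"
  shows "p \<le> K * ivp_value (- w) / (- ivp_slope (- w))"
proof -
  have "0 \<le> k + (a - k) * ivp_value (- w) + p * ivp_slope (- w)" using assms by (simp add: ivp_def)
  moreover have "k \<le> k * ivp_value (- w)" using ivp_value_ge_1[of "- w"] k by (metis mult.right_neutral mult_left_mono)
  moreover have "a * ivp_value (- w) \<le> K * ivp_value (- w)" using assms ivp_value_ge_1[of "- w"] by (intro mult_right_mono) auto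
  ultimately have "p * (- ivp_slope (- w)) \<le> K * ivp_value (- w)" by (simp add: algebra_simps)
  moreover have "0 < - ivp_slope (- w)" using assms ivp_slope_neg_iff[of "-w"] by simp
  ultimately show ?thesis by (simp only: pos_le_divide_eq)
qed

end

section \<open>The least majorant by solutions\<close>

text \<open>\<open>g\<close> stands for the value function of the next higher rate, extended by 0 to
  the left. \<open>kK\<close> reflects that paying the current rate forever is worth at most as much
  as paying the top rate forever.\<close>

locale obstacle = exp_pair +
  fixes g :: "real \<Rightarrow> real" and K G :: real
  assumes g0: "\<And>y. y \<le> 0 \<Longrightarrow> g y = 0" and g_nonneg: "\<And>y. 0 \<le> g y" and g_le: "\<And>y. g y \<le> K"
    and kK: "k \<le> K" and g_lip: "\<And>x y. \<bar>g x - g y\<bar> \<le> G * \<bar>x - y\<bar>"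
begin

definition majorant :: "(real \<Rightarrow> real) \<Rightarrow> bool" where
  "majorant h \<longleftrightarrow> (\<exists>A B. h = gsol A B) \<and> (\<forall>y\<ge>0. g y \<le> h y)"

text \<open>The value 0 on the left half-line is prescribed rather than obtained from the infimum;
  \<open>envelope_linear_bound\<close> shows that the two pieces fit together continuously at
  0.\<close>

definition envelope :: "real \<Rightarrow> real" where
  "envelope x = (if x \<le> 0 then 0 else INF h\<in>Collect majorant. h x)"

lemma majorant_ivp: "majorant (ivp x a p) \<longleftrightarrow> (\<forall>y\<ge>0. g y \<le> ivp x a p y)"
  unfolding majorant_def using ivp_eq_gsol by metis

lemma majorant_imp_ivp: "majorant h \<Longrightarrow> \<exists>p. h = ivp x (h x) p"
  unfolding majorant_def using gsol_eq_ivp by metis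

lemma majorant_nonneg: "majorant h \<Longrightarrow> 0 \<le> y \<Longrightarrow> 0 \<le> h y"
  unfolding majorant_def using g_nonneg order_trans by blast

text \<open>The solution with value \<open>K\<close> and slope 0 at a point stays above
  \<open>K\<close> by \<open>ivp_value_ge_1\<close>. It shows that majorants exist, which makes the
  infimum meaningful.\<close>

lemma majorant_K: "majorant (ivp x K 0)"
proof -
  have "g y \<le> ivp x K 0 y" for y
  proof -
    have "(K - k) * 1 \<le> (K - k) * ivp_value (y - x)" using kK ivp_value_ge_1 by (intro mult_left_mono) auto
    then show ?thesis using g_le[of y] by (simp add: ivp_def)
  qed
  then show ?thesis by (simp add: majorant_ivp)
qed

lemma G_nonneg: "0 \<le> G"
  using g_lip[of 0 1] by simp

lemma g_cont: "continuous_on S g"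
  using g_lip G_nonneg by (intro lipschitz_on_continuous_on[of G] lipschitz_onI) (auto simp: dist_real_def)

lemma envelope_le: "majorant h \<Longrightarrow> 0 \<le> x \<Longrightarrow> envelope x \<le> h x"
proof (cases "x \<le> 0")
  case True
  assume "majorant h" "0 \<le> x"
  then show ?thesis using True majorant_nonneg by (simp add: envelope_def)
next
  case False
  assume h: "majorant h" "0 \<le> x"
  have "bdd_below ((\<lambda>h. h x) ` Collect majorant)"
    using h majorant_nonneg by (intro bdd_belowI[of _ 0]) auto
  then have "(INF h\<in>Collect majorant. h x) \<le> h x" using h by (intro cINF_lower) auto
  then show ?thesis using False by (simp add: envelope_def)
qed

lemma envelope_greatest: "0 < x \<Longrightarrow> (\<And>h. majorant h \<Longrightarrow> m \<le> h x) \<Longrightarrow> m \<le> envelope x"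
  using majorant_K by (auto simp: envelope_def intro!: cINF_greatest)

lemma envelope_ge_g: "g x \<le> envelope x"
proof (cases "x \<le> 0")
  case True then show ?thesis by (simp add: g0 envelope_def)
next
  case False then show ?thesis by (intro envelope_greatest) (auto simp: majorant_def)
qed

lemma envelope_nonneg: "0 \<le> envelope x"
  using envelope_ge_g g_nonneg order_trans by blast

lemma envelope_le_K: "envelope x \<le> K"
proof (cases "x \<le> 0")
  case True then show ?thesis using kK k by (simp add: envelope_def)
next
  case False then show ?thesis using envelope_le[OF majorant_K[of x], of x] by simp
qed

lemma majorant_slope_lower: "majorant (ivp x a p) \<Longrightarrow> 0 \<le> x \<Longrightarrow> a \<le> K \<Longrightarrow> - (K * ivp_value 1 / ivp_slope 1) \<le> p"
  using slope_lower[of 1 x a p K] majorant_nonneg[of "ivp x a p" "x + 1"] majorant_nonneg[of "ivp x a p" x] by simp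

lemma majorant_slope_upper: "majorant (ivp x a p) \<Longrightarrow> 0 < w \<Longrightarrow> w \<le> x \<Longrightarrow> a \<le> L \<Longrightarrow> p \<le> L * ivp_value (- w) / (- ivp_slope (- w))"
  using slope_upper[of w x a p L] majorant_nonneg[of "ivp x a p" "x - w"] majorant_nonneg[of "ivp x a p" x] by simp

text \<open>Attainment of the infimum is a compactness argument for the pairs (value, slope) at
  \<open>x\<close>: values may be restricted to \<open>{0..K}\<close>, and nonnegativity of
  majorants at 0 and at \<open>x + 1\<close> bounds the slopes.\<close>

lemma envelope_touch:
  assumes "0 < x" shows "\<exists>p. majorant (ivp x (envelope x) p)"
proof -
  define P where "P = K * ivp_value 1 / ivp_slope 1 + K * ivp_value (- x) / (- ivp_slope (- x))"
  have Kn: "0 \<le> K" using k kK by simp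
  have p: "\<bar>p\<bar> \<le> P" if "majorant (ivp x a p)" "a \<le> K" for a p
  proof -
    have "0 \<le> K * ivp_value 1 / ivp_slope 1" "0 \<le> K * ivp_value (- x) / (- ivp_slope (- x))"
      using Kn ivp_value_ge_1[of 1] ivp_value_ge_1[of "-x"] ivp_slope_pos_iff[of 1] ivp_slope_neg_iff[of "-x"] assms
      by (auto intro!: divide_nonneg_pos mult_nonneg_nonneg simp del: divide_minus_right)
    then show ?thesis
      using majorant_slope_lower[OF that(1) _ that(2)] majorant_slope_upper[OF that(1) assms order_refl that(2)] assms
      unfolding P_def by linarith
  qed
  \<comment> \<open>A solution depends affinely on its value and slope at \<open>x\<close>, so each
    \<open>y\<close> contributes a closed half-plane. Minimising the first coordinate over
    \<open>T\<close> yields the envelope together with a touching slope.\<close>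
  define T where "T = ({0..K} \<times> {-P..P}) \<inter> {z. \<forall>y\<in>{0..}. g y \<le> k + (fst z - k) * ivp_value (y - x) + snd z * ivp_slope (y - x)}"
  have cpt: "compact T" unfolding T_def
  proof (rule compact_Int_closed)
    show "compact ({0..K} \<times> {-P..P})" by (intro compact_Times compact_Icc)
    have "{z. \<forall>y\<in>{0..}. g y \<le> k + (fst z - k) * ivp_value (y - x) + snd z * ivp_slope (y - x)}
        = (\<Inter>y\<in>{0..}. {z. g y \<le> k + (fst z - k) * ivp_value (y - x) + snd z * ivp_slope (y - x)})" by auto
    moreover have "closed \<dots>"
      by (intro closed_INT ballI closed_Collect_le continuous_intros)
    ultimately show "closed {z. \<forall>y\<in>{0..}. g y \<le> k + (fst z - k) * ivp_value (y - x) + snd z * ivp_slope (y - x)}"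
      by simp
  qed
  have TI: "(a, p) \<in> T" if "majorant (ivp x a p)" "a \<le> K" for a p
    using that p[OF that] majorant_nonneg[OF that(1), of x] assms
    by (auto simp: T_def majorant_ivp ivp_def abs_le_iff)
  have K0: "(K, 0) \<in> T" using TI majorant_K by simp
  then have "T \<noteq> {}" by blast
  from continuous_attains_inf[OF cpt this continuous_on_fst[OF continuous_on_id]]
  obtain z where z: "z \<in> T" "\<And>w. w \<in> T \<Longrightarrow> fst z \<le> fst w" by blast
  have m: "majorant (ivp x (fst z) (snd z))"
    using z(1) by (auto simp: T_def majorant_ivp ivp_def)
  have "envelope x = fst z"
  proof (rule antisym)
    show "envelope x \<le> fst z" using envelope_le[OF m, of x] assms by simp
    show "fst z \<le> envelope x"
    proof (rule envelope_greatest[OF assms])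
      fix h assume h: "majorant h"
      show "fst z \<le> h x"
      proof (cases "h x \<le> K")
        case True
        obtain p where "h = ivp x (h x) p" using majorant_imp_ivp[OF h] by blast
        then have "(h x, p) \<in> T" using TI h True by metis
        then show ?thesis using z(2) by fastforce
      next
        case False
        then show ?thesis using z(2)[OF K0] by simp
      qed
    qed
  qed
  then show ?thesis using m by auto
qed

text \<open>An explicit majorant that vanishes at 0 serves as a barrier. Besides continuity at 0 it
  provides the factor \<open>x\<close> that keeps the slopes of touching majorants bounded near
  0.\<close>

lemma envelope_linear_bound: "\<exists>D\<ge>0. \<forall>x\<in>{0..1}. envelope x \<le> D * x"
proof -
  \<comment> \<open>Chosen so that \<open>A * (exp (r1 * y) - exp (r2 * y))\<close> dominates the
    Lipschitz bound \<open>G * y\<close> of the obstacle; the second coefficient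
    \<open>- k - A\<close> of \<open>h\<close> makes \<open>h\<close> vanish at 0.\<close>
  define A where "A = G / r1"
  have A: "0 \<le> A" using G_nonneg r1 by (simp add: A_def)
  define h where "h = gsol A (- k - A)"
  have h: "h y = k * (1 - exp (r2 * y)) + A * (exp (r1 * y) - exp (r2 * y))" for y
    by (simp add: h_def gsol_def algebra_simps)
  have e2: "exp (r2 * y) \<le> 1" if "0 \<le> y" for y using that r2 by (simp add: mult_nonpos_nonneg)
  have "g y \<le> h y" if "0 \<le> y" for y
  proof -
    have "g y \<le> G * y" using g_lip[of y 0] g0[of 0] that by simp
    also have "\<dots> = A * (r1 * y)" using r1 by (simp add: A_def)
    also have "\<dots> \<le> A * (exp (r1 * y) - exp (r2 * y))"
      using A e2[OF that] exp_ge_add_one_self[of "r1 * y"] by (intro mult_left_mono) linarith+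
    also have "\<dots> \<le> h y" using k e2[OF that] by (simp add: h)
    finally show ?thesis .
  qed
  then have m: "majorant h" unfolding majorant_def h_def by blast
  define D where "D = k * (- r2) + A * (r1 * exp r1 - r2)"
  have "envelope x \<le> D * x" if x: "x \<in> {0..1}" for x
  proof -
    have 1: "1 - exp (r2 * x) \<le> - r2 * x" using exp_ge_add_one_self[of "r2 * x"] by linarith
    have "1 - r1 * x \<le> exp (- (r1 * x))" using exp_ge_add_one_self[of "- (r1 * x)"] by simp
    then have "exp (r1 * x) * (1 - r1 * x) \<le> exp (r1 * x) * exp (- (r1 * x))" by (intro mult_left_mono) auto
    then have "exp (r1 * x) - 1 \<le> exp (r1 * x) * (r1 * x)" by (simp add: exp_minus algebra_simps)
    also have "\<dots> \<le> exp r1 * (r1 * x)" using x r1 by (intro mult_right_mono) (auto simp: mult_left_le)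
    finally have 2: "exp (r1 * x) - exp (r2 * x) \<le> exp r1 * (r1 * x) - r2 * x" using 1 by linarith
    have "envelope x \<le> h x" using envelope_le[OF m] x by simp
    also have "\<dots> \<le> k * (- r2 * x) + A * (exp r1 * (r1 * x) - r2 * x)"
      unfolding h using 1 2 k A by (intro add_mono mult_left_mono) auto
    also have "\<dots> = D * x" by (simp add: D_def algebra_simps)
    finally show ?thesis .
  qed
  moreover have "0 \<le> D" unfolding D_def using k A r1 r2 
    by (intro add_nonneg_nonneg mult_nonneg_nonneg) (auto intro: order_trans[of _ 0])
  ultimately show ?thesis by blast
qed

lemma ivp_slope_lower: "0 \<le> x \<Longrightarrow> (- r2) / (r1 - r2) * x \<le> - ivp_slope (- x)"
proof -
  assume x: "0 \<le> x"
  have "exp (r1 * - x) \<le> 1" "1 - r2 * x \<le> exp (r2 * - x)"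
    using x r1 exp_ge_add_one_self[of "- (r2 * x)"] by auto
  then have "- r2 * x \<le> exp (r2 * - x) - exp (r1 * - x)" by linarith
  then have "- r2 * x / (r1 - r2) \<le> (exp (r2 * - x) - exp (r1 * - x)) / (r1 - r2)"
    using r2_less_r1 by (intro divide_right_mono) auto
  moreover have "- ivp_slope (- x) = (exp (r2 * - x) - exp (r1 * - x)) / (r1 - r2)"
    unfolding ivp_slope_def by (simp only: minus_divide_left minus_diff_eq)
  ultimately show ?thesis by simp
qed

text \<open>For \<open>x\<close> near 0 a majorant is known to be nonnegative only back to distance
  \<open>x\<close>, so the upper slope bound has a denominator of order \<open>x\<close>
  (\<open>ivp_slope_lower\<close>). The linear bound on the envelope puts a matching factor
  \<open>x\<close> into the numerator.\<close>

lemma envelope_slope_bound: "\<exists>P\<ge>0. \<forall>x>0. \<forall>p. majorant (ivp x (envelope x) p) \<longrightarrow> \<bar>p\<bar> \<le> P"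
proof -
  have Kn: "0 \<le> K" using k kK by simp
  obtain D where D: "0 \<le> D" "\<And>x. x \<in> {0..1} \<Longrightarrow> envelope x \<le> D * x" using envelope_linear_bound by blast
  have "continuous_on {-1..0} ivp_value" using continuous_ivp_value[of "{-1..0}" "\<lambda>x. x"] by (simp add: continuous_on_id)
  then obtain m where m: "\<And>z. z \<in> {-1..0} \<Longrightarrow> ivp_value z \<le> ivp_value m"
    using continuous_attains_sup[OF compact_Icc, of "-1" 0 ivp_value] by fastforce
  define e where "e = (- r2) / (r1 - r2)"
  have e: "0 < e" using r2 r2_less_r1 unfolding e_def by (intro divide_pos_pos) auto
  define P where "P = K * ivp_value 1 / ivp_slope 1 + K * ivp_value (- 1) / (- ivp_slope (- 1)) + D * ivp_value m / e"
  have nn: "0 \<le> K * ivp_value 1 / ivp_slope 1" "0 \<le> K * ivp_value (- 1) / (- ivp_slope (- 1))" "0 \<le> D * ivp_value m / e"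
  proof -
    show "0 \<le> K * ivp_value 1 / ivp_slope 1"
      using Kn ivp_value_ge_1[of 1] ivp_slope_pos_iff[of 1] by simp
    show "0 \<le> K * ivp_value (- 1) / (- ivp_slope (- 1))"
      using Kn ivp_value_ge_1[of "-1"] ivp_slope_neg_iff[of "-1"] by (intro divide_nonneg_pos mult_nonneg_nonneg) auto
    show "0 \<le> D * ivp_value m / e"
      using D(1) e ivp_value_ge_1[of m] by simp
  qed
  have "\<bar>p\<bar> \<le> P" if x: "0 < x" and mj: "majorant (ivp x (envelope x) p)" for x p
  proof -
    have lo: "- (K * ivp_value 1 / ivp_slope 1) \<le> p" using majorant_slope_lower[OF mj] x envelope_le_K by simp
    have "p \<le> K * ivp_value (- 1) / (- ivp_slope (- 1)) \<or> p \<le> D * ivp_value m / e"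
    proof (cases "1 \<le> x")
      case True
      then show ?thesis using majorant_slope_upper[OF mj, of 1 K] envelope_le_K by simp
    next
      case False
      have bx: "e * x \<le> - ivp_slope (- x)" using ivp_slope_lower[of x] x by (simp add: e_def)
      have "p \<le> (D * x) * ivp_value (- x) / (- ivp_slope (- x))"
        using majorant_slope_upper[OF mj x order_refl, of "D * x"] D(2)[of x] False x by simp
      also have "\<dots> \<le> (D * x) * ivp_value m / (e * x)"
      proof (intro frac_le mult_left_mono bx)
        show "ivp_value (- x) \<le> ivp_value m" using m[of "-x"] False x by simp
        show "0 \<le> D * x * ivp_value m" using D(1) x ivp_value_ge_1[of m] by (intro mult_nonneg_nonneg) auto
      qed (use D(1) x e in auto)
      also have "\<dots> = D * ivp_value m / e" using x by simp
      finally show ?thesis by simp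
    qed
    then show ?thesis using lo nn unfolding P_def by linarith
  qed
  moreover have "0 \<le> P" using nn unfolding P_def by linarith
  ultimately show ?thesis by blast
qed

end

section \<open>Touching paraboloids\<close>

text \<open>For \<open>e = 1\<close> the function is touched from above, for \<open>e = - 1\<close> from below. The equation relating
  \<open>p\<close> and \<open>s\<close> says that the generator vanishes at \<open>x\<close> on the paraboloid.\<close>

definition quad_bound ::
  "real \<Rightarrow> real \<Rightarrow> real \<Rightarrow> real \<Rightarrow> real \<Rightarrow> (real \<Rightarrow> real) \<Rightarrow> real \<Rightarrow> real \<Rightarrow> bool" where
  "quad_bound mu sg q c e f M x \<longleftrightarrow> (\<exists>p s. \<bar>p\<bar> \<le> M \<and> \<bar>s\<bar> \<le> M
     \<and> sg\<^sup>2 / 2 * s + (mu - c) * p = q * f x - c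
     \<and> (\<forall>z. e * f (x + z) \<le> e * (f x + p * z + s * z\<^sup>2 / 2) + M * \<bar>z\<bar> ^ 3))"

lemma exp_taylor2: "\<bar>exp w - 1 - w - w\<^sup>2 / 2\<bar> \<le> exp \<bar>w\<bar> * \<bar>w\<bar> ^ 3" for w :: real
proof -
  obtain t where t: "\<bar>t\<bar> \<le> \<bar>w\<bar>" "exp w = (\<Sum>m<3. w ^ m / fact m) + exp t / fact 3 * w ^ 3"
    using Maclaurin_exp_le[of w 3] by blast
  have "exp w - 1 - w - w\<^sup>2 / 2 = exp t / 6 * w ^ 3"
    using t(2) by (simp add: eval_nat_numeral)
  then have "\<bar>exp w - 1 - w - w\<^sup>2 / 2\<bar> = exp t / 6 * \<bar>w\<bar> ^ 3"
    by (simp only: abs_mult power_abs abs_divide abs_exp_cancel abs_numeral)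
  also have "\<dots> \<le> exp \<bar>w\<bar> * \<bar>w\<bar> ^ 3"
  proof (rule mult_right_mono)
    have "exp t \<le> exp \<bar>w\<bar>" using t(1) by simp
    moreover have "0 < exp t" by simp
    ultimately show "exp t / 6 \<le> exp \<bar>w\<bar>" by linarith
  qed simp
  finally show ?thesis .
qed

context exp_pair
begin

text \<open>The second derivative of \<open>ivp x a p\<close> at \<open>x\<close>, expressed through
  the sum and the product of the roots.\<close>

definition ivp_curv :: "real \<Rightarrow> real \<Rightarrow> real" where
  "ivp_curv a p = - (r1 * r2) * (a - k) + (r1 + r2) * p"

lemma exp_taylor_scaled:
  fixes r z :: real
  assumes "\<bar>z\<bar> \<le> 1"
  shows "\<bar>exp (r * z) - 1 - r * z - (r * z)\<^sup>2 / 2\<bar> \<le> exp \<bar>r\<bar> * \<bar>r\<bar> ^ 3 * \<bar>z\<bar> ^ 3"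
proof -
  have "\<bar>r * z\<bar> \<le> \<bar>r\<bar>" using assms by (simp add: abs_mult mult_left_le)
  then have "exp \<bar>r * z\<bar> * \<bar>r * z\<bar> ^ 3 \<le> exp \<bar>r\<bar> * \<bar>r * z\<bar> ^ 3" by (intro mult_right_mono) auto
  then show ?thesis using exp_taylor2[of "r * z"] by (simp add: abs_mult power_mult_distrib)
qed

lemma ivp_taylor:
  "\<exists>T\<ge>0. \<forall>x a p z. \<bar>z\<bar> \<le> 1 \<longrightarrow>
     \<bar>ivp x a p (x + z) - (a + p * z + ivp_curv a p * z\<^sup>2 / 2)\<bar> \<le> (\<bar>a - k\<bar> + \<bar>p\<bar>) * T * \<bar>z\<bar> ^ 3"
proof -
  define T1 T2 where "T1 = exp \<bar>r1\<bar> * \<bar>r1\<bar> ^ 3" and "T2 = exp \<bar>r2\<bar> * \<bar>r2\<bar> ^ 3"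
  \<comment> \<open>\<open>ivp_value\<close> and \<open>ivp_slope\<close> are linear combinations of
    the two exponentials, so their Taylor remainders are the same combinations of the remainders of
    the exponentials; \<open>T\<close> dominates both.\<close>
  define T where "T = ((r1 + 1) * T2 + (1 - r2) * T1) / (r1 - r2)"
  have T12: "0 \<le> T1" "0 \<le> T2" by (simp_all add: T1_def T2_def)
  have "0 \<le> T" unfolding T_def using T12 r2_less_r1 r1 r2
    by (intro divide_nonneg_pos add_nonneg_nonneg mult_nonneg_nonneg) auto
  moreover have "\<bar>ivp x a p (x + z) - (a + p * z + ivp_curv a p * z\<^sup>2 / 2)\<bar> \<le> (\<bar>a - k\<bar> + \<bar>p\<bar>) * T * \<bar>z\<bar> ^ 3"
    if z: "\<bar>z\<bar> \<le> 1" for x a p z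
  proof -
    define R1 R2 where "R1 = exp (r1 * z) - 1 - r1 * z - (r1 * z)\<^sup>2 / 2"
      and "R2 = exp (r2 * z) - 1 - r2 * z - (r2 * z)\<^sup>2 / 2"
    have R: "\<bar>R1\<bar> \<le> T1 * \<bar>z\<bar> ^ 3" "\<bar>R2\<bar> \<le> T2 * \<bar>z\<bar> ^ 3"
      unfolding R1_def R2_def T1_def T2_def using exp_taylor_scaled[OF z] by blast+
    have ivp_value: "ivp_value z = 1 - r1 * r2 * z\<^sup>2 / 2 + (r1 * R2 - r2 * R1) / (r1 - r2)"
      using r2_less_r1 by (simp add: ivp_value_def R1_def R2_def divide_simps) (simp add: algebra_simps power2_eq_square)
    have ivp_slope: "ivp_slope z = z + (r1 + r2) * z\<^sup>2 / 2 + (R1 - R2) / (r1 - r2)"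
      using r2_less_r1 by (simp add: ivp_slope_def R1_def R2_def divide_simps) (simp add: algebra_simps power2_eq_square)
    have "\<bar>r1 * R2\<bar> \<le> r1 * (T2 * \<bar>z\<bar> ^ 3)" "\<bar>r2 * R1\<bar> \<le> - r2 * (T1 * \<bar>z\<bar> ^ 3)"
      using R r1 r2 by (auto simp: abs_mult intro!: mult_left_mono)
    moreover have "T * \<bar>z\<bar> ^ 3 * (r1 - r2) = r1 * (T2 * \<bar>z\<bar> ^ 3) + T2 * \<bar>z\<bar> ^ 3 + T1 * \<bar>z\<bar> ^ 3 - r2 * (T1 * \<bar>z\<bar> ^ 3)"
      using r2_less_r1 by (simp add: T_def) (simp add: algebra_simps)
    moreover have "0 \<le> T2 * \<bar>z\<bar> ^ 3" "0 \<le> T1 * \<bar>z\<bar> ^ 3" using T12 by simp_all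
    moreover have "0 \<le> r1 * (T2 * \<bar>z\<bar> ^ 3)" "0 \<le> - r2 * (T1 * \<bar>z\<bar> ^ 3)"
      using T12 r1 r2 by (intro mult_nonneg_nonneg; simp)+
    ultimately have "\<bar>r1 * R2 - r2 * R1\<bar> \<le> T * \<bar>z\<bar> ^ 3 * (r1 - r2)" "\<bar>R1 - R2\<bar> \<le> T * \<bar>z\<bar> ^ 3 * (r1 - r2)"
      using R by linarith+
    then have b: "\<bar>(r1 * R2 - r2 * R1) / (r1 - r2)\<bar> \<le> T * \<bar>z\<bar> ^ 3" "\<bar>(R1 - R2) / (r1 - r2)\<bar> \<le> T * \<bar>z\<bar> ^ 3"
      using r2_less_r1 by (simp_all add: abs_divide pos_divide_le_eq)
    have "ivp x a p (x + z) - (a + p * z + ivp_curv a p * z\<^sup>2 / 2)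
        = (a - k) * ((r1 * R2 - r2 * R1) / (r1 - r2)) + p * ((R1 - R2) / (r1 - r2))"
      unfolding ivp_def ivp_curv_def by (simp only: add_diff_cancel_left' ivp_value ivp_slope) (simp add: field_simps)
    also have "\<bar>\<dots>\<bar> \<le> \<bar>a - k\<bar> * (T * \<bar>z\<bar> ^ 3) + \<bar>p\<bar> * (T * \<bar>z\<bar> ^ 3)"
      using b by (intro order_trans[OF abs_triangle_ineq] add_mono) (auto simp only: abs_mult abs_ge_zero intro!: mult_left_mono)
    finally show ?thesis by (simp add: algebra_simps)
  qed
  ultimately show ?thesis by blast
qed

text \<open>By Vieta, the roots determine \<open>b\<close> and \<open>q\<close> in terms of
  \<open>sg\<close>. For \<open>c = q * k\<close> the right-hand side is \<open>q * a - c\<close>,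
  which is the condition on slope and curvature in \<open>quad_bound\<close>.\<close>

lemma ivp_curv_ode:
  assumes "sg\<^sup>2 / 2 * r1\<^sup>2 + b * r1 = q" "sg\<^sup>2 / 2 * r2\<^sup>2 + b * r2 = q"
  shows "sg\<^sup>2 / 2 * ivp_curv a p + b * p = q * (a - k)"
proof -
  have "(r1 - r2) * (sg\<^sup>2 / 2 * (r1 + r2) + b) = 0"
  proof -
    have "(r1 - r2) * (sg\<^sup>2 / 2 * (r1 + r2) + b) = (sg\<^sup>2 / 2 * r1\<^sup>2 + b * r1) - (sg\<^sup>2 / 2 * r2\<^sup>2 + b * r2)"
      by (simp add: field_simps power2_eq_square)
    then show ?thesis using assms by simp
  qed
  then have b: "b = - (sg\<^sup>2 / 2 * (r1 + r2))" using r2_less_r1 by simp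
  have q: "q = - (sg\<^sup>2 / 2 * (r1 * r2))" using assms(1) unfolding b by (simp add: field_simps power2_eq_square)
  show ?thesis unfolding ivp_curv_def b q by (simp add: field_simps)
qed

text \<open>A touching on a window of radius \<open>w\<close> becomes global: inside the window
  Taylor's formula leaves a cubic error, and outside it the bounded \<open>f\<close>, the linear and
  the quadratic term are all dominated by a multiple of \<open>|z|^3\<close>. The constant is fixed
  before the point and the function.\<close>

lemma ivp_quad_bound:
  assumes w: "0 < w" "w \<le> 1" and K: "k \<le> K" and P: "0 \<le> P"
    and ode: "sg\<^sup>2 / 2 * r1\<^sup>2 + (mu - c) * r1 = q" "sg\<^sup>2 / 2 * r2\<^sup>2 + (mu - c) * r2 = q" "c = q * k"
  shows "\<exists>M\<ge>0. \<forall>x p f e. (e = 1 \<or> e = - 1) \<and> (\<forall>y. 0 \<le> f y \<and> f y \<le> K) \<and> \<bar>p\<bar> \<le> P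
      \<and> (\<forall>z. \<bar>z\<bar> \<le> w \<longrightarrow> e * f (x + z) \<le> e * ivp x (f x) p (x + z))
      \<longrightarrow> quad_bound mu sg q c e f M x"
proof -
  obtain T where T: "T \<ge> 0" "\<And>x a p z. \<bar>z\<bar> \<le> 1 \<Longrightarrow>
     \<bar>ivp x a p (x + z) - (a + p * z + ivp_curv a p * z\<^sup>2 / 2)\<bar> \<le> (\<bar>a - k\<bar> + \<bar>p\<bar>) * T * \<bar>z\<bar> ^ 3"
    using ivp_taylor by blast
  define S where "S = \<bar>r1 * r2\<bar> * K + \<bar>r1 + r2\<bar> * P"
  have Kn: "0 \<le> K" using K k by simp
  have S: "0 \<le> S" using Kn P by (simp add: S_def)
  \<comment> \<open>\<open>P\<close> and \<open>S\<close> bound slope and curvature,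
    \<open>(K + P) * T\<close> is the Taylor error, and the last quotient pays for
    \<open>2 * K + P * |z| + S * z^2\<close> when \<open>|z|\<close> exceeds
    \<open>w\<close>.\<close>
  define M where "M = P + S + (K + P) * T + (2 * K + P + S) / w ^ 3"
  have parts: "0 \<le> (K + P) * T" "0 \<le> (2 * K + P + S) / w ^ 3" using Kn P S T(1) w by simp_all
  have Mn: "0 \<le> M" using parts P S unfolding M_def by linarith
  have "quad_bound mu sg q c e f M x"
    if e: "e = 1 \<or> e = - 1" and f: "\<And>y. 0 \<le> f y \<and> f y \<le> K" and p: "\<bar>p\<bar> \<le> P"
      and le: "\<And>z. \<bar>z\<bar> \<le> w \<Longrightarrow> e * f (x + z) \<le> e * ivp x (f x) p (x + z)" for x p f e
  proof -
    define s where "s = ivp_curv (f x) p"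
    have ak: "\<bar>f x - k\<bar> \<le> K" using f[of x] k K by (auto simp: abs_le_iff)
    have "\<bar>s\<bar> \<le> \<bar>- (r1 * r2) * (f x - k)\<bar> + \<bar>(r1 + r2) * p\<bar>"
      unfolding s_def ivp_curv_def by (rule abs_triangle_ineq)
    also have "\<dots> \<le> S" unfolding S_def using ak p by (auto simp: abs_mult intro!: add_mono mult_left_mono)
    finally have s: "\<bar>s\<bar> \<le> S" .
    have "e * f (x + z) \<le> e * (f x + p * z + s * z\<^sup>2 / 2) + M * \<bar>z\<bar> ^ 3" for z
    proof (cases "\<bar>z\<bar> \<le> w")
      case True
      have "\<bar>ivp x (f x) p (x + z) - (f x + p * z + s * z\<^sup>2 / 2)\<bar> \<le> (\<bar>f x - k\<bar> + \<bar>p\<bar>) * T * \<bar>z\<bar> ^ 3"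
        unfolding s_def using T(2) True w by simp
      also have "\<dots> \<le> (K + P) * T * \<bar>z\<bar> ^ 3" using ak p T(1) by (intro mult_right_mono add_mono) auto
      also have "\<dots> \<le> M * \<bar>z\<bar> ^ 3" using parts P S unfolding M_def by (intro mult_right_mono) auto
      finally have "\<bar>ivp x (f x) p (x + z) - (f x + p * z + s * z\<^sup>2 / 2)\<bar> \<le> M * \<bar>z\<bar> ^ 3" .
      then show ?thesis using le[OF True] e by auto
    next
      case False
      then have z: "1 \<le> \<bar>z\<bar> / w" using w by simp
      have u: "u \<le> u / w ^ 3 * \<bar>z\<bar> ^ 3" "u * \<bar>z\<bar> \<le> u / w ^ 3 * \<bar>z\<bar> ^ 3" "u * \<bar>z\<bar>\<^sup>2 \<le> u / w ^ 3 * \<bar>z\<bar> ^ 3"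
        if "0 \<le> u" for u
      proof -
        have eq: "u / w ^ 3 * \<bar>z\<bar> ^ 3 = u * (\<bar>z\<bar> / w) ^ 3" by (simp add: power_divide)
        have le_zw: "\<bar>z\<bar> \<le> \<bar>z\<bar> / w" using w by (simp add: pos_le_divide_eq mult_left_le)
        have 1: "1 \<le> (\<bar>z\<bar> / w) ^ 3" using z by (rule one_le_power)
        have 2: "\<bar>z\<bar> \<le> (\<bar>z\<bar> / w) ^ 3"
          using le_zw power_increasing[of 1 3 "\<bar>z\<bar> / w", OF _ z] by (simp only: power_one_right) linarith
        have 3: "\<bar>z\<bar>\<^sup>2 \<le> (\<bar>z\<bar> / w) ^ 3"
          using power_mono[OF le_zw abs_ge_zero, of 2] power_increasing[of 2 3 "\<bar>z\<bar> / w", OF _ z] by linarith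
        show "u \<le> u / w ^ 3 * \<bar>z\<bar> ^ 3" "u * \<bar>z\<bar> \<le> u / w ^ 3 * \<bar>z\<bar> ^ 3" "u * \<bar>z\<bar>\<^sup>2 \<le> u / w ^ 3 * \<bar>z\<bar> ^ 3"
          unfolding eq using mult_left_mono[OF 1 that] mult_left_mono[OF 2 that] mult_left_mono[OF 3 that]
          by (simp_all only: mult_1_right)
      qed
      have "\<bar>p * z\<bar> \<le> P * \<bar>z\<bar>" using p by (simp add: abs_mult mult_right_mono)
      moreover have "\<bar>s * z\<^sup>2 / 2\<bar> \<le> S * \<bar>z\<bar>\<^sup>2"
      proof -
        have "\<bar>s\<bar> * z\<^sup>2 \<le> S * z\<^sup>2" using s by (intro mult_right_mono) auto
        moreover have "0 \<le> \<bar>s\<bar> * z\<^sup>2" by simp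
        moreover have "\<bar>s * z\<^sup>2 / 2\<bar> = \<bar>s\<bar> * z\<^sup>2 / 2" by (simp add: abs_mult)
        ultimately show ?thesis by simp
      qed
      moreover have "(2 * K) / w ^ 3 * \<bar>z\<bar> ^ 3 + P / w ^ 3 * \<bar>z\<bar> ^ 3 + S / w ^ 3 * \<bar>z\<bar> ^ 3 \<le> M * \<bar>z\<bar> ^ 3"
      proof -
        have "(2 * K) / w ^ 3 + P / w ^ 3 + S / w ^ 3 \<le> M" using parts P S unfolding M_def
          by (simp add: add_divide_distrib)
        from mult_right_mono[OF this, of "\<bar>z\<bar> ^ 3"] show ?thesis by (simp only: distrib_right zero_le_power abs_ge_zero)
      qed
      moreover have "e * f (x + z) \<le> K" "- K \<le> e * f x" using e f[of x] f[of "x+z"] by auto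
      moreover have "- \<bar>p * z\<bar> \<le> e * (p * z)" "- \<bar>s * z\<^sup>2 / 2\<bar> \<le> e * (s * z\<^sup>2 / 2)" using e by auto
      moreover have "e * (f x + p * z + s * z\<^sup>2 / 2) = e * f x + e * (p * z) + e * (s * z\<^sup>2 / 2)"
        by (simp only: distrib_left)
      moreover have "2 * K \<le> 2 * K / w ^ 3 * \<bar>z\<bar> ^ 3" using Kn by (intro u(1)) simp
      ultimately show ?thesis using u(2)[OF P] u(3)[OF S] by linarith
    qed
    moreover have "sg\<^sup>2 / 2 * s + (mu - c) * p = q * f x - c"
      unfolding s_def using ivp_curv_ode[OF ode(1,2), of "f x" p] ode(3) by (simp add: algebra_simps)
    moreover have "\<bar>p\<bar> \<le> M" "\<bar>s\<bar> \<le> M" using p s parts P S unfolding M_def by linarith+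
    ultimately show ?thesis unfolding quad_bound_def by blast
  qed
  then show ?thesis using Mn by blast
qed

end

text \<open>The zero extension gives \<open>v\<close> a meaning after an overshoot below 0, and the
  Lipschitz bound across 0 includes continuity at ruin.\<close>

definition vclass :: "real \<Rightarrow> real \<Rightarrow> (real \<Rightarrow> real) \<Rightarrow> bool" where
  "vclass K L v \<longleftrightarrow> (\<forall>y\<le>0. v y = 0) \<and> (\<forall>y. 0 \<le> v y \<and> v y \<le> K) \<and> (\<forall>x y. \<bar>v x - v y\<bar> \<le> L * \<bar>x - y\<bar>)"

text \<open>The function \<open>v\<close> is a supersolution on the open half-line and a
  solution where it exceeds the obstacle, with constants uniform away from 0 and from the contact set.\<close>

definition obstacle_sol ::
  "real \<Rightarrow> real \<Rightarrow> real \<Rightarrow> real \<Rightarrow> real \<Rightarrow> real \<Rightarrow> (real \<Rightarrow> real) \<Rightarrow> (real \<Rightarrow> real) \<Rightarrow> bool" where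
  "obstacle_sol mu sg q K L c g v \<longleftrightarrow> vclass K L v \<and> (\<forall>x. g x \<le> v x)
     \<and> (\<forall>w>0. \<exists>M\<ge>0. \<forall>x\<ge>w. quad_bound mu sg q c 1 v M x)
     \<and> (\<forall>w>0. \<exists>M\<ge>0. \<forall>x>0. g x + w < v x \<longrightarrow> quad_bound mu sg q c (- 1) v M x)"

lemma char_roots_exist:
  fixes sg q b :: real
  assumes "0 < sg" "0 < q"
  obtains r1 r2 where "0 < r1" "r2 < 0" "sg\<^sup>2 / 2 * r1\<^sup>2 + b * r1 = q" "sg\<^sup>2 / 2 * r2\<^sup>2 + b * r2 = q"
proof
  define D where "D = sqrt (b\<^sup>2 + 2 * sg\<^sup>2 * q)"
  have "\<bar>b\<bar> < D" unfolding D_def using assms by (intro real_less_rsqrt) simp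
  then show "0 < (- b + D) / sg\<^sup>2" "(- b - D) / sg\<^sup>2 < 0" using assms by (auto simp: divide_less_0_iff)
  have D2: "D\<^sup>2 = b\<^sup>2 + 2 * sg\<^sup>2 * q" unfolding D_def using assms by simp
  have *: "sg\<^sup>2 / 2 * (y / sg\<^sup>2)\<^sup>2 + b * (y / sg\<^sup>2) = q" if "y\<^sup>2 + 2 * b * y = 2 * sg\<^sup>2 * q" for y
  proof -
    have "sg\<^sup>2 / 2 * (y / sg\<^sup>2)\<^sup>2 + b * (y / sg\<^sup>2) = (y\<^sup>2 + 2 * b * y) / (2 * sg\<^sup>2)"
      using assms by (simp add: field_simps power2_eq_square)
    then show ?thesis using that assms by simp
  qed
  show "sg\<^sup>2 / 2 * ((- b + D) / sg\<^sup>2)\<^sup>2 + b * ((- b + D) / sg\<^sup>2) = q"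
    "sg\<^sup>2 / 2 * ((- b - D) / sg\<^sup>2)\<^sup>2 + b * ((- b - D) / sg\<^sup>2) = q"
    by (rule *, use D2 in \<open>simp add: power2_eq_square algebra_simps\<close>)+
qed

section \<open>The least majorant solves the obstacle problem\<close>

context obstacle
begin

text \<open>The majorant touching at \<open>x\<close> gives a one-sided estimate with the uniform
  slope bound, and exchanging the two points gives the other side. At 0, where no touching is
  available, the linear bound takes over. \<open>G \<le> L\<close> allows one constant for obstacle
  and envelope.\<close>

lemma envelope_lipschitz: "\<exists>L\<ge>G. \<forall>x y. \<bar>envelope x - envelope y\<bar> \<le> L * \<bar>x - y\<bar>"
proof -
  obtain P where P: "P \<ge> 0" "\<And>x p. 0 < x \<Longrightarrow> majorant (ivp x (envelope x) p) \<Longrightarrow> \<bar>p\<bar> \<le> P"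
    using envelope_slope_bound by blast
  obtain D where D: "0 \<le> D" "\<And>x. x \<in> {0..1} \<Longrightarrow> envelope x \<le> D * x" using envelope_linear_bound by blast
  obtain T where T: "T \<ge> 0" "\<And>x a p z. \<bar>z\<bar> \<le> 1 \<Longrightarrow>
     \<bar>ivp x a p (x + z) - (a + p * z + ivp_curv a p * z\<^sup>2 / 2)\<bar> \<le> (\<bar>a - k\<bar> + \<bar>p\<bar>) * T * \<bar>z\<bar> ^ 3"
    using ivp_taylor by blast
  have Kn: "0 \<le> K" using k kK by simp
  define S where "S = \<bar>r1 * r2\<bar> * K + \<bar>r1 + r2\<bar> * P"
  have S: "0 \<le> S" using Kn P by (simp add: S_def)
  define L where "L = G + D + K + P + S + (K + P) * T"
  have nn: "0 \<le> (K + P) * T" using Kn P T by simp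
  have main: "envelope y \<le> envelope x + L * \<bar>y - x\<bar>" if x: "0 < x" and y: "0 \<le> y" for x y
  proof (cases "\<bar>y - x\<bar> \<le> 1")
    case True
    obtain p where p: "majorant (ivp x (envelope x) p)" using envelope_touch[OF x] by blast
    have pP: "\<bar>p\<bar> \<le> P" using P(2)[OF x p] .
    define z where "z = y - x"
    have ak: "\<bar>envelope x - k\<bar> \<le> K" using envelope_nonneg[of x] envelope_le_K[of x] k kK by (auto simp: abs_le_iff)
    have "\<bar>ivp_curv (envelope x) p\<bar> \<le> \<bar>- (r1 * r2) * (envelope x - k)\<bar> + \<bar>(r1 + r2) * p\<bar>"
      unfolding ivp_curv_def by (rule abs_triangle_ineq)
    also have "\<dots> \<le> S" unfolding S_def using ak pP by (auto simp: abs_mult intro!: add_mono mult_left_mono)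
    finally have s: "\<bar>ivp_curv (envelope x) p\<bar> \<le> S" .
    have z1: "\<bar>z\<bar> \<le> 1" using True by (simp add: z_def)
    have z2: "\<bar>z\<bar>\<^sup>2 \<le> \<bar>z\<bar>" "\<bar>z\<bar> ^ 3 \<le> \<bar>z\<bar>"
      using z1 power_decreasing[of 1 2 "\<bar>z\<bar>"] power_decreasing[of 1 3 "\<bar>z\<bar>"] by auto
    have "envelope y \<le> ivp x (envelope x) p (x + z)" using envelope_le[OF p y] by (simp add: z_def)
    also have "\<dots> \<le> envelope x + p * z + ivp_curv (envelope x) p * z\<^sup>2 / 2 + (\<bar>envelope x - k\<bar> + \<bar>p\<bar>) * T * \<bar>z\<bar> ^ 3"
      using T(2)[OF z1, of x "envelope x" p] by linarith
    also have "\<dots> \<le> envelope x + P * \<bar>z\<bar> + S * \<bar>z\<bar> + (K + P) * T * \<bar>z\<bar>"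
    proof -
      have "\<bar>p * z\<bar> \<le> P * \<bar>z\<bar>" using pP by (simp add: abs_mult mult_right_mono)
      moreover have "\<bar>ivp_curv (envelope x) p * z\<^sup>2 / 2\<bar> \<le> S * \<bar>z\<bar>"
      proof -
        have "\<bar>ivp_curv (envelope x) p\<bar> * z\<^sup>2 \<le> S * \<bar>z\<bar>" using s z2(1) S by (intro mult_mono) auto
        moreover have "0 \<le> \<bar>ivp_curv (envelope x) p\<bar> * z\<^sup>2" by simp
        moreover have "\<bar>ivp_curv (envelope x) p * z\<^sup>2 / 2\<bar> = \<bar>ivp_curv (envelope x) p\<bar> * z\<^sup>2 / 2" by (simp add: abs_mult)
        ultimately show ?thesis by linarith
      qed
      moreover have "(\<bar>envelope x - k\<bar> + \<bar>p\<bar>) * T * \<bar>z\<bar> ^ 3 \<le> (K + P) * T * \<bar>z\<bar>"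
        using ak pP T(1) z2(2) Kn P(1) by (intro mult_mono add_mono) auto
      ultimately show ?thesis by linarith
    qed
    also have "\<dots> \<le> envelope x + L * \<bar>z\<bar>"
    proof -
      have "0 \<le> G * \<bar>z\<bar>" "0 \<le> D * \<bar>z\<bar>" "0 \<le> K * \<bar>z\<bar>" using G_nonneg D(1) Kn by simp_all
      then show ?thesis by (simp add: L_def algebra_simps)
    qed
    finally show ?thesis by (simp add: z_def)
  next
    case False
    have "K * 1 \<le> L * \<bar>y - x\<bar>" using False Kn G_nonneg D(1) P(1) S nn unfolding L_def
      by (intro mult_mono) auto
    then show ?thesis using envelope_nonneg[of x] envelope_le_K[of y] by linarith
  qed
  have main0: "envelope y \<le> L * y" if y: "0 \<le> y" for y
  proof (cases "y \<le> 1")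
    case True
    have "envelope y \<le> D * y" using D(2) True y by simp
    also have "\<dots> \<le> L * y" using y G_nonneg Kn P(1) S nn unfolding L_def by (intro mult_right_mono) auto
    finally show ?thesis .
  next
    case False
    have "K * 1 \<le> L * y" using False Kn G_nonneg D(1) P(1) S nn unfolding L_def
      by (intro mult_mono) auto
    then show ?thesis using envelope_le_K[of y] by linarith
  qed
  have Ln: "0 \<le> L" using Kn G_nonneg D(1) P(1) S nn unfolding L_def by linarith
  have le: "envelope y \<le> envelope x + L * \<bar>y - x\<bar>" for x y
  proof (cases "y \<le> 0")
    case True
    then show ?thesis using envelope_nonneg[of x] Ln by (simp add: envelope_def[of y])
  next
    case y: False
    show ?thesis
    proof (cases "x \<le> 0")
      case True
      have "L * y \<le> L * \<bar>y - x\<bar>" using True y Ln by (intro mult_left_mono) auto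
      then show ?thesis using main0[of y] y envelope_nonneg[of x] by linarith
    next
      case False
      then show ?thesis using main y by simp
    qed
  qed
  have "\<bar>envelope x - envelope y\<bar> \<le> L * \<bar>x - y\<bar>" for x y
    using le[of x y] le[of y x] by (simp add: abs_le_iff abs_minus_commute)
  moreover have "G \<le> L" using Kn D(1) P(1) S nn unfolding L_def by linarith
  ultimately show ?thesis by blast
qed

text \<open>The solution that interpolates the envelope at \<open>a\<close> and \<open>b\<close>
  lies below the envelope inside by the maximum principle, and above it outside because a majorant
  touching at an end point crosses it there. Once this interpolant is seen to be a majorant itself,
  equality follows.\<close>

lemma envelope_harmonic:
  assumes ab: "0 < a" "a < b" and gt: "\<And>y. a \<le> y \<Longrightarrow> y \<le> b \<Longrightarrow> g y < envelope y"
  shows "\<exists>A B. \<forall>y\<in>{a..b}. envelope y = gsol A B y"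
proof -
  obtain p where p: "ivp a (envelope a) p b = envelope b" using ivp_interpolate[OF ab(2)] by blast
  define A B where "A = (p - r2 * (envelope a - k)) / (r1 - r2) * exp (- (r1 * a))"
    and "B = (r1 * (envelope a - k) - p) / (r1 - r2) * exp (- (r2 * a))"
  have H: "gsol A B = ivp a (envelope a) p" unfolding A_def B_def by (rule ivp_eq_gsol [symmetric])
  have Ha: "gsol A B a = envelope a" and Hb: "gsol A B b = envelope b" using p by (simp_all add: H)
  obtain pa where pa: "majorant (ivp a (envelope a) pa)" using envelope_touch[OF ab(1)] by blast
  obtain pb where pb: "majorant (ivp b (envelope b) pb)" using envelope_touch[of b] ab by auto
  \<comment> \<open>The majorant touching at \<open>a\<close> agrees with the interpolant at
    \<open>a\<close> and is at least as large at \<open>b\<close>, hence at most as large to the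
    left of \<open>a\<close>.\<close>
  have left: "envelope y \<le> gsol A B y" if "0 \<le> y" "y \<le> a" for y
  proof -
    have "ivp a (envelope a) p b \<le> ivp a (envelope a) pa b" using p envelope_le[OF pa, of b] ab by simp
    then have "ivp a (envelope a) pa y \<le> ivp a (envelope a) p y" using ivp_le_left[OF ab(2) that(2)] by simp
    then show ?thesis using envelope_le[OF pa that(1)] H by simp
  qed
  have right: "envelope y \<le> gsol A B y" if "b \<le> y" for y
  proof -
    obtain p' where p': "gsol A B = ivp b (envelope b) p'" using gsol_eq_ivp[of A B b] Hb by metis
    have "ivp b (envelope b) p' a \<le> ivp b (envelope b) pb a" using p' Ha envelope_le[OF pb, of a] ab by simp
    then have "ivp b (envelope b) pb y \<le> ivp b (envelope b) p' y" using ivp_le_right[OF ab(2) that] by simp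
    then show ?thesis using envelope_le[OF pb, of y] that ab p' by simp
  qed
  have between: "gsol A B y \<le> envelope y" if "a \<le> y" "y \<le> b" for y
  proof -
    have "0 < y" using ab that by simp
    then obtain py where py: "majorant (ivp y (envelope y) py)" using envelope_touch by blast
    obtain A' B' where AB': "ivp y (envelope y) py = gsol A' B'" using py unfolding majorant_def by blast
    have "gsol A B a \<le> gsol A' B' a" "gsol A B b \<le> gsol A' B' b"
      using envelope_le[OF py, of a] envelope_le[OF py, of b] ab by (simp_all add: Ha Hb AB')
    then have "gsol A B y \<le> gsol A' B' y" by (rule gsol_le_between[OF that])
    then show ?thesis by (simp add: AB' [symmetric])
  qed
  \<comment> \<open>Lift the interpolant \<open>gsol A B\<close> by the smallest multiple of \<open>exp (r2 y)\<close> that dominates \<open>g\<close> on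
    \<open>[a, b]\<close>. The result is a majorant; if the lift were positive, it would meet \<open>g\<close> in \<open>[a, b]\<close>.\<close>
  define d where "d y = (g y - gsol A B y) * exp (- (r2 * y))" for y
  have "continuous_on {a..b} d" unfolding d_def gsol_def by (intro continuous_intros g_cont)
  then obtain y0 where y0: "y0 \<in> {a..b}" "\<And>y. y \<in> {a..b} \<Longrightarrow> d y \<le> d y0"
    using continuous_attains_sup[OF compact_Icc, of a b d] ab by auto
  have shift: "gsol A (B + m) y = gsol A B y + m * exp (r2 * y)" for m y
    by (simp add: gsol_def algebra_simps)
  define m where "m = max 0 (d y0)"
  have "g y \<le> gsol A (B + m) y" if "0 \<le> y" for y
  proof (cases "y \<in> {a..b}")
    case True
    have "(g y - gsol A B y) = d y * exp (r2 * y)" by (simp add: d_def exp_minus)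
    also have "\<dots> \<le> m * exp (r2 * y)" using y0(2)[OF True] by (intro mult_right_mono) (auto simp: m_def)
    finally show ?thesis by (simp add: shift)
  next
    case False
    then have "envelope y \<le> gsol A B y" using left right that by (cases "y \<le> a") auto
    moreover have "0 \<le> m * exp (r2 * y)" by (simp add: m_def)
    ultimately show ?thesis using envelope_ge_g[of y] by (simp add: shift)
  qed
  then have mj: "majorant (gsol A (B + m))" unfolding majorant_def by blast
  have "d y0 \<le> 0"
  proof (rule ccontr)
    assume "\<not> d y0 \<le> 0"
    then have "m = d y0" by (simp add: m_def)
    moreover have "d y0 * exp (r2 * y0) = g y0 - gsol A B y0" by (simp add: d_def exp_minus)
    ultimately have "gsol A (B + m) y0 = g y0" by (simp add: shift)
    then show False using envelope_le[OF mj, of y0] gt[of y0] y0(1) ab by simp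
  qed
  then have "majorant (gsol A B)" using mj by (simp add: m_def)
  then have "envelope y = gsol A B y" if "y \<in> {a..b}" for y
    using envelope_le[of "gsol A B" y] between[of y] that ab by (intro antisym) auto
  then show ?thesis by blast
qed

lemma envelope_obstacle_sol:
  assumes ode: "sg\<^sup>2 / 2 * r1\<^sup>2 + (mu - c) * r1 = q" "sg\<^sup>2 / 2 * r2\<^sup>2 + (mu - c) * r2 = q" "c = q * k"
  shows "\<exists>L. obstacle_sol mu sg q K L c g envelope"
proof -
  obtain L where L: "G \<le> L" "\<And>x y. \<bar>envelope x - envelope y\<bar> \<le> L * \<bar>x - y\<bar>" using envelope_lipschitz by blast
  have Kn: "0 \<le> K" using k kK by simp
  have slopes: "\<exists>P\<ge>0. \<forall>x a p. 0 \<le> a \<and> a \<le> K \<and> 0 \<le> ivp x a p (x - w) \<and> 0 \<le> ivp x a p (x + w) \<longrightarrow> \<bar>p\<bar> \<le> P"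
    if "0 < w" for w
  proof -
    define P where "P = \<bar>K * ivp_value w / ivp_slope w\<bar> + \<bar>K * ivp_value (- w) / (- ivp_slope (- w))\<bar>"
    have "\<bar>p\<bar> \<le> P" if "0 \<le> a \<and> a \<le> K \<and> 0 \<le> ivp x a p (x - w) \<and> 0 \<le> ivp x a p (x + w)" for x a p
      using slope_lower[of w x a p K] slope_upper[of w x a p K] that \<open>0 < w\<close> unfolding P_def by linarith
    moreover have "0 \<le> P" by (simp add: P_def)
    ultimately show ?thesis by blast
  qed
  have above: "\<exists>M\<ge>0. \<forall>x\<ge>w. quad_bound mu sg q c 1 envelope M x" if w: "0 < w" for w
  proof -
    define u where "u = min w 1"
    have u: "0 < u" "u \<le> 1" "u \<le> w" using w by (auto simp: u_def)
    obtain P where P: "P \<ge> 0" "\<And>x a p. 0 \<le> a \<and> a \<le> K \<and> 0 \<le> ivp x a p (x - u) \<and> 0 \<le> ivp x a p (x + u) \<Longrightarrow> \<bar>p\<bar> \<le> P"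
      using slopes[OF u(1)] by blast
    obtain M where M: "M \<ge> 0" "\<And>x p f e. (e = 1 \<or> e = - 1) \<and> (\<forall>y. 0 \<le> f y \<and> f y \<le> K) \<and> \<bar>p\<bar> \<le> P
      \<and> (\<forall>z. \<bar>z\<bar> \<le> u \<longrightarrow> e * f (x + z) \<le> e * ivp x (f x) p (x + z)) \<Longrightarrow> quad_bound mu sg q c e f M x"
      using ivp_quad_bound[OF u(1,2) kK P(1) ode] by blast
    have "quad_bound mu sg q c 1 envelope M x" if x: "x \<ge> w" for x
    proof -
      obtain p where p: "majorant (ivp x (envelope x) p)" using envelope_touch[of x] x w by auto
      have "\<bar>p\<bar> \<le> P" using P(2)[of "envelope x" x p] envelope_nonneg envelope_le_K majorant_nonneg[OF p] x u by simp
      moreover have "\<forall>z. \<bar>z\<bar> \<le> u \<longrightarrow> 1 * envelope (x + z) \<le> 1 * ivp x (envelope x) p (x + z)"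
        using envelope_le[OF p] x u by auto
      ultimately show ?thesis using M(2)[of 1 envelope p x] envelope_nonneg envelope_le_K by blast
    qed
    then show ?thesis using M(1) by blast
  qed
  have below: "\<exists>M\<ge>0. \<forall>x>0. g x + w < envelope x \<longrightarrow> quad_bound mu sg q c (- 1) envelope M x" if w: "0 < w" for w
  proof -
    \<comment> \<open>The gap between envelope and obstacle changes at rate at most
      \<open>2 * L\<close>, so a gap larger than \<open>w\<close> at \<open>x\<close> stays positive
      on the window of radius \<open>u\<close>.\<close>
    define u where "u = min 1 (w / (2 * (L + 1)))"
    have Ln: "0 \<le> L" using L(1) G_nonneg by simp
    have u: "0 < u" "u \<le> 1" "2 * L * u \<le> w"
    proof -
      show "0 < u" "u \<le> 1" using w Ln by (auto simp: u_def)
      have "2 * L * u \<le> 2 * (L + 1) * (w / (2 * (L + 1)))" using w Ln by (intro mult_mono) (auto simp: u_def)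
      then show "2 * L * u \<le> w" using Ln by simp
    qed
    obtain P where P: "P \<ge> 0" "\<And>x a p. 0 \<le> a \<and> a \<le> K \<and> 0 \<le> ivp x a p (x - u) \<and> 0 \<le> ivp x a p (x + u) \<Longrightarrow> \<bar>p\<bar> \<le> P"
      using slopes[OF u(1)] by blast
    obtain M where M: "M \<ge> 0" "\<And>x p f e. (e = 1 \<or> e = - 1) \<and> (\<forall>y. 0 \<le> f y \<and> f y \<le> K) \<and> \<bar>p\<bar> \<le> P
      \<and> (\<forall>z. \<bar>z\<bar> \<le> u \<longrightarrow> e * f (x + z) \<le> e * ivp x (f x) p (x + z)) \<Longrightarrow> quad_bound mu sg q c e f M x"
      using ivp_quad_bound[OF u(1,2) kK P(1) ode] by blast
    have "quad_bound mu sg q c (- 1) envelope M x" if x: "x > 0" "g x + w < envelope x" for x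
    proof -
      have gt: "g (x + z) < envelope (x + z)" if "\<bar>z\<bar> \<le> u" for z
      proof -
        have "G * \<bar>z\<bar> \<le> L * u" "L * \<bar>z\<bar> \<le> L * u" using that L(1) Ln by (auto intro!: mult_mono)
        then show ?thesis using g_lip[of "x + z" x] L(2)[of "x + z" x] x(2) u(3) by (simp add: abs_le_iff)
      qed
      \<comment> \<open>Obstacle and envelope both vanish on the left half-line, so a window with a
        strict gap cannot reach it.\<close>
      have pos: "0 < x - u"
      proof (rule ccontr)
        assume "\<not> 0 < x - u"
        then show False using gt[of "- u"] u g0[of "x - u"] by (simp add: envelope_def)
      qed
      have "g y < envelope y" if "x - u \<le> y" "y \<le> x + u" for y using gt[of "y - x"] that by (simp add: abs_le_iff)
      then obtain A B where AB: "\<forall>y\<in>{x - u..x + u}. envelope y = gsol A B y"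
        using envelope_harmonic[of "x - u" "x + u"] pos u by auto
      have "gsol A B x = envelope x" using AB u by simp
      then obtain p where p: "gsol A B = ivp x (envelope x) p" using gsol_eq_ivp[of A B x] by metis
      have eq: "envelope y = ivp x (envelope x) p y" if "y \<in> {x - u..x + u}" for y
        unfolding p [symmetric] using AB that by blast
      have "0 \<le> ivp x (envelope x) p (x - u)" "0 \<le> ivp x (envelope x) p (x + u)"
        using envelope_nonneg[of "x - u"] envelope_nonneg[of "x + u"] u
        by (simp_all add: eq[of "x - u", symmetric] eq[of "x + u", symmetric])
      then have "\<bar>p\<bar> \<le> P" using P(2)[of "envelope x" x p] envelope_nonneg envelope_le_K by simp
      moreover have "\<forall>z. \<bar>z\<bar> \<le> u \<longrightarrow> - 1 * envelope (x + z) \<le> - 1 * ivp x (envelope x) p (x + z)"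
      proof (intro allI impI)
        fix z :: real assume "\<bar>z\<bar> \<le> u"
        then have "envelope (x + z) = ivp x (envelope x) p (x + z)" by (intro eq) (auto simp: abs_le_iff)
        then show "- 1 * envelope (x + z) \<le> - 1 * ivp x (envelope x) p (x + z)" by linarith
      qed
      ultimately show ?thesis using M(2)[of "- 1" envelope p x] envelope_nonneg envelope_le_K by blast
    qed
    then show ?thesis using M(1) by blast
  qed
  have "vclass K L envelope" unfolding vclass_def using envelope_nonneg envelope_le_K L(2) by (simp add: envelope_def)
  then show ?thesis unfolding obstacle_sol_def using envelope_ge_g above below by blast
qed

end

section \<open>Existence of the whole family of value functions\<close>

lemma vclass_mono: "vclass K L v \<Longrightarrow> L \<le> L' \<Longrightarrow> vclass K L' v"
  unfolding vclass_def by (meson abs_ge_zero mult_right_mono order_trans)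

lemma obstacle_sol_mono: "obstacle_sol mu sg q K L c g v \<Longrightarrow> L \<le> L' \<Longrightarrow> obstacle_sol mu sg q K L' c g v"
  unfolding obstacle_sol_def using vclass_mono by blast

text \<open>The bounded solution vanishing at 0 is \<open>K * (1 - exp (r2 * x))\<close>. It is
  nonpositive on the left half-line, hence lies below its truncation \<open>v\<close> everywhere and
  touches it from below at each positive point. From above it touches on windows inside the right
  half-line, where both coincide.\<close>

lemma top_level_solution:
  fixes mu sg q c :: real
  assumes sg: "0 < sg" and q: "0 < q" and c: "0 \<le> c"
  shows "\<exists>v L. obstacle_sol mu sg q (c / q) L c (\<lambda>_. - 1) v \<and> (v \<longlongrightarrow> c / q) at_top"
proof -
  obtain r1 r2 where r: "0 < r1" "r2 < 0" "sg\<^sup>2 / 2 * r1\<^sup>2 + (mu - c) * r1 = q" "sg\<^sup>2 / 2 * r2\<^sup>2 + (mu - c) * r2 = q"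
    using char_roots_exist[OF sg q] by blast
  define K where "K = c / q"
  have K: "0 \<le> K" "c = q * K" using c q by (simp_all add: K_def)
  interpret exp_pair r1 r2 K by unfold_locales (use r K in auto)
  define v where "v x = (if x \<le> 0 then 0 else K * (1 - exp (r2 * x)))" for x
  have hfv: "gsol 0 (- K) x = K * (1 - exp (r2 * x))" for x by (simp add: gsol_def algebra_simps)
  have vhf: "0 \<le> x \<Longrightarrow> v x = gsol 0 (- K) x" for x by (auto simp: v_def hfv)
  have hfle: "gsol 0 (- K) x \<le> v x" for x
  proof (cases "x \<le> 0")
    case True
    then have "1 \<le> exp (r2 * x)" using r by (simp add: mult_nonpos_nonpos)
    then show ?thesis using True K by (simp add: v_def hfv mult_nonneg_nonpos)
  next
    case False then show ?thesis using vhf by simp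
  qed
  have bnd: "0 \<le> v x \<and> v x \<le> K" for x
  proof (cases "x \<le> 0")
    case False
    then have "exp (r2 * x) \<le> 1" using r by (simp add: mult_nonpos_nonneg)
    then show ?thesis using K False by (simp add: v_def mult_left_le)
  qed (use K in \<open>simp add: v_def\<close>)
  have lip: "v y \<le> v x + K * (- r2) * \<bar>y - x\<bar>" for x y
  proof -
    have K2: "0 \<le> K * (- r2)" using K r by (intro mult_nonneg_nonneg) auto
    have a: "gsol 0 (- K) y - gsol 0 (- K) x \<le> K * (- r2) * (y - x)" if "0 \<le> x" "x \<le> y" for x y
    proof -
      have "1 - exp (r2 * (y - x)) \<le> - r2 * (y - x)" using exp_ge_add_one_self[of "r2 * (y - x)"] by linarith
      then have "exp (r2 * x) * (1 - exp (r2 * (y - x))) \<le> 1 * (- r2 * (y - x))"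
        using that r(2) by (intro mult_mono) (auto simp: mult_nonpos_nonneg)
      moreover have "exp (r2 * y) = exp (r2 * x) * exp (r2 * (y - x))" by (simp add: exp_add [symmetric] algebra_simps)
      ultimately have "exp (r2 * x) - exp (r2 * y) \<le> - r2 * (y - x)" by (simp add: algebra_simps)
      then have "K * (exp (r2 * x) - exp (r2 * y)) \<le> K * (- r2 * (y - x))" using K by (intro mult_left_mono) auto
      then show ?thesis by (simp add: hfv algebra_simps)
    qed
    have mono: "v y \<le> v x" if "y \<le> x" for x y
    proof (cases "y \<le> 0")
      case True then show ?thesis using bnd[of x] by (simp add: v_def[of y])
    next
      case False
      then have "exp (r2 * x) \<le> exp (r2 * y)" using that r by simp
      then show ?thesis using False that K by (auto simp: v_def intro!: mult_left_mono)
    qed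
    show ?thesis
    proof (cases "y \<le> x")
      case True
      then show ?thesis using mono[OF True] mult_nonneg_nonneg[OF K2 abs_ge_zero[of "y - x"]] by linarith
    next
      case False
      show ?thesis
      proof (cases "y \<le> 0")
        case True
        then have "v y = 0" by (simp add: v_def)
        then show ?thesis using bnd[of x] mult_nonneg_nonneg[OF K2 abs_ge_zero[of "y - x"]] by linarith
      next
        case y: False
        have "v y - v (max 0 x) \<le> K * (- r2) * (y - max 0 x)" using a[of "max 0 x" y] vhf y False by simp
        also have "\<dots> \<le> K * (- r2) * \<bar>y - x\<bar>" using K2 False y by (intro mult_left_mono) auto
        finally have "v y \<le> v (max 0 x) + K * (- r2) * \<bar>y - x\<bar>" by simp
        moreover have "v (max 0 x) = v x" by (simp add: max_def v_def)
        ultimately show ?thesis by simp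
      qed
    qed
  qed
  have "vclass K (K * (- r2)) v" unfolding vclass_def
  proof (intro conjI allI impI)
    show "\<bar>v x - v y\<bar> \<le> K * (- r2) * \<bar>x - y\<bar>" for x y
      using lip[of x y] lip[of y x] by (simp add: abs_le_iff abs_minus_commute)
  qed (use bnd in \<open>auto simp: v_def\<close>)
  moreover have "(\<forall>x. - 1 \<le> v x)" using bnd by (meson order_trans neg_le_0_iff_le zero_le_one)
  moreover have qb: "\<exists>M\<ge>0. \<forall>x\<ge>w. quad_bound mu sg q c 1 v M x" if w: "0 < w" for w
  proof -
    define P where "P = K * (- r2)"
    have P: "0 \<le> P" using K r by (simp add: P_def mult_nonneg_nonpos)
    obtain M where M: "M \<ge> 0" "\<And>x p f e. (e = 1 \<or> e = - 1) \<and> (\<forall>y. 0 \<le> f y \<and> f y \<le> K) \<and> \<bar>p\<bar> \<le> P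
      \<and> (\<forall>z. \<bar>z\<bar> \<le> min w 1 \<longrightarrow> e * f (x + z) \<le> e * ivp x (f x) p (x + z)) \<Longrightarrow> quad_bound mu sg q c e f M x"
      using ivp_quad_bound[of "min w 1" K P sg mu c q] w P r K by auto
    have "quad_bound mu sg q c 1 v M x" if x: "x \<ge> w" for x
    proof -
      define p where "p = r1 * (0 * exp (r1 * x)) + r2 * (- K * exp (r2 * x))"
      have ivp: "gsol 0 (- K) = ivp x (v x) p" unfolding p_def using gsol_eq_ivp[of 0 "- K" x] vhf[of x] x w by simp
      have "p = P * exp (r2 * x)" by (simp add: p_def P_def)
      moreover have "exp (r2 * x) \<le> 1" using x w r by (simp add: mult_nonpos_nonneg)
      ultimately have "\<bar>p\<bar> \<le> P" using P by (simp add: abs_mult mult_left_le)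
      moreover have "\<forall>z. \<bar>z\<bar> \<le> min w 1 \<longrightarrow> 1 * v (x + z) \<le> 1 * ivp x (v x) p (x + z)"
        using vhf x by (auto simp: ivp [symmetric])
      ultimately show ?thesis using M(2)[of 1 v p x] bnd by blast
    qed
    then show ?thesis using M(1) by blast
  qed
  moreover have "\<exists>M\<ge>0. \<forall>x>0. - 1 + w < v x \<longrightarrow> quad_bound mu sg q c (- 1) v M x" if w: "0 < w" for w
  proof -
    define P where "P = K * (- r2)"
    have P: "0 \<le> P" using K r by (simp add: P_def mult_nonneg_nonpos)
    obtain M where M: "M \<ge> 0" "\<And>x p f e. (e = 1 \<or> e = - 1) \<and> (\<forall>y. 0 \<le> f y \<and> f y \<le> K) \<and> \<bar>p\<bar> \<le> P
      \<and> (\<forall>z. \<bar>z\<bar> \<le> 1 \<longrightarrow> e * f (x + z) \<le> e * ivp x (f x) p (x + z)) \<Longrightarrow> quad_bound mu sg q c e f M x"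
      using ivp_quad_bound[of 1 K P sg mu c q] P r K by auto
    have "quad_bound mu sg q c (- 1) v M x" if x: "x > 0" for x
    proof -
      define p where "p = r1 * (0 * exp (r1 * x)) + r2 * (- K * exp (r2 * x))"
      have ivp: "gsol 0 (- K) = ivp x (v x) p" unfolding p_def using gsol_eq_ivp[of 0 "- K" x] vhf[of x] x by simp
      have "p = P * exp (r2 * x)" by (simp add: p_def P_def)
      moreover have "exp (r2 * x) \<le> 1" using x r by (simp add: mult_nonpos_nonneg)
      ultimately have "\<bar>p\<bar> \<le> P" using P by (simp add: abs_mult mult_left_le)
      moreover have "\<forall>z. \<bar>z\<bar> \<le> 1 \<longrightarrow> - 1 * v (x + z) \<le> - 1 * ivp x (v x) p (x + z)"
        using hfle by (auto simp: ivp [symmetric])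
      ultimately show ?thesis using M(2)[of "- 1" v p x] bnd by blast
    qed
    then show ?thesis using M(1) by blast
  qed
  ultimately have "obstacle_sol mu sg q K (K * (- r2)) c (\<lambda>_. - 1) v" unfolding obstacle_sol_def by blast
  moreover have "(v \<longlongrightarrow> K) at_top"
  proof -
    have "((\<lambda>x. exp (r2 * x)) \<longlongrightarrow> 0) at_top"
      using r by (intro filterlim_compose[OF exp_at_bot] filterlim_tendsto_neg_mult_at_bot[OF tendsto_const] filterlim_ident)
    then have "((\<lambda>x. K * (1 - exp (r2 * x))) \<longlongrightarrow> K * (1 - 0)) at_top" by (intro tendsto_intros)
    moreover have "\<forall>\<^sub>F x in at_top. K * (1 - exp (r2 * x)) = v x"
      using eventually_gt_at_top[of 0] by eventually_elim (simp add: v_def)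
    ultimately show ?thesis using tendsto_cong by force
  qed
  ultimately show ?thesis unfolding K_def by blast
qed

lemma obstacle_problem_solvable:
  fixes mu sg q c K G :: real
  assumes sg: "0 < sg" and q: "0 < q" and c: "0 \<le> c" "c / q \<le> K" and g: "vclass K G g"
  shows "\<exists>v L. obstacle_sol mu sg q K L c g v"
proof -
  obtain r1 r2 where r: "0 < r1" "r2 < 0" "sg\<^sup>2 / 2 * r1\<^sup>2 + (mu - c) * r1 = q" "sg\<^sup>2 / 2 * r2\<^sup>2 + (mu - c) * r2 = q"
    using char_roots_exist[OF sg q] by blast
  interpret obstacle r1 r2 "c / q" g K G
    using r c q g by unfold_locales (auto simp: vclass_def)
  show ?thesis using envelope_obstacle_sol[of sg mu c q] r q by auto
qed

text \<open>The obstacle \<open>- 1\<close> at the top level is never active, so that level needs no separate treatment.\<close>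

lemma value_family_exists:
  fixes mu sg q :: real and cs :: "nat \<Rightarrow> real"
  assumes sg: "0 < sg" and q: "0 < q" and n: "1 \<le> n" and c: "\<And>j. j \<in> {1..n} \<Longrightarrow> 0 \<le> cs j \<and> cs j \<le> cs n"
  shows "\<exists>v L. v (Suc n) = (\<lambda>_. - 1) \<and> (\<forall>j\<in>{1..n}. obstacle_sol mu sg q (cs n / q) L (cs j) (v (Suc j)) (v j)
            \<and> (v j \<longlongrightarrow> cs n / q) at_top)"
proof -
  define K where "K = cs n / q"
  \<comment> \<open>The induction on \<open>m\<close> runs downwards through the levels from
    \<open>n\<close> to \<open>n - m\<close>. The Lipschitz constant may grow from level to level,
    and a common one is kept by taking maxima, whereas the bound \<open>K\<close> is the same
    throughout.\<close>
  have "\<exists>v L. v (Suc n) = (\<lambda>_. - 1) \<and> (\<forall>j\<in>{n - m..n}. obstacle_sol mu sg q K L (cs j) (v (Suc j)) (v j)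
            \<and> (v j \<longlongrightarrow> K) at_top)" if "m < n" for m
    using that
  proof (induction m)
    case 0
    obtain v L where v: "obstacle_sol mu sg q K L (cs n) (\<lambda>_. - 1) v" "(v \<longlongrightarrow> K) at_top"
      using top_level_solution[OF sg q, of "cs n" mu] c[of n] n unfolding K_def by auto
    show ?case
      by (rule exI[of _ "\<lambda>j. if j = n then v else (\<lambda>_. - 1)"], rule exI[of _ L]) (use v in auto)
  next
    case (Suc m)
    from Suc.IH[OF Suc_lessD[OF Suc.prems]] obtain v L where v: "v (Suc n) = (\<lambda>_. - 1)"
      "\<And>j. j \<in> {n - m..n} \<Longrightarrow> obstacle_sol mu sg q K L (cs j) (v (Suc j)) (v j) \<and> (v j \<longlongrightarrow> K) at_top"
      by blast
    define i where "i = n - Suc m"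
    have i: "Suc i = n - m" "i \<in> {1..n}" using Suc.prems by (auto simp: i_def)
    have vi: "obstacle_sol mu sg q K L (cs (Suc i)) (v (Suc (Suc i))) (v (Suc i))" "(v (Suc i) \<longlongrightarrow> K) at_top"
      using v(2)[of "n - m"] i by auto
    then have "vclass K L (v (Suc i))" by (simp add: obstacle_sol_def)
    moreover have "cs i / q \<le> K" using c[OF i(2)] q by (simp add: K_def divide_right_mono)
    ultimately obtain u L' where u: "obstacle_sol mu sg q K L' (cs i) (v (Suc i)) u"
      using obstacle_problem_solvable[OF sg q, of "cs i" K L "v (Suc i)" mu] c[OF i(2)] by blast
    \<comment> \<open>The limit is inherited from the next level: \<open>u\<close> is squeezed
      between \<open>v (Suc i)\<close> and \<open>K\<close>.\<close>
    have lim: "(u \<longlongrightarrow> K) at_top"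
    proof (rule tendsto_sandwich[OF _ _ vi(2) tendsto_const])
      show "\<forall>\<^sub>F x in at_top. v (Suc i) x \<le> u x" "\<forall>\<^sub>F x in at_top. u x \<le> K"
        using u by (auto simp: obstacle_sol_def vclass_def)
    qed
    show ?case
    proof (rule exI[of _ "v(i := u)"], rule exI[of _ "max L L'"], intro conjI ballI)
      show "(v(i := u)) (Suc n) = (\<lambda>_. - 1)" using v(1) i by auto
      fix j assume j: "j \<in> {n - Suc m..n}"
      show "obstacle_sol mu sg q K (max L L') (cs j) ((v(i := u)) (Suc j)) ((v(i := u)) j)"
      proof (cases "j = i")
        case True then show ?thesis using u obstacle_sol_mono by auto
      next
        case False
        then have "j \<in> {n - m..n}" using j i by (auto simp: i_def)
        then show ?thesis using v(2)[of j] False j obstacle_sol_mono by (auto simp: i_def)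
      qed
      show "((v(i := u)) j \<longlongrightarrow> K) at_top"
      proof (cases "j = i")
        case True then show ?thesis using lim by simp
      next
        case False
        then have "j \<in> {n - m..n}" using j i by (auto simp: i_def)
        then show ?thesis using v(2)[of j] False by simp
      qed
    qed
  qed
  from this[of "n - 1"] show ?thesis using n unfolding K_def by (simp add: Suc_diff_Suc)
qed

section \<open>Viscosity supersolutions\<close>

lemma local_max_second_deriv:
  fixes h h' :: "real \<Rightarrow> real"
  assumes h: "\<And>z. (h has_real_derivative h' z) (at z)" and h': "(h' has_real_derivative d2) (at 0)"
    and d: "0 < d" "\<And>z. \<bar>z\<bar> < d \<Longrightarrow> h z \<le> h 0"
  shows "h' 0 = 0" "d2 \<le> 0"
proof -
  show 0: "h' 0 = 0" using DERIV_local_max[OF h d(1)] d(2) by auto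
  show "d2 \<le> 0"
  proof (rule ccontr)
    assume "\<not> d2 \<le> 0"
    then obtain r where r: "r > 0" "\<And>t. t > 0 \<Longrightarrow> t < r \<Longrightarrow> h' 0 < h' (0 + t)"
      using DERIV_pos_inc_right[OF h'] by auto
    define t where "t = min r d / 2"
    have t: "0 < t" "t < r" "t < d" using r d by (auto simp: t_def)
    obtain z where z: "0 < z" "z < t" "h t - h 0 = (t - 0) * h' z"
      using MVT2[OF t(1), of h h'] h by blast
    have "0 < h' z" using r(2)[of z] z t 0 by simp
    then have "h 0 < h t" using z t by (smt (verit) mult_pos_pos)
    then show False using d(2)[of t] t by simp
  qed
qed

text \<open>A test function below \<open>v\<close> is also below the paraboloid with its cubic
  error. Adding \<open>e * z^2 / 2\<close> absorbs the cubic term near the point, so the difference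
  has a local maximum there; this fixes the slope as \<open>p\<close> and bounds the second
  derivative by \<open>s + e\<close>, with \<open>e\<close> arbitrary.\<close>

lemma visc_super_of_quad_bound:
  assumes qb: "quad_bound mu sg q c 1 v M x" and M: "0 \<le> M" and g: "g x \<le> v x" and x: "0 < x"
  shows "visc_super_at mu sg q c g v x"
  unfolding visc_super_at_def
proof (intro allI impI)
  fix \<phi> \<phi>' \<phi>'' :: "real \<Rightarrow> real"
  assume "(\<forall>y. (\<phi> has_real_derivative \<phi>' y) (at y)) \<and> (\<forall>y. (\<phi>' has_real_derivative \<phi>'' y) (at y))
        \<and> continuous_on UNIV \<phi>'' \<and> \<phi> x = v x \<and> (\<forall>y\<ge>0. v x - \<phi> x \<le> v y - \<phi> y)"
  then have \<phi>: "\<And>y. (\<phi> has_real_derivative \<phi>' y) (at y)" "\<And>y. (\<phi>' has_real_derivative \<phi>'' y) (at y)"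
    "\<phi> x = v x" "\<And>y. 0 \<le> y \<Longrightarrow> \<phi> y \<le> v y" by auto
  obtain p s where ps: "sg\<^sup>2 / 2 * s + (mu - c) * p = q * v x - c"
    "\<And>z. v (x + z) \<le> v x + p * z + s * z\<^sup>2 / 2 + M * \<bar>z\<bar> ^ 3"
    using qb unfolding quad_bound_def by auto
  have *: "\<phi>' x = p \<and> \<phi>'' x \<le> s + e" if e: "0 < e" for e
  proof -
    define h where "h z = \<phi> (x + z) - p * z - (s + e) * z\<^sup>2 / 2" for z
    define h' where "h' z = \<phi>' (x + z) - p - (s + e) * z" for z
    have \<phi>sh: "((\<lambda>z. \<phi> (x + z)) has_real_derivative \<phi>' (x + z)) (at z)"
      "((\<lambda>z. \<phi>' (x + z)) has_real_derivative \<phi>'' (x + z)) (at z)" for z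
    proof -
      have "((\<lambda>z. \<phi> (x + z)) has_real_derivative \<phi>' (x + z) * 1) (at z)"
        by (rule DERIV_chain2[OF \<phi>(1)]) (auto intro!: derivative_eq_intros)
      then show "((\<lambda>z. \<phi> (x + z)) has_real_derivative \<phi>' (x + z)) (at z)" by simp
      have "((\<lambda>z. \<phi>' (x + z)) has_real_derivative \<phi>'' (x + z) * 1) (at z)"
        by (rule DERIV_chain2[OF \<phi>(2)]) (auto intro!: derivative_eq_intros)
      then show "((\<lambda>z. \<phi>' (x + z)) has_real_derivative \<phi>'' (x + z)) (at z)" by simp
    qed
    have 1: "(h has_real_derivative h' z) (at z)" for z
      unfolding h_def h'_def by (auto intro!: derivative_eq_intros \<phi>sh)
    have 2: "(h' has_real_derivative (\<phi>'' x - (s + e))) (at 0)"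
      unfolding h'_def by (auto intro!: derivative_eq_intros \<phi>sh(2)[of 0, simplified])
    \<comment> \<open>Within distance \<open>d\<close> the cubic term is at most
      \<open>e * z^2 / 2\<close>, and \<open>x + z\<close> stays in the half-line where
      \<open>\<phi>\<close> is known to lie below \<open>v\<close>.\<close>
    define d where "d = min x (e / (2 * (M + 1)))"
    have d: "0 < d" using x e M by (simp add: d_def)
    have 3: "h z \<le> h 0" if z: "\<bar>z\<bar> < d" for z
    proof -
      have "M * \<bar>z\<bar> \<le> (M + 1) * (e / (2 * (M + 1)))" using z M e by (intro mult_mono) (auto simp: d_def)
      also have "\<dots> = e / 2" using M by (simp add: field_simps)
      finally have "M * \<bar>z\<bar> \<le> e / 2" .
      then have "M * \<bar>z\<bar> * z\<^sup>2 \<le> e / 2 * z\<^sup>2" by (intro mult_right_mono) auto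
      moreover have "\<bar>z\<bar> ^ 3 = \<bar>z\<bar> * z\<^sup>2" by (simp add: power2_eq_square power3_eq_cube abs_mult_self_eq)
      ultimately have "M * \<bar>z\<bar> ^ 3 \<le> e * z\<^sup>2 / 2" by simp
      moreover have "\<phi> (x + z) \<le> v (x + z)" using z by (intro \<phi>(4)) (auto simp: d_def)
      moreover have "h z = \<phi> (x + z) - p * z - s * z\<^sup>2 / 2 - e * z\<^sup>2 / 2" "h 0 = v x"
        using \<phi>(3) by (simp_all add: h_def field_simps)
      ultimately show ?thesis using ps(2)[of z] by linarith
    qed
    from local_max_second_deriv[OF 1 2 d 3] show ?thesis by (simp add: h'_def)
  qed
  have "\<phi>' x = p" using *[of 1] by simp
  moreover have "\<phi>'' x \<le> s" by (rule field_le_epsilon) (use * in blast)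
  then have "sg\<^sup>2 / 2 * \<phi>'' x \<le> sg\<^sup>2 / 2 * s" by (intro mult_left_mono) auto
  ultimately have "Lop mu sg q c \<phi> \<phi>' \<phi>'' x \<le> 0" unfolding Lop_def using ps(1) \<phi>(3) by simp
  then show "max (Lop mu sg q c \<phi> \<phi>' \<phi>'' x) (g x - \<phi> x) \<le> 0" using g \<phi>(3) by simp
qed

lemma visc_super_at_cong:
  assumes "\<And>y. 0 \<le> y \<Longrightarrow> u y = u' y" "g x = g' x" "0 \<le> x"
  shows "visc_super_at mu sg q c g u x \<longleftrightarrow> visc_super_at mu sg q c g' u' x"
  unfolding visc_super_at_def using assms by (intro iff_allI) auto

lemma loc_lipschitz_continuous:
  assumes "loc_lipschitz_nonneg u" shows "continuous_on {0..} u"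
proof (rule continuous_onI)
  fix x e :: real assume x: "x \<in> {0..}" and e: "0 < e"
  obtain r L where r: "r > 0" "\<And>y z. y \<in> cball x r \<inter> {0..} \<Longrightarrow> z \<in> cball x r \<inter> {0..} \<Longrightarrow> \<bar>u y - u z\<bar> \<le> L * \<bar>y - z\<bar>"
    using assms x unfolding loc_lipschitz_nonneg_def by (metis atLeast_iff)
  define d where "d = min r (e / (\<bar>L\<bar> + 1))"
  have d: "0 < d" using r e by (simp add: d_def)
  have "dist (u y) (u x) \<le> e" if y: "y \<in> {0..}" "dist y x < d" for y
  proof -
    have "\<bar>u y - u x\<bar> \<le> L * \<bar>y - x\<bar>" using r x y by (intro r(2)) (auto simp: d_def dist_commute)
    also have "\<dots> \<le> (\<bar>L\<bar> + 1) * (e / (\<bar>L\<bar> + 1))"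
      using y e by (intro mult_mono) (auto simp: d_def dist_real_def)
    finally show ?thesis by (simp add: dist_real_def)
  qed
  then show "\<exists>d>0. \<forall>x'\<in>{0..}. dist x' x < d \<longrightarrow> dist (u x') (u x) \<le> e" using d by blast
qed

lemma continuous_attains_inf_halfline:
  fixes f :: "real \<Rightarrow> real"
  assumes f: "continuous_on {0..} f" and x0: "0 \<le> x0" and ev: "\<forall>\<^sub>F x in at_top. f x0 \<le> f x"
  shows "\<exists>x\<ge>0. \<forall>y\<ge>0. f x \<le> f y"
proof -
  obtain R where R: "\<And>x. R \<le> x \<Longrightarrow> f x0 \<le> f x" using ev by (auto simp: eventually_at_top_linorder)
  define b where "b = max x0 R"
  have fb: "continuous_on {0..b} f" using f by (rule continuous_on_subset) auto
  have "{0..b} \<noteq> {}" using x0 by (simp add: b_def)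
  from continuous_attains_inf[OF compact_Icc this fb]
  obtain x where x: "x \<in> {0..b}" "\<And>y. y \<in> {0..b} \<Longrightarrow> f x \<le> f y" by blast
  have "f x \<le> f y" if "0 \<le> y" for y
  proof (cases "y \<le> b")
    case True then show ?thesis using x(2)[of y] that by simp
  next
    case False
    then have "f x0 \<le> f y" using R by (simp add: b_def)
    then show ?thesis using x(2)[of x0] x0 by (simp add: b_def)
  qed
  then show ?thesis using x(1) by auto
qed

text \<open>The inequality is immediate at points where \<open>u\<close> is touched from below by a smooth function; the
  minimisers of \<open>u y + m (y - x0)^2\<close> are such points and converge to \<open>x0\<close>.\<close>

lemma supersolution_ge_obstacle:
  assumes u: "continuous_on {0..} u" and g: "continuous_on {0..} g" and x0: "0 < x0"
    and lb: "\<And>y. 0 \<le> y \<Longrightarrow> B \<le> u y"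
    and vs: "\<And>x. 0 < x \<Longrightarrow> visc_super_at mu sg q c g u x"
  shows "g x0 \<le> u x0"
proof -
  define xs where "xs m = (SOME x. 0 \<le> x \<and> (\<forall>y\<ge>0. u x + real (Suc m) * (x - x0)\<^sup>2 \<le> u y + real (Suc m) * (y - x0)\<^sup>2))" for m
  have xs: "0 \<le> xs m \<and> (\<forall>y\<ge>0. u (xs m) + real (Suc m) * (xs m - x0)\<^sup>2 \<le> u y + real (Suc m) * (y - x0)\<^sup>2)" for m
    unfolding xs_def
  proof (rule someI_ex)
    have "\<forall>\<^sub>F x in at_top. u x0 \<le> u x + real (Suc m) * (x - x0)\<^sup>2"
      using eventually_ge_at_top[of "max 0 (x0 + 1 + \<bar>u x0 - B\<bar>)"]
    proof eventually_elim
      case (elim x)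
      then have 1: "1 + \<bar>u x0 - B\<bar> \<le> x - x0" "0 \<le> x" by auto
      then have "(x - x0) * 1 \<le> (x - x0) * (x - x0)" by (intro mult_left_mono) auto
      also have "\<dots> \<le> real (Suc m) * ((x - x0) * (x - x0))" using mult_right_mono[of 1 "real (Suc m)" "(x - x0) * (x - x0)"] by simp
      finally have "\<bar>u x0 - B\<bar> \<le> real (Suc m) * (x - x0)\<^sup>2" using 1 by (simp add: power2_eq_square)
      then show ?case using lb[OF 1(2)] by linarith
    qed
    then show "\<exists>x. 0 \<le> x \<and> (\<forall>y\<ge>0. u x + real (Suc m) * (x - x0)\<^sup>2 \<le> u y + real (Suc m) * (y - x0)\<^sup>2)"
      using x0 by (intro continuous_attains_inf_halfline[of _ x0] continuous_intros u) auto
  qed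
  \<comment> \<open>Comparison with the competitor \<open>x0\<close> bounds the penalty by
    \<open>D\<close>, so the squared distance of the minimisers from \<open>x0\<close> is at most
    \<open>D / (m + 1)\<close>.\<close>
  define D where "D = u x0 - B"
  have bound: "real (Suc m) * (xs m - x0)\<^sup>2 \<le> D" for m
    using xs[of m, THEN conjunct2, rule_format, of x0] xs[of m, THEN conjunct1] lb[of "xs m"] x0
    unfolding D_def by simp
  have "(\<lambda>m. (xs m - x0)\<^sup>2) \<longlonglongrightarrow> 0"
  proof (rule real_tendsto_sandwich[of "\<lambda>_. 0" _ _ "\<lambda>m. D / real (Suc m)"])
    show "\<forall>\<^sub>F m in sequentially. (xs m - x0)\<^sup>2 \<le> D / real (Suc m)"
      using bound by (intro always_eventually allI) (simp add: pos_le_divide_eq mult.commute del: of_nat_Suc)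
    show "(\<lambda>m. D / real (Suc m)) \<longlonglongrightarrow> 0" by (rule LIMSEQ_Suc[OF lim_const_over_n])
  qed auto
  then have "(\<lambda>m. sqrt ((xs m - x0)\<^sup>2)) \<longlonglongrightarrow> sqrt 0" by (rule tendsto_real_sqrt)
  then have lim: "xs \<longlonglongrightarrow> x0" by (simp add: tendsto_rabs_zero_iff LIM_zero_iff)
  have "g (xs m) \<le> u (xs m)" if pos: "0 < xs m" for m
  proof -
    define k where "k = real (Suc m)"
    define \<phi> where "\<phi> y = u (xs m) + k * (xs m - x0)\<^sup>2 - k * (y - x0)\<^sup>2" for y
    have "(\<phi> has_real_derivative (- 2 * k * (y - x0))) (at y)" for y
      unfolding \<phi>_def by (auto intro!: derivative_eq_intros)
    moreover have "((\<lambda>y. - 2 * k * (y - x0)) has_real_derivative (- 2 * k)) (at y)" for y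
      by (auto intro!: derivative_eq_intros)
    moreover have "\<phi> (xs m) = u (xs m)" by (simp add: \<phi>_def)
    moreover have "\<forall>y\<ge>0. u (xs m) - \<phi> (xs m) \<le> u y - \<phi> y" using xs[of m] by (auto simp: \<phi>_def k_def)
    ultimately have "max (Lop mu sg q c \<phi> (\<lambda>y. - 2 * k * (y - x0)) (\<lambda>y. - 2 * k) (xs m)) (g (xs m) - \<phi> (xs m)) \<le> 0"
      using vs[OF pos, unfolded visc_super_at_def, rule_format, of \<phi> "\<lambda>y. - 2 * k * (y - x0)" "\<lambda>y. - 2 * k"]
      by (simp del: max.bounded_iff)
    then show ?thesis using \<open>\<phi> (xs m) = u (xs m)\<close> by simp
  qed
  moreover have "\<forall>\<^sub>F m in sequentially. 0 < xs m" using order_tendstoD(1)[OF lim x0] .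
  ultimately have ev: "\<forall>\<^sub>F m in sequentially. g (xs m) \<le> u (xs m)" by (simp add: eventually_mono)
  have cont: "(\<lambda>m. f (xs m)) \<longlonglongrightarrow> f x0" if "continuous_on {0..} f" for f :: "real \<Rightarrow> real"
    using that lim x0 xs by (intro continuous_on_tendsto_compose[OF that]) auto
  show ?thesis using tendsto_le[OF sequentially_bot cont[OF u] cont[OF g] ev] .
qed

lemma supersolution_ge_solution:
  assumes sol: "obstacle_sol mu sg q K L c g v" and q: "0 < q" and sg: "0 < sg" and g: "vclass K L g"
    and Vn: "\<And>x. 0 \<le> x \<Longrightarrow> Vn x = g x" and sup: "admissible_super mu sg q c cbar Vn u" and K: "K = cbar / q"
    and x: "0 \<le> x"
  shows "v x \<le> u x"
proof (rule ccontr)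
  assume neg: "\<not> v x \<le> u x"
  have v: "vclass K L v" using sol by (simp add: obstacle_sol_def)
  have cont: "continuous_on S f" if "vclass K L f" for f S
  proof (rule lipschitz_on_continuous_on[of "\<bar>L\<bar>"], rule lipschitz_onI)
    fix a b
    have "\<bar>f a - f b\<bar> \<le> L * \<bar>a - b\<bar>" using that by (simp add: vclass_def)
    also have "\<dots> \<le> \<bar>L\<bar> * \<bar>a - b\<bar>" by (intro mult_right_mono) auto
    finally show "dist (f a) (f b) \<le> \<bar>L\<bar> * dist a b" by (simp add: dist_real_def)
  qed simp
  have u: "continuous_on {0..} u" using sup loc_lipschitz_continuous by (simp add: admissible_super_def)
  have u0: "u 0 = 0" using sup by (simp add: admissible_super_def)
  obtain l where l: "((\<lambda>x. ereal (u x)) \<longlongrightarrow> l) at_top" "ereal K \<le> l"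
    using sup unfolding admissible_super_def K by blast
  have evu: "\<forall>\<^sub>F y in at_top. m < u y" if "m < K" for m
  proof -
    have "ereal m < l" using that l(2) by (metis ereal_less_eq(3) less_le_trans less_ereal.simps(1))
    from order_tendstoD(1)[OF l(1) this] show ?thesis by simp
  qed
  define f where "f y = u y - v y" for y
  have fc: "continuous_on {0..} f" unfolding f_def by (intro continuous_intros u cont v)
  \<comment> \<open>Far out \<open>u\<close> exceeds \<open>K + f x\<close> while \<open>v\<close>
    never exceeds \<open>K\<close>; the negative value \<open>f x\<close> is thus not undercut at
    infinity and \<open>f\<close> attains its minimum.\<close>
  have fx: "f x < 0" using neg by (simp add: f_def)
  have "\<forall>\<^sub>F y in at_top. f x \<le> f y"
    using evu[of "K + f x"] fx
  proof (simp, elim eventually_mono)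
    fix y assume "K + f x < u y"
    moreover have "v y \<le> K" using v by (simp add: vclass_def)
    ultimately show "f x \<le> f y" by (simp add: f_def)
  qed
  then obtain y where y: "0 \<le> y" "\<And>z. 0 \<le> z \<Longrightarrow> f y \<le> f z"
    using continuous_attains_inf_halfline[OF fc x] by blast
  have fy: "f y < 0" using y(2)[OF x] fx by simp
  have ypos: "0 < y"
  proof (rule ccontr)
    assume "\<not> 0 < y"
    then have "y = 0" using y by simp
    then show False using fy u0 v by (simp add: f_def vclass_def)
  qed
  have "\<exists>B. \<forall>z\<ge>0. B \<le> u z"
  proof -
    have "\<forall>z\<ge>0. f y \<le> u z" 
    proof (intro allI impI)
      fix z :: real assume "0 \<le> z"
      then have "f y \<le> f z" using y(2) by blast
      moreover have "0 \<le> v z" using v by (simp add: vclass_def)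
      ultimately show "f y \<le> u z" by (simp add: f_def)
    qed
    then show ?thesis by blast
  qed
  then obtain B where B: "\<And>z. 0 \<le> z \<Longrightarrow> B \<le> u z" by blast
  have vsu: "visc_super_at mu sg q c g u z" if "0 < z" for z
  proof -
    have "visc_super_at mu sg q c Vn u z" using sup that by (simp add: admissible_super_def)
    then show ?thesis using visc_super_at_cong[of u u Vn z g] Vn[of z] that by simp
  qed
  have "g y \<le> u y" using supersolution_ge_obstacle[OF u cont[OF g] ypos B vsu] .
  moreover have "u y = v y + f y" by (simp add: f_def)
  ultimately have "g y + - f y / 2 < v y" using fy by linarith
  moreover have "0 < - f y / 2" using fy by simp
  ultimately obtain M where M: "0 \<le> M" "quad_bound mu sg q c (- 1) v M y"
    using sol ypos unfolding obstacle_sol_def by meson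
  obtain p s where ps: "sg\<^sup>2 / 2 * s + (mu - c) * p = q * v y - c"
    "\<And>z. v y + p * z + s * z\<^sup>2 / 2 - M * \<bar>z\<bar> ^ 3 \<le> v (y + z)"
    using M(2) unfolding quad_bound_def by (auto simp: algebra_simps)
  \<comment> \<open>Lowering the curvature by \<open>e\<close> costs \<open>sg^2 / 2 * e\<close>,
    which is half of the excess \<open>q * (v y - u y)\<close> gained because \<open>u\<close> lies
    below \<open>v\<close> at \<open>y\<close>.\<close>
  define e where "e = - q * f y / sg\<^sup>2"
  have e: "0 < e" using q fy sg by (simp add: e_def divide_neg_pos mult_pos_neg)
  \<comment> \<open>Completing a square gives \<open>M * |z|^3 \<le> e * z^2 / 2 + A * z^4\<close>.
    The quartic replaces the cubic error by a polynomial whose first two derivatives vanish at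
    \<open>y\<close>.\<close>
  define A where "A = M\<^sup>2 / (2 * e)"
  define \<phi> where "\<phi> t = u y + p * (t - y) + (s - e) * (t - y)\<^sup>2 / 2 - A * (t - y) ^ 4" for t
  define \<phi>' where "\<phi>' t = p + (s - e) * (t - y) - 4 * A * (t - y) ^ 3" for t
  define \<phi>'' where "\<phi>'' t = (s - e) - 12 * A * (t - y)\<^sup>2" for t
  have "(\<phi> has_real_derivative \<phi>' t) (at t)" for t
    unfolding \<phi>_def \<phi>'_def by (auto intro!: derivative_eq_intros simp: field_simps)
  moreover have "(\<phi>' has_real_derivative \<phi>'' t) (at t)" for t
    unfolding \<phi>'_def \<phi>''_def by (auto intro!: derivative_eq_intros simp: field_simps)
  moreover have "continuous_on UNIV \<phi>''" unfolding \<phi>''_def by (intro continuous_intros)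
  moreover have \<phi>y: "\<phi> y = u y" by (simp add: \<phi>_def)
  moreover have "\<forall>t\<ge>0. u y - \<phi> y \<le> u t - \<phi> t"
  proof (intro allI impI)
    fix t :: real assume t: "0 \<le> t"
    define z where "z = t - y"
    have "0 \<le> (e * \<bar>z\<bar> - M * z\<^sup>2)\<^sup>2" by simp
    also have "\<dots> = e\<^sup>2 * z\<^sup>2 - 2 * e * M * \<bar>z\<bar> ^ 3 + M\<^sup>2 * z ^ 4"
    proof -
      have a: "\<bar>z\<bar> * z\<^sup>2 = \<bar>z\<bar> ^ 3" by (simp add: power3_eq_cube power2_eq_square abs_mult_self_eq)
      have "(e * \<bar>z\<bar> - M * z\<^sup>2)\<^sup>2 = e\<^sup>2 * \<bar>z\<bar>\<^sup>2 - 2 * e * M * (\<bar>z\<bar> * z\<^sup>2) + M\<^sup>2 * z ^ 4"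
        by (simp add: power2_diff power_mult_distrib)
      then show ?thesis unfolding a by simp
    qed
    finally have "2 * e * (M * \<bar>z\<bar> ^ 3) \<le> 2 * e * (e * z\<^sup>2 / 2 + A * z ^ 4)"
      using e by (simp add: A_def distrib_left power2_eq_square) 
    then have "M * \<bar>z\<bar> ^ 3 \<le> e * z\<^sup>2 / 2 + A * z ^ 4" using e by (simp only: mult_le_cancel_left_pos mult_pos_pos zero_less_numeral)
    moreover have "\<phi> t = u y + p * z + s * z\<^sup>2 / 2 - e * z\<^sup>2 / 2 - A * z ^ 4"
      unfolding \<phi>_def z_def by (simp add: field_simps)
    moreover have "v y + p * z + s * z\<^sup>2 / 2 - M * \<bar>z\<bar> ^ 3 \<le> v t" using ps(2)[of z] by (simp add: z_def)
    moreover have "u y - v y \<le> u t - v t" using y(2)[OF t] by (simp add: f_def)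
    ultimately show "u y - \<phi> y \<le> u t - \<phi> t" using \<phi>y by linarith
  qed
  ultimately have "Lop mu sg q c \<phi> \<phi>' \<phi>'' y \<le> 0"
    using vsu[OF ypos] unfolding visc_super_at_def by (metis max.bounded_iff)
  then have "sg\<^sup>2 / 2 * (s - e) + (mu - c) * p - q * u y + c \<le> 0"
    by (simp add: Lop_def \<phi>_def \<phi>'_def \<phi>''_def)
  moreover have "sg\<^sup>2 / 2 * (s - e) = sg\<^sup>2 / 2 * s - sg\<^sup>2 / 2 * e" by (rule right_diff_distrib)
  ultimately have "q * v y - q * u y \<le> sg\<^sup>2 / 2 * e" using ps(1) by linarith
  also have "sg\<^sup>2 / 2 * e = - q * f y / 2" using sg by (simp add: e_def)
  finally have "q * (- f y) \<le> q * (- f y) / 2" by (simp add: f_def algebra_simps)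
  then show False using q fy by (simp add: mult_less_0_iff)
qed

lemma solution_admissible_super:
  assumes sol: "obstacle_sol mu sg q K L c g v" and K: "K = cbar / q"
    and lim: "(v \<longlongrightarrow> K) at_top"
    and Vn: "\<And>x. 0 \<le> x \<Longrightarrow> Vn x = g x" and V: "\<And>x. 0 \<le> x \<Longrightarrow> V x = v x"
  shows "admissible_super mu sg q c cbar Vn V"
proof -
  have v: "vclass K L v" using sol by (simp add: obstacle_sol_def)
  have "loc_lipschitz_nonneg V" unfolding loc_lipschitz_nonneg_def
    using v V by (intro allI impI exI[of _ "1::real"] conjI zero_less_one exI[of _ L] ballI) (auto simp: vclass_def)
  moreover have "visc_super_at mu sg q c Vn V x" if x: "0 < x" for x
  proof -
    obtain M where "0 \<le> M" "quad_bound mu sg q c 1 v M x" using sol x unfolding obstacle_sol_def by blast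
    then have "visc_super_at mu sg q c g v x"
      using visc_super_of_quad_bound sol x unfolding obstacle_sol_def by blast
    then show ?thesis using visc_super_at_cong[of V v Vn x g] V Vn x by simp
  qed
  moreover have "V 0 = 0" using V[of 0] v by (simp add: vclass_def)
  moreover have "((\<lambda>x. ereal (V x)) \<longlongrightarrow> ereal K) at_top"
  proof -
    have "((\<lambda>x. ereal (v x)) \<longlongrightarrow> ereal K) at_top" using lim by simp
    moreover have "\<forall>\<^sub>F x in at_top. ereal (v x) = ereal (V x)"
      using eventually_ge_at_top[of 0] by eventually_elim (simp add: V)
    ultimately show ?thesis by (rule Lim_transform_eventually)
  qed
  ultimately show ?thesis unfolding admissible_super_def K by blast
qed

section \<open>Gaussian steps\<close>

definition gauss :: "real \<Rightarrow> real measure" where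
  "gauss d = density lborel (\<lambda>y. ennreal (normal_density 0 (sqrt d) y))"

lemma sets_gauss [simp, measurable_cong]: "sets (gauss d) = sets borel" and space_gauss [simp]: "space (gauss d) = UNIV"
  by (simp_all add: gauss_def)

lemma prob_space_gauss: "0 < d \<Longrightarrow> prob_space (gauss d)"
  unfolding gauss_def by (intro prob_space_normal_density) simp

lemma gauss_moments:
  assumes d: "0 < d"
  shows "integrable (gauss d) (\<lambda>y. y)" "(\<integral>y. y \<partial>gauss d) = 0"
    "integrable (gauss d) (\<lambda>y. y\<^sup>2)" "(\<integral>y. y\<^sup>2 \<partial>gauss d) = d"
    "integrable (gauss d) (\<lambda>y. \<bar>y\<bar> ^ 3)" "(\<integral>y. \<bar>y\<bar> ^ 3 \<partial>gauss d) \<le> 2 * d * sqrt d"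
proof -
  have s: "0 < sqrt d" using d by simp
  have tr: "integrable (gauss d) f \<and> (\<integral>y. f y \<partial>gauss d) = r"
    if "has_bochner_integral lborel (\<lambda>y. normal_density 0 (sqrt d) y * f y) r" "f \<in> borel_measurable borel" for f r
    using that unfolding gauss_def
    by (auto simp: has_bochner_integral_iff integrable_real_density integral_real_density)
  show "integrable (gauss d) (\<lambda>y. y)" "(\<integral>y. y \<partial>gauss d) = 0"
    using tr[of "\<lambda>y. y" 0] normal_moment_odd[OF s, of 0 0] by simp_all
  show "integrable (gauss d) (\<lambda>y. y\<^sup>2)" "(\<integral>y. y\<^sup>2 \<partial>gauss d) = d"
    using tr[of "\<lambda>y. y\<^sup>2" d] normal_moment_even[OF s, of 0 1] d by simp_all
  have 3: "has_bochner_integral lborel (\<lambda>y. normal_density 0 (sqrt d) y * \<bar>y\<bar> ^ 3) (2 * (sqrt d) ^ 3 * sqrt (2 / pi))"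
    using normal_moment_abs_odd[OF s, of 0 1] by (simp add: numeral_3_eq_3)
  show "integrable (gauss d) (\<lambda>y. \<bar>y\<bar> ^ 3)"
    using tr[OF 3] by simp
  have "(\<integral>y. \<bar>y\<bar> ^ 3 \<partial>gauss d) = 2 * (sqrt d) ^ 3 * sqrt (2 / pi)" using tr[OF 3] by simp
  also have "\<dots> \<le> 2 * (sqrt d) ^ 3 * 1"
    using pi_gt3 d by (intro mult_left_mono) (auto intro!: real_le_lsqrt simp: divide_le_eq)
  also have "(sqrt d) ^ 3 = d * sqrt d" using d by (simp add: power3_eq_cube)
  finally show "(\<integral>y. \<bar>y\<bar> ^ 3 \<partial>gauss d) \<le> 2 * d * sqrt d" by simp
qed

text \<open>The summands come from the squared drift, the cubed drift and the cubed diffusion term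
  in \<open>gauss_step\<close>: 4 is the constant of \<open>cube_add_le\<close>, and 8 is 4 times
  the bound 2 for the third absolute moment.\<close>

definition step_const :: "real \<Rightarrow> real \<Rightarrow> real" where
  "step_const b sg = b\<^sup>2 / 2 + 4 * \<bar>b\<bar> ^ 3 + 8 * \<bar>sg\<bar> ^ 3"

lemma step_const_nonneg: "0 \<le> step_const b sg"
  by (simp add: step_const_def)

lemma cube_add_le: "(\<bar>a + b\<bar>) ^ 3 \<le> 4 * (\<bar>a\<bar> ^ 3 + \<bar>b\<bar> ^ 3)" for a b :: real
proof -
  have "\<bar>a + b\<bar> ^ 3 \<le> (\<bar>a\<bar> + \<bar>b\<bar>) ^ 3" by (intro power_mono) auto
  also have "4 * (u ^ 3 + v ^ 3) - (u + v) ^ 3 = 3 * (u + v) * (u - v)\<^sup>2" for u v :: real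
    by (simp add: power3_eq_cube power2_eq_square algebra_simps)
  then have "(\<bar>a\<bar> + \<bar>b\<bar>) ^ 3 \<le> 4 * (\<bar>a\<bar> ^ 3 + \<bar>b\<bar> ^ 3)"
    by (smt (verit, best) abs_ge_zero mult_nonneg_nonneg zero_le_power2)
  finally show ?thesis .
qed

text \<open>Moments up to order two integrate the paraboloid exactly; slope and curvature then
  combine to the generator, which the touching condition replaces by \<open>q * f x - c\<close>.
  Only the cubic term and the squared drift leave an error. The sign \<open>e\<close> lets one
  estimate serve both verification arguments.\<close>

lemma gauss_step:
  assumes qb: "quad_bound mu sg q c e f M x" and e: "e = 1 \<or> e = - 1" and M: "0 \<le> M"
    and f: "f \<in> borel_measurable borel" "\<And>y. 0 \<le> f y \<and> f y \<le> K" and d: "0 < d" "d \<le> 1"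
  shows "e * (\<integral>y. f (x + (mu - c) * d + sg * y) \<partial>gauss d)
     \<le> e * (f x * (1 + q * d) - c * d) + M * step_const (mu - c) sg * (d * sqrt d)"
proof -
  interpret prob_space "gauss d" by (rule prob_space_gauss[OF d(1)])
  obtain p s where ps: "\<bar>s\<bar> \<le> M" "sg\<^sup>2 / 2 * s + (mu - c) * p = q * f x - c"
    "\<And>z. e * f (x + z) \<le> e * (f x + p * z + s * z\<^sup>2 / 2) + M * \<bar>z\<bar> ^ 3"
    using qb unfolding quad_bound_def by blast
  define b where "b = mu - c"
  \<comment> \<open>Since \<open>d \<le> 1\<close>, the powers \<open>d^2\<close> and
    \<open>d^3\<close> are absorbed into \<open>d * sqrt d\<close>.\<close>
  have d3: "d * d \<le> d * sqrt d" "d * d * d \<le> d * sqrt d"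
  proof -
    have "d \<le> sqrt d" using d by (intro real_le_rsqrt) (simp add: power2_eq_square mult_left_le)
    then show 1: "d * d \<le> d * sqrt d" using d by simp
    have "d * d * d \<le> d * d" using d by (simp add: mult_left_le)
    then show "d * d * d \<le> d * sqrt d" using 1 by linarith
  qed
  note mom = gauss_moments[OF d(1)]
  define R where "R y = e * (f x + p * (b * d) + s * (b * d)\<^sup>2 / 2) + e * (p * sg + s * (b * d) * sg) * y
      + e * (s * sg\<^sup>2 / 2) * y\<^sup>2 + M * 4 * (\<bar>b * d\<bar> ^ 3 + \<bar>sg\<bar> ^ 3 * \<bar>y\<bar> ^ 3)" for y
  have iR: "integrable (gauss d) R" unfolding R_def using mom by simp
  have if': "integrable (gauss d) (\<lambda>y. f (x + b * d + sg * y))"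
    using f by (intro integrable_const_bound[where B=K]) (auto intro!: AE_I2)
  have "e * (\<integral>y. f (x + b * d + sg * y) \<partial>gauss d) = (\<integral>y. e * f (x + b * d + sg * y) \<partial>gauss d)" by simp
  also have "\<dots> \<le> (\<integral>y. R y \<partial>gauss d)"
  proof (rule integral_mono)
    fix y
    define z where "z = b * d + sg * y"
    have "\<bar>z\<bar> ^ 3 \<le> 4 * (\<bar>b * d\<bar> ^ 3 + \<bar>sg\<bar> ^ 3 * \<bar>y\<bar> ^ 3)"
      unfolding z_def using cube_add_le[of "b * d" "sg * y"] by (simp add: abs_mult power_mult_distrib)
    then have "M * \<bar>z\<bar> ^ 3 \<le> M * (4 * (\<bar>b * d\<bar> ^ 3 + \<bar>sg\<bar> ^ 3 * \<bar>y\<bar> ^ 3))" using M by (rule mult_left_mono)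
    then have "M * \<bar>z\<bar> ^ 3 \<le> M * 4 * (\<bar>b * d\<bar> ^ 3 + \<bar>sg\<bar> ^ 3 * \<bar>y\<bar> ^ 3)" by (simp only: mult.assoc)
    moreover have "e * (f x + p * z + s * z\<^sup>2 / 2) = e * (f x + p * (b * d) + s * (b * d)\<^sup>2 / 2) + e * (p * sg + s * (b * d) * sg) * y
      + e * (s * sg\<^sup>2 / 2) * y\<^sup>2"
      unfolding z_def by (simp add: field_simps power2_eq_square)
    moreover have "x + b * d + sg * y = x + z" by (simp add: z_def)
    ultimately show "e * f (x + b * d + sg * y) \<le> R y"
      using ps(3)[of z] unfolding R_def by (simp only:)
  qed (use iR if' in auto)
  also have "\<dots> = e * (f x + p * (b * d) + s * (b * d)\<^sup>2 / 2) + e * (s * sg\<^sup>2 / 2) * d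
      + M * 4 * (\<bar>b * d\<bar> ^ 3 + \<bar>sg\<bar> ^ 3 * (\<integral>y. \<bar>y\<bar> ^ 3 \<partial>gauss d))"
    unfolding R_def using mom prob_space by simp
  also have "\<dots> \<le> e * (f x + p * (b * d) + s * (b * d)\<^sup>2 / 2) + e * (s * sg\<^sup>2 / 2) * d
      + M * 4 * (\<bar>b * d\<bar> ^ 3 + \<bar>sg\<bar> ^ 3 * (2 * d * sqrt d))"
    using mom(6) M by (intro add_left_mono mult_left_mono) auto
  also have "\<dots> = e * (f x * (1 + q * d) - c * d) + (e * s) * b\<^sup>2 / 2 * (d * d) + M * 4 * \<bar>b\<bar> ^ 3 * (d * d * d) + M * 8 * \<bar>sg\<bar> ^ 3 * (d * sqrt d)"
  proof -
    have "e * (f x + p * (b * d) + s * (b * d)\<^sup>2 / 2) + e * (s * sg\<^sup>2 / 2) * d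
       = e * (f x + d * (sg\<^sup>2 / 2 * s + b * p)) + (e * s) * b\<^sup>2 / 2 * (d * d)"
      by (simp add: field_simps power2_eq_square)
    then have "e * (f x + p * (b * d) + s * (b * d)\<^sup>2 / 2) + e * (s * sg\<^sup>2 / 2) * d
       = e * (f x + d * (q * f x - c)) + (e * s) * b\<^sup>2 / 2 * (d * d)"
      unfolding ps(2)[folded b_def] .
    moreover have "\<bar>b * d\<bar> ^ 3 = \<bar>b\<bar> ^ 3 * (d * d * d)" using d by (simp add: abs_mult power3_eq_cube)
    ultimately show ?thesis by (simp add: algebra_simps)
  qed
  also have "\<dots> \<le> e * (f x * (1 + q * d) - c * d) + M * b\<^sup>2 / 2 * (d * sqrt d) + M * 4 * \<bar>b\<bar> ^ 3 * (d * sqrt d) + M * 8 * \<bar>sg\<bar> ^ 3 * (d * sqrt d)"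
  proof -
    have "e * s \<le> M" using ps(1) e by auto
    then have "(e * s) * b\<^sup>2 / 2 \<le> M * b\<^sup>2 / 2" by (intro divide_right_mono mult_right_mono) auto
    then have "(e * s) * b\<^sup>2 / 2 * (d * d) \<le> M * b\<^sup>2 / 2 * (d * sqrt d)"
      by (rule mult_mono[OF _ d3(1)]) (use M d in auto)
    moreover have "M * 4 * \<bar>b\<bar> ^ 3 * (d * d * d) \<le> M * 4 * \<bar>b\<bar> ^ 3 * (d * sqrt d)"
      using d3 M by (intro mult_left_mono) auto
    ultimately show ?thesis by linarith
  qed
  also have "\<dots> = e * (f x * (1 + q * d) - c * d) + M * step_const b sg * (d * sqrt d)"
    by (simp add: step_const_def algebra_simps)
  finally show ?thesis unfolding b_def .
qed

section \<open>Independence of Brownian increments\<close>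

locale brownian_surplus =
  fixes M :: "'a measure" and W :: "real \<Rightarrow> 'a \<Rightarrow> real" and mu sg x :: real
  assumes BM: "std_BM M W" and sg_pos: "0 < sg"
begin

sublocale prob_space M
  using BM by (simp add: std_BM_def)

abbreviation X :: "real \<Rightarrow> 'a \<Rightarrow> real" where "X \<equiv> Xproc x mu sg W"

section \<open>The completed filtration\<close>

definition raw :: "real \<Rightarrow> 'a set set" where
  "raw t = sigma_sets (space M) (\<Union>s\<in>{0..t}. {X s -` U \<inter> space M | U. U \<in> sets (borel :: real measure)})"

text \<open>Bundled as a measure space so that adaptedness becomes ordinary measurability; only its
  sets matter. As \<open>nat_filt\<close> is already a sigma-algebra, generating one adds no
  sets.\<close>

definition Filt :: "real \<Rightarrow> 'a measure" where
  "Filt t = sigma (space M) (nat_filt M X t)"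

lemma W_meas [measurable]: "0 \<le> t \<Longrightarrow> W t \<in> borel_measurable M"
  using BM by (simp add: std_BM_def)

lemma X_meas: "0 \<le> t \<Longrightarrow> X t \<in> borel_measurable M"
  unfolding Xproc_def [abs_def] by measurable

lemma raw_gen_subset: "(\<Union>s\<in>{0..t}. {X s -` U \<inter> space M | U. U \<in> sets (borel :: real measure)}) \<subseteq> events"
  using X_meas measurable_sets by fastforce

lemma raw_subset: "raw t \<subseteq> events"
  unfolding raw_def using sets.sigma_sets_subset[OF raw_gen_subset] .

lemma nat_filt_iff: "A \<in> nat_filt M X t \<longleftrightarrow> A \<in> events \<and> (\<exists>B\<in>raw t. (A - B) \<union> (B - A) \<in> null_sets M)"
  unfolding nat_filt_def raw_def by (rule mem_Collect_eq)

text \<open>Complements leave a symmetric difference unchanged, and the symmetric difference of two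
  countable unions lies in the union of the individual ones, which is a null set.\<close>

lemma nat_filt_sigma_algebra: "sigma_algebra (space M) (nat_filt M X t)"
proof -
  have gp: "(\<Union>s\<in>{0..t}. {X s -` U \<inter> space M | U. U \<in> sets (borel :: real measure)}) \<subseteq> Pow (space M)" by auto
  interpret R: sigma_algebra "space M" "raw t" unfolding raw_def by (rule sigma_algebra_sigma_sets[OF gp])
  show ?thesis unfolding sigma_algebra_iff2
  proof (intro conjI ballI allI impI)
    show "nat_filt M X t \<subseteq> Pow (space M)" using sets.space_closed[of M] by (auto simp: nat_filt_iff)
    show "{} \<in> nat_filt M X t"
      unfolding nat_filt_iff by (intro conjI sets.empty_sets bexI[OF _ R.empty_sets]) simp
  next
    fix A assume "A \<in> nat_filt M X t"
    then obtain B where B: "A \<in> events" "B \<in> raw t" "(A - B) \<union> (B - A) \<in> null_sets M"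
      unfolding nat_filt_iff by blast
    have "((space M - A) - (space M - B)) \<union> ((space M - B) - (space M - A)) = (A - B) \<union> (B - A)"
      using sets.sets_into_space[OF B(1)] R.sets_into_space[OF B(2)] by blast
    then show "space M - A \<in> nat_filt M X t"
      unfolding nat_filt_iff using B(3) R.compl_sets[OF B(2)] sets.compl_sets[OF B(1)]
      by (intro conjI bexI[of _ "space M - B"]) simp_all
  next
    fix A :: "nat \<Rightarrow> 'a set" assume "range A \<subseteq> nat_filt M X t"
    then have "A i \<in> nat_filt M X t" for i by auto
    then have "\<forall>i. \<exists>B. A i \<in> events \<and> B \<in> raw t \<and> (A i - B) \<union> (B - A i) \<in> null_sets M"
      unfolding nat_filt_iff by blast
    then obtain B where B: "\<And>i. A i \<in> events" "\<And>i. B i \<in> raw t" "\<And>i. (A i - B i) \<union> (B i - A i) \<in> null_sets M"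
      by metis
    have UB: "(\<Union>i. B i) \<in> raw t" using B(2) by (intro R.countable_UN) auto
    have UA: "(\<Union>i. A i) \<in> events" using B(1) by (intro sets.countable_UN) auto
    have "(\<Union>i. (A i - B i) \<union> (B i - A i)) \<in> null_sets M" using B(3) by (intro null_sets_UN)
    then have "((\<Union>i. A i) - (\<Union>i. B i)) \<union> ((\<Union>i. B i) - (\<Union>i. A i)) \<in> null_sets M"
      by (rule null_sets_subset) (use UA UB raw_subset[of t] in auto)
    then show "(\<Union>i. A i) \<in> nat_filt M X t" using UA UB unfolding nat_filt_iff by blast
  qed
qed

lemma space_Filt [simp]: "space (Filt t) = space M" and sets_Filt: "sets (Filt t) = nat_filt M X t"
proof -
  interpret F: sigma_algebra "space M" "nat_filt M X t" by (rule nat_filt_sigma_algebra)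
  show "space (Filt t) = space M" "sets (Filt t) = nat_filt M X t"
    unfolding Filt_def using F.space_closed by (simp_all add: F.sigma_sets_eq)
qed

lemma Filt_subset: "sets (Filt t) \<subseteq> events"
  by (auto simp: sets_Filt nat_filt_iff)

lemma Filt_mono: "s \<le> t \<Longrightarrow> sets (Filt s) \<subseteq> sets (Filt t)"
proof -
  assume "s \<le> t"
  then have "raw s \<subseteq> raw t" unfolding raw_def by (intro sigma_sets_mono' UN_mono) auto
  then show ?thesis unfolding sets_Filt using nat_filt_iff by blast
qed

lemma measurable_Filt_mono: "s \<le> t \<Longrightarrow> f \<in> measurable (Filt s) N \<Longrightarrow> f \<in> measurable (Filt t) N"
  using Filt_mono[of s t] unfolding measurable_def by auto

lemma measurable_Filt_imp: "f \<in> measurable (Filt s) N \<Longrightarrow> f \<in> measurable M N"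
  using Filt_subset[of s] unfolding measurable_def by auto

lemma raw_subset_Filt: "raw t \<subseteq> sets (Filt t)"
proof
  fix A assume A: "A \<in> raw t"
  have "(A - A) \<union> (A - A) \<in> null_sets M" by simp
  then show "A \<in> sets (Filt t)" using A raw_subset[of t] unfolding sets_Filt nat_filt_iff by blast
qed

lemma X_Filt: "0 \<le> s \<Longrightarrow> s \<le> t \<Longrightarrow> X s \<in> borel_measurable (Filt t)"
proof (rule measurableI)
  fix U :: "real set" assume s: "0 \<le> s" "s \<le> t" and U: "U \<in> sets borel"
  have "X s -` U \<inter> space M \<in> raw t" unfolding raw_def using s U by (intro sigma_sets.Basic UN_I[of s]) auto
  then show "X s -` U \<inter> space (Filt t) \<in> sets (Filt t)" using raw_subset_Filt by auto
qed simp

lemma W_Filt: "0 \<le> s \<Longrightarrow> s \<le> t \<Longrightarrow> W s \<in> borel_measurable (Filt t)"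
proof -
  assume s: "0 \<le> s" "s \<le> t"
  have "W s = (\<lambda>\<omega>. (X s \<omega> - x - mu * s) / sg)" using sg_pos by (auto simp: Xproc_def)
  moreover have "(\<lambda>\<omega>. (X s \<omega> - x - mu * s) / sg) \<in> borel_measurable (Filt t)"
    using X_Filt[OF s] by measurable
  ultimately show ?thesis by simp
qed

lemma W_0: "\<omega> \<in> space M \<Longrightarrow> W 0 \<omega> = 0"
  and W_cont: "\<omega> \<in> space M \<Longrightarrow> continuous_on {0..} (\<lambda>t. W t \<omega>)"
  using BM by (simp_all add: std_BM_def)

text \<open>The values of \<open>X\<close> at finitely many times up to \<open>t\<close> are
  functions of finitely many increments over intervals up to \<open>t\<close>, and those are
  independent of the increment that follows.\<close>

lemma cylinder_indep:
  assumes t: "0 \<le> t" and d: "0 < d" and F: "finite F" "F \<subseteq> {0..t}"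
    and U: "\<And>s. s \<in> F \<Longrightarrow> U s \<in> sets (borel :: real measure)" and B: "B \<in> sets (borel :: real measure)"
  shows "prob ({\<omega> \<in> space M. \<forall>s\<in>F. X s \<omega> \<in> U s} \<inter> {\<omega> \<in> space M. W (t + d) \<omega> - W t \<omega> \<in> B})
    = prob {\<omega> \<in> space M. \<forall>s\<in>F. X s \<omega> \<in> U s} * prob {\<omega> \<in> space M. W (t + d) \<omega> - W t \<omega> \<in> B}"
proof -
  \<comment> \<open>Adding 0 and \<open>t\<close> makes the first grid time 0, where
    \<open>W\<close> vanishes, and the last one \<open>t\<close>; then \<open>W\<close> at each grid
    time is a sum of increments with index below \<open>m\<close>.\<close>
  define F' where "F' = insert 0 (insert t F)"
  define l where "l = sorted_list_of_set F'"
  define m where "m = card F' - 1"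
  have F': "finite F'" "F' \<subseteq> {0..t}" using F t by (auto simp: F'_def)
  have cardF: "card F' = Suc m" using F'(1) by (simp add: m_def F'_def card_gt_0_iff)
  have l: "sorted_wrt (<) l" "set l = F'" "length l = Suc m"
    using F' cardF by (simp_all add: l_def)
  \<comment> \<open>\<open>std_BM\<close> asks for an infinite strictly increasing sequence of
    times: after \<open>t\<close> it goes to \<open>t + d\<close> and then on in unit steps.\<close>
  define ts where "ts i = (if i \<le> m then l ! i else t + d + real (i - Suc m))" for i
  have ts_in: "ts i \<in> F'" if "i \<le> m" for i using that l nth_mem[of i l] by (simp add: ts_def)
  have sm: "strict_mono ts"
  proof (rule strict_monoI_Suc)
    fix i show "ts i < ts (Suc i)"
    proof (cases "Suc i \<le> m")
      case True
      then show ?thesis using l(1,3) by (simp add: ts_def sorted_wrt_nth_less)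
    next
      case False
      show ?thesis
      proof (cases "i = m")
        case True then show ?thesis using ts_in[of m] F'(2) d by (auto simp: ts_def)
      next
        case F: False then show ?thesis using False by (auto simp: ts_def of_nat_diff)
      qed
    qed
  qed
  have ts0: "ts 0 = 0"
  proof -
    have "0 \<in> set l" using l(2) by (simp add: F'_def)
    then obtain i where i: "i < Suc m" "l ! i = 0" using l(3) by (metis in_set_conv_nth)
    then have "ts 0 \<le> ts i" using sm by (simp add: strict_mono_less_eq)
    moreover have "0 \<le> ts 0" using ts_in[of 0] F'(2) by auto
    ultimately show ?thesis using i by (auto simp: ts_def)
  qed
  have tsm: "ts m = t"
  proof -
    have "t \<in> set l" using l(2) by (simp add: F'_def)
    then obtain i where i: "i < Suc m" "l ! i = t" using l(3) by (metis in_set_conv_nth)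
    then have "ts i \<le> ts m" using sm by (simp add: strict_mono_less_eq)
    moreover have "ts m \<le> t" using ts_in[of m] F'(2) by auto
    ultimately show ?thesis using i by (auto simp: ts_def)
  qed
  have tsSm: "ts (Suc m) = t + d" by (simp add: ts_def)
  define D where "D i \<omega> = W (ts (Suc i)) \<omega> - W (ts i) \<omega>" for i \<omega>
  have ind: "indep_vars (\<lambda>_. borel) D {..<Suc m}"
    using BM sm ts0 unfolding std_BM_def D_def by auto
  have sumD: "W (ts j) \<omega> = (\<Sum>i<j. D i \<omega>)" if "\<omega> \<in> space M" for j \<omega>
    using W_0[OF that] sum_lessThan_telescope[of "\<lambda>i. W (ts i) \<omega>" j] by (simp add: D_def ts0)
  have iv: "indep_var (PiM {..<m} (\<lambda>_. borel)) (\<lambda>\<omega>. restrict (\<lambda>i. D i \<omega>) {..<m}) (PiM {m} (\<lambda>_. borel)) (\<lambda>\<omega>. restrict (\<lambda>i. D i \<omega>) {m})"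
    by (rule indep_var_restrict[OF ind]) auto
  define Q where "Q f = (\<forall>j\<in>{j. j \<le> m \<and> ts j \<in> F}. x + mu * ts j + sg * (\<Sum>i<j. f i) \<in> U (ts j))" for f :: "nat \<Rightarrow> real"
  have Qm: "Q \<in> measurable (PiM {..<m} (\<lambda>_. borel)) (count_space UNIV)"
  proof -
    have "Measurable.pred (PiM {..<m} (\<lambda>_. borel)) (\<lambda>f. x + mu * ts j + sg * (\<Sum>i<j. f i) \<in> U (ts j))"
      if "j \<le> m \<and> ts j \<in> F" for j
    proof -
      have [measurable]: "U (ts j) \<in> sets borel" using U that by blast
      have [measurable]: "(\<lambda>f. f i) \<in> borel_measurable (PiM {..<m} (\<lambda>_. borel :: real measure))" if "i < j" for i
        using that \<open>j \<le> m \<and> ts j \<in> F\<close> by (intro measurable_component_singleton) auto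
      have [measurable]: "(\<lambda>f. \<Sum>i<j. f i) \<in> borel_measurable (PiM {..<m} (\<lambda>_. borel :: real measure))"
        by (intro borel_measurable_sum) auto
      show ?thesis by measurable
    qed
    then show ?thesis unfolding Q_def [abs_def] by (intro pred_intros_finite) auto
  qed
  have eqQ: "Q (restrict (\<lambda>i. D i \<omega>) {..<m}) \<longleftrightarrow> (\<forall>s\<in>F. X s \<omega> \<in> U s)" if w: "\<omega> \<in> space M" for \<omega>
  proof -
    have "(\<Sum>i<j. restrict (\<lambda>i. D i \<omega>) {..<m} i) = W (ts j) \<omega>" if "j \<le> m" for j
      unfolding sumD[OF w] using that by (intro sum.cong) auto
    then have "Q (restrict (\<lambda>i. D i \<omega>) {..<m}) \<longleftrightarrow> (\<forall>j\<in>{j. j \<le> m \<and> ts j \<in> F}. X (ts j) \<omega> \<in> U (ts j))"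
      unfolding Q_def Xproc_def by auto
    also have "\<dots> \<longleftrightarrow> (\<forall>s\<in>F. X s \<omega> \<in> U s)"
    proof -
      have "\<exists>j. j \<le> m \<and> ts j = s" if "s \<in> F" for s
      proof -
        have "s \<in> set l" using l(2) that by (simp add: F'_def)
        then obtain j where "j < Suc m" "l ! j = s" using l(3) by (metis in_set_conv_nth)
        then show ?thesis by (intro exI[of _ j]) (auto simp: ts_def)
      qed
      then show ?thesis by blast
    qed
    finally show ?thesis .
  qed
  define Q1 Q2 where "Q1 = Q \<circ> (\<lambda>\<omega>. restrict (\<lambda>i. D i \<omega>) {..<m})"
    and "Q2 = (\<lambda>f. f m \<in> B) \<circ> (\<lambda>\<omega>. restrict (\<lambda>i. D i \<omega>) {m})"
  have Q2eq: "Q2 \<omega> \<longleftrightarrow> W (t + d) \<omega> - W t \<omega> \<in> B" for \<omega>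
    unfolding Q2_def o_def D_def by (simp only: restrict_apply' insertI1 tsm tsSm)
  have "(\<lambda>f. f m \<in> B) \<in> measurable (PiM {m} (\<lambda>_. borel :: real measure)) (count_space UNIV)"
  proof -
    have [measurable]: "(\<lambda>f. f m) \<in> borel_measurable (PiM {m} (\<lambda>_. borel :: real measure))"
      by (intro measurable_component_singleton) auto
    show ?thesis using B by measurable
  qed
  from indep_var_compose[OF iv Qm this]
  have "indep_var (count_space UNIV) Q1 (count_space UNIV) Q2" unfolding Q1_def Q2_def .
  then have "prob ((\<lambda>\<omega>. (Q1 \<omega>, Q2 \<omega>)) -` ({True} \<times> {True}) \<inter> space M)
     = prob (Q1 -` {True} \<inter> space M) * prob (Q2 -` {True} \<inter> space M)"
    by (rule indep_varD) auto
  moreover have "(\<lambda>\<omega>. (Q1 \<omega>, Q2 \<omega>)) -` ({True} \<times> {True}) \<inter> space M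
     = {\<omega> \<in> space M. \<forall>s\<in>F. X s \<omega> \<in> U s} \<inter> {\<omega> \<in> space M. W (t + d) \<omega> - W t \<omega> \<in> B}"
    using eqQ unfolding vimage_def Q2eq by (auto simp: Q1_def)
  moreover have "Q1 -` {True} \<inter> space M = {\<omega> \<in> space M. \<forall>s\<in>F. X s \<omega> \<in> U s}"
    using eqQ by (auto simp: Q1_def)
  moreover have "Q2 -` {True} \<inter> space M = {\<omega> \<in> space M. W (t + d) \<omega> - W t \<omega> \<in> B}"
    unfolding vimage_def Q2eq by blast
  ultimately show ?thesis by (simp only:)
qed

text \<open>Cylinder events are stable under intersection and generate \<open>raw t\<close>, so
  independence extends from them to all of \<open>raw t\<close> by Dynkin's argument.\<close>

lemma raw_indep:
  assumes t: "0 \<le> t" and d: "0 < d" and A: "A \<in> raw t" and B: "B \<in> sets (borel :: real measure)"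
  shows "prob (A \<inter> {\<omega> \<in> space M. W (t + d) \<omega> - W t \<omega> \<in> B}) = prob A * prob {\<omega> \<in> space M. W (t + d) \<omega> - W t \<omega> \<in> B}"
proof -
  define Cyl where "Cyl = {{\<omega> \<in> space M. \<forall>s\<in>F. X s \<omega> \<in> U s} | F U. finite F \<and> F \<subseteq> {0..t} \<and> (\<forall>s\<in>F. U s \<in> sets (borel :: real measure))}"
  define N where "N = {\<omega> \<in> space M. W (t + d) \<omega> - W t \<omega> \<in> B}"
  have [measurable]: "W t \<in> borel_measurable M" "W (t + d) \<in> borel_measurable M" using t d by simp_all
  have Nm: "N \<in> events" unfolding N_def using B by measurable
  have Cyl_ev: "Cyl \<subseteq> events"
  proof
    fix C assume "C \<in> Cyl"
    then obtain F U where F: "C = {\<omega> \<in> space M. \<forall>s\<in>F. X s \<omega> \<in> U s}" "finite F" "F \<subseteq> {0..t}" "\<And>s. s \<in> F \<Longrightarrow> U s \<in> sets borel"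
      unfolding Cyl_def by blast
    have "{\<omega> \<in> space M. X s \<omega> \<in> U s} \<in> events" if "s \<in> F" for s
      using measurable_sets[OF X_meas F(4)[OF that]] F(3) that by (auto simp: vimage_def Int_def conj_commute)
    then show "C \<in> events" unfolding F(1) using F(2) by (intro sets.sets_Collect_finite_All) auto
  qed
  have IS: "Int_stable Cyl"
  proof (rule Int_stableI)
    fix a b assume "a \<in> Cyl" "b \<in> Cyl"
    then obtain F U F' U' where F: "a = {\<omega> \<in> space M. \<forall>s\<in>F. X s \<omega> \<in> U s}" "finite F" "F \<subseteq> {0..t}" "\<forall>s\<in>F. U s \<in> sets borel"
      and F': "b = {\<omega> \<in> space M. \<forall>s\<in>F'. X s \<omega> \<in> U' s}" "finite F'" "F' \<subseteq> {0..t}" "\<forall>s\<in>F'. U' s \<in> sets borel"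
      unfolding Cyl_def by blast
    define V where "V s = (if s \<in> F then U s else UNIV) \<inter> (if s \<in> F' then U' s else UNIV)" for s
    have "a \<inter> b = {\<omega> \<in> space M. \<forall>s\<in>F \<union> F'. X s \<omega> \<in> V s}" unfolding F(1) F'(1) V_def by (auto split: if_splits)
    moreover have "\<forall>s\<in>F \<union> F'. V s \<in> sets borel" using F(4) F'(4) by (auto simp: V_def)
    ultimately show "a \<inter> b \<in> Cyl" unfolding Cyl_def using F(2,3) F'(2,3)
      by (intro CollectI exI[of _ "F \<union> F'"] exI[of _ V]) auto
  qed
  have "indep_set Cyl {N}"
  proof (rule indep_setI[OF Cyl_ev])
    show "{N} \<subseteq> events" using Nm by simp
    fix a b assume ab: "a \<in> Cyl" "b \<in> {N}"
    then obtain F U where F: "a = {\<omega> \<in> space M. \<forall>s\<in>F. X s \<omega> \<in> U s}" "finite F" "F \<subseteq> {0..t}" "\<And>s. s \<in> F \<Longrightarrow> U s \<in> sets borel"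
      unfolding Cyl_def by blast
    show "prob (a \<inter> b) = prob a * prob b"
      using cylinder_indep[OF t d F(2,3,4) B] ab(2) unfolding F(1) N_def by simp
  qed
  then have "indep_set (sigma_sets (space M) Cyl) (sigma_sets (space M) {N})"
    by (rule indep_set_sigma_sets[OF _ IS]) (auto simp: Int_stable_def)
  moreover have "A \<in> sigma_sets (space M) Cyl"
  proof -
    have "(\<Union>s\<in>{0..t}. {X s -` U \<inter> space M | U. U \<in> sets (borel :: real measure)}) \<subseteq> Cyl"
    proof (safe)
      fix s U assume s: "s \<in> {0..t}" and U: "U \<in> sets (borel :: real measure)"
      have "X s -` U \<inter> space M = {\<omega> \<in> space M. \<forall>r\<in>{s}. X r \<omega> \<in> U}" by auto
      then show "X s -` U \<inter> space M \<in> Cyl" unfolding Cyl_def using s U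
        by (intro CollectI exI[of _ "{s}"] exI[of _ "\<lambda>_. U"]) auto
    qed
    then show ?thesis using A sigma_sets_mono' unfolding raw_def by blast
  qed
  moreover have "N \<in> sigma_sets (space M) {N}" by (rule sigma_sets.Basic) simp
  ultimately show ?thesis using indep_setD unfolding N_def by blast
qed

text \<open>An event of the completed filtration differs from one of \<open>raw t\<close> by a null
  set, which changes none of the probabilities.\<close>

lemma Filt_indep:
  assumes t: "0 \<le> t" and d: "0 < d" and A: "A \<in> sets (Filt t)" and B: "B \<in> sets (borel :: real measure)"
  shows "prob (A \<inter> {\<omega> \<in> space M. W (t + d) \<omega> - W t \<omega> \<in> B}) = prob A * prob {\<omega> \<in> space M. W (t + d) \<omega> - W t \<omega> \<in> B}"
proof -
  define N where "N = {\<omega> \<in> space M. W (t + d) \<omega> - W t \<omega> \<in> B}"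
  have [measurable]: "W t \<in> borel_measurable M" "W (t + d) \<in> borel_measurable M" using t d by simp_all
  have Nm: "N \<in> events" unfolding N_def using B by measurable
  obtain A' where A': "A \<in> events" "A' \<in> raw t" "(A - A') \<union> (A' - A) \<in> null_sets M"
    using A unfolding sets_Filt nat_filt_iff by blast
  have A'm: "A' \<in> events" using A'(2) raw_subset by blast
  have ae: "AE \<omega> in M. \<omega> \<in> A \<longleftrightarrow> \<omega> \<in> A'" using AE_not_in[OF A'(3)] by eventually_elim auto
  have "prob (A \<inter> N) = prob (A' \<inter> N)" using ae A'(1) A'm Nm by (intro measure_eq_AE) auto
  also have "\<dots> = prob A' * prob N" using raw_indep[OF t d A'(2) B] by (simp add: N_def)
  also have "prob A' = prob A" using ae A'(1) A'm by (intro measure_eq_AE) auto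
  finally show ?thesis by (simp add: N_def)
qed

lemma distr_increment: "0 \<le> t \<Longrightarrow> 0 < d \<Longrightarrow> distr M borel (\<lambda>\<omega>. W (t + d) \<omega> - W t \<omega>) = gauss d"
proof -
  assume t: "0 \<le> t" "0 < d"
  then have "distributed M lborel (\<lambda>\<omega>. W (t + d) \<omega> - W t \<omega>) (\<lambda>y. ennreal (normal_density 0 (sqrt (t + d - t)) y))"
    using BM unfolding std_BM_def by (metis less_add_same_cancel1)
  then have "distr M lborel (\<lambda>\<omega>. W (t + d) \<omega> - W t \<omega>) = gauss d"
    by (simp add: distributed_distr_eq_density gauss_def)
  moreover have "distr M lborel (\<lambda>\<omega>. W (t + d) \<omega> - W t \<omega>) = distr M borel (\<lambda>\<omega>. W (t + d) \<omega> - W t \<omega>)"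
    by (rule distr_cong) auto
  ultimately show ?thesis by simp
qed

text \<open>The past, as the pair of the indicator of \<open>A\<close> and \<open>\<xi>\<close>, is
  independent of the increment; the joint law is therefore a product, and Fubini integrates the
  increment out with the past held fixed. The indicator takes the place of a conditional
  expectation.\<close>

lemma freezing:
  fixes f :: "real \<Rightarrow> real"
  assumes t: "0 \<le> t" and d: "0 < d" and A: "A \<in> sets (Filt t)" and xi: "\<xi> \<in> borel_measurable (Filt t)"
    and f: "f \<in> borel_measurable borel" "\<And>y. \<bar>f y\<bar> \<le> K"
  shows "(\<integral>\<omega>. indicator A \<omega> * f (\<xi> \<omega> + b + sg * (W (t + d) \<omega> - W t \<omega>)) \<partial>M)
      = (\<integral>\<omega>. indicator A \<omega> * (\<integral>y. f (\<xi> \<omega> + b + sg * y) \<partial>gauss d) \<partial>M)"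
    and "integrable M (\<lambda>\<omega>. indicator A \<omega> * (\<integral>y. f (\<xi> \<omega> + b + sg * y) \<partial>gauss d))"
proof -
  define Z :: "'a \<Rightarrow> real \<times> real" where "Z \<omega> = (indicator A \<omega>, \<xi> \<omega>)" for \<omega>
  define Y where "Y \<omega> = W (t + d) \<omega> - W t \<omega>" for \<omega>
  have [measurable]: "A \<in> sets (Filt t)" "\<xi> \<in> borel_measurable (Filt t)" by fact+
  have ZF: "Z \<in> measurable (Filt t) (borel \<Otimes>\<^sub>M borel)" unfolding Z_def by measurable
  have Zm [measurable]: "Z \<in> measurable M (borel \<Otimes>\<^sub>M borel)" using measurable_Filt_imp[OF ZF] .
  have Ym [measurable]: "Y \<in> borel_measurable M" unfolding Y_def using t d by simp
  have [measurable]: "f \<in> borel_measurable borel" by fact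
  have eq: "distr M (borel \<Otimes>\<^sub>M borel) Z \<Otimes>\<^sub>M gauss d = distr M ((borel \<Otimes>\<^sub>M borel) \<Otimes>\<^sub>M borel) (\<lambda>\<omega>. (Z \<omega>, Y \<omega>))"
  proof (rule pair_measure_eqI)
    show "sigma_finite_measure (distr M (borel \<Otimes>\<^sub>M borel) Z)"
      using prob_space_distr[OF Zm] by (simp add: prob_space_imp_sigma_finite)
    show "sigma_finite_measure (gauss d)"
      using prob_space_gauss[OF d] by (simp add: prob_space_imp_sigma_finite)
    fix B C assume "B \<in> sets (distr M (borel \<Otimes>\<^sub>M borel) Z)" "C \<in> sets (gauss d)"
    then have BC [measurable]: "B \<in> sets (borel \<Otimes>\<^sub>M borel)" "C \<in> sets borel" by simp_all
    have ev: "Z -` B \<inter> space M \<in> sets (Filt t)" using measurable_sets[OF ZF BC(1)] by simp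
    have YC: "Y -` C \<inter> space M = {\<omega> \<in> space M. W (t + d) \<omega> - W t \<omega> \<in> C}" by (auto simp: Y_def)
    have "emeasure (distr M ((borel \<Otimes>\<^sub>M borel) \<Otimes>\<^sub>M borel) (\<lambda>\<omega>. (Z \<omega>, Y \<omega>))) (B \<times> C)
        = emeasure M ((\<lambda>\<omega>. (Z \<omega>, Y \<omega>)) -` (B \<times> C) \<inter> space M)"
      by (rule emeasure_distr) auto
    also have "(\<lambda>\<omega>. (Z \<omega>, Y \<omega>)) -` (B \<times> C) \<inter> space M = (Z -` B \<inter> space M) \<inter> (Y -` C \<inter> space M)" by auto
    also have "emeasure M \<dots> = emeasure M (Z -` B \<inter> space M) * emeasure M (Y -` C \<inter> space M)"
      using Filt_indep[OF t d ev BC(2)] unfolding emeasure_eq_measure YC by (simp add: ennreal_mult)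
    also have "emeasure M (Z -` B \<inter> space M) = emeasure (distr M (borel \<Otimes>\<^sub>M borel) Z) B" by (simp add: emeasure_distr)
    also have "emeasure M (Y -` C \<inter> space M) = emeasure (distr M borel Y) C" by (simp add: emeasure_distr)
    also have "distr M borel Y = gauss d" unfolding Y_def by (rule distr_increment[OF t d])
    finally show "emeasure (distr M (borel \<Otimes>\<^sub>M borel) Z) B * emeasure (gauss d) C
       = emeasure (distr M ((borel \<Otimes>\<^sub>M borel) \<Otimes>\<^sub>M borel) (\<lambda>\<omega>. (Z \<omega>, Y \<omega>))) (B \<times> C)" by simp
  qed (auto intro!: sets_pair_measure_cong)
  define h where "h z y = fst z * f (snd z + b + sg * y)" for z :: "real \<times> real" and y
  interpret G: prob_space "gauss d" by (rule prob_space_gauss[OF d])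
  interpret DZ: prob_space "distr M (borel \<Otimes>\<^sub>M borel) Z" by (rule prob_space_distr[OF Zm])
  interpret PP: pair_sigma_finite "distr M (borel \<Otimes>\<^sub>M borel) Z" "gauss d" ..
  have hm [measurable]: "case_prod h \<in> borel_measurable ((borel \<Otimes>\<^sub>M borel) \<Otimes>\<^sub>M borel)" unfolding h_def case_prod_beta' by measurable
  have hK: "\<bar>h (Z \<omega>) y\<bar> \<le> \<bar>K\<bar>" for \<omega> y
    using f(2)[of "\<xi> \<omega> + b + sg * y"] by (auto simp: h_def Z_def indicator_def)
  have int: "integrable (distr M (borel \<Otimes>\<^sub>M borel) Z \<Otimes>\<^sub>M gauss d) (case_prod h)"
    unfolding eq
  proof (subst integrable_distr_eq)
    show "integrable M (\<lambda>\<omega>. case (Z \<omega>, Y \<omega>) of (z, y) \<Rightarrow> h z y)"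
      using hK by (intro integrable_const_bound[where B="\<bar>K\<bar>"]) (auto intro!: AE_I2)
  qed measurable
  have "(\<integral>\<omega>. h (Z \<omega>) (Y \<omega>) \<partial>M) = (\<integral>p. case_prod h p \<partial>distr M ((borel \<Otimes>\<^sub>M borel) \<Otimes>\<^sub>M borel) (\<lambda>\<omega>. (Z \<omega>, Y \<omega>)))"
    by (subst integral_distr) auto
  also have "\<dots> = (\<integral>z. (\<integral>y. h z y \<partial>gauss d) \<partial>distr M (borel \<Otimes>\<^sub>M borel) Z)"
    unfolding eq [symmetric] using PP.integral_fst'[OF int] by simp
  also have "\<dots> = (\<integral>\<omega>. (\<integral>y. h (Z \<omega>) y \<partial>gauss d) \<partial>M)"
    by (subst integral_distr) auto
  finally show "(\<integral>\<omega>. indicator A \<omega> * f (\<xi> \<omega> + b + sg * (W (t + d) \<omega> - W t \<omega>)) \<partial>M)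
      = (\<integral>\<omega>. indicator A \<omega> * (\<integral>y. f (\<xi> \<omega> + b + sg * y) \<partial>gauss d) \<partial>M)"
    by (simp add: h_def Z_def Y_def)
  have "integrable (distr M (borel \<Otimes>\<^sub>M borel) Z) (\<lambda>z. \<integral>y. h z y \<partial>gauss d)"
    using PP.integrable_fst'[OF int] by simp
  then have "integrable M (\<lambda>\<omega>. \<integral>y. h (Z \<omega>) y \<partial>gauss d)"
    by (subst (asm) integrable_distr_eq) auto
  then show "integrable M (\<lambda>\<omega>. indicator A \<omega> * (\<integral>y. f (\<xi> \<omega> + b + sg * y) \<partial>gauss d))"
    by (simp add: h_def Z_def)
qed

lemma expected_step:
  assumes t: "0 \<le> t" and d: "0 < d" "d \<le> 1" and A: "A \<in> sets (Filt t)" and xi: "\<xi> \<in> borel_measurable (Filt t)"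
    and f: "f \<in> borel_measurable borel" "\<And>y. 0 \<le> f y \<and> f y \<le> K"
    and e: "e = 1 \<or> e = - 1" and M0: "0 \<le> M0" and qb: "\<And>\<omega>. \<omega> \<in> A \<Longrightarrow> quad_bound mu sg q c e f M0 (\<xi> \<omega>)"
  shows "e * (\<integral>\<omega>. indicator A \<omega> * f (\<xi> \<omega> + (mu - c) * d + sg * (W (t + d) \<omega> - W t \<omega>)) \<partial>M)
      \<le> e * (\<integral>\<omega>. indicator A \<omega> * (f (\<xi> \<omega>) * (1 + q * d) - c * d) \<partial>M) + M0 * step_const (mu - c) sg * (d * sqrt d) * prob A"
proof -
  have Am: "A \<in> events" using A Filt_subset by blast
  have xm [measurable]: "\<xi> \<in> borel_measurable M" using measurable_Filt_imp[OF xi] .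
  have [measurable]: "f \<in> borel_measurable borel" "A \<in> events" by fact+
  have fK: "\<bar>f y\<bar> \<le> K" for y using f(2)[of y] by auto
  define R where "R = M0 * step_const (mu - c) sg * (d * sqrt d)"
  have i1: "integrable M (\<lambda>\<omega>. indicator A \<omega> * (f (\<xi> \<omega>) * (1 + q * d) - c * d))"
  proof (rule integrable_const_bound[where B="K * \<bar>1 + q * d\<bar> + \<bar>c * d\<bar>"], rule AE_I2)
    fix \<omega>
    have K0: "0 \<le> K" using f(2)[of 0] by linarith
    have "\<bar>f (\<xi> \<omega>) * (1 + q * d) - c * d\<bar> \<le> \<bar>f (\<xi> \<omega>) * (1 + q * d)\<bar> + \<bar>c * d\<bar>" by (rule abs_triangle_ineq4)
    also have "\<dots> \<le> K * \<bar>1 + q * d\<bar> + \<bar>c * d\<bar>" using fK[of "\<xi> \<omega>"] by (simp add: abs_mult mult_right_mono)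
    finally show "norm (indicator A \<omega> * (f (\<xi> \<omega>) * (1 + q * d) - c * d)) \<le> K * \<bar>1 + q * d\<bar> + \<bar>c * d\<bar>"
      using K0 by (auto simp: indicator_def)
  qed measurable
  note fr = freezing[OF t d(1) A xi f(1) fK, of "(mu - c) * d"]
  have "e * (\<integral>\<omega>. indicator A \<omega> * f (\<xi> \<omega> + (mu - c) * d + sg * (W (t + d) \<omega> - W t \<omega>)) \<partial>M)
     = (\<integral>\<omega>. e * (indicator A \<omega> * (\<integral>y. f (\<xi> \<omega> + (mu - c) * d + sg * y) \<partial>gauss d)) \<partial>M)"
    unfolding fr(1) by simp
  also have "\<dots> \<le> (\<integral>\<omega>. e * (indicator A \<omega> * (f (\<xi> \<omega>) * (1 + q * d) - c * d)) + R * indicator A \<omega> \<partial>M)"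
  proof (rule integral_mono)
    fix \<omega>
    show "e * (indicator A \<omega> * (\<integral>y. f (\<xi> \<omega> + (mu - c) * d + sg * y) \<partial>gauss d))
       \<le> e * (indicator A \<omega> * (f (\<xi> \<omega>) * (1 + q * d) - c * d)) + R * indicator A \<omega>"
      using gauss_step[OF qb e M0 f d] by (auto simp: indicator_def R_def)
  qed (use fr(2) i1 in \<open>auto simp: emeasure_eq_measure\<close>)
  also have "\<dots> = e * (\<integral>\<omega>. indicator A \<omega> * (f (\<xi> \<omega>) * (1 + q * d) - c * d) \<partial>M) + R * prob A"
    using i1 Am by (simp add: emeasure_eq_measure)
  finally show ?thesis unfolding R_def .
qed

end

section \<open>Grids and levels\<close>

lemma quad_bound_mono: "quad_bound mu sg q c e f M x \<Longrightarrow> M \<le> M' \<Longrightarrow> quad_bound mu sg q c e f M' x"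
proof -
  assume qb: "quad_bound mu sg q c e f M x" and le: "M \<le> M'"
  obtain p s where ps: "\<bar>p\<bar> \<le> M" "\<bar>s\<bar> \<le> M" "sg\<^sup>2 / 2 * s + (mu - c) * p = q * f x - c"
    "\<And>z. e * f (x + z) \<le> e * (f x + p * z + s * z\<^sup>2 / 2) + M * \<bar>z\<bar> ^ 3"
    using qb unfolding quad_bound_def by blast
  have "M * \<bar>z\<bar> ^ 3 \<le> M' * \<bar>z\<bar> ^ 3" for z using le by (intro mult_right_mono) auto
  then have "\<And>z. e * f (x + z) \<le> e * (f x + p * z + s * z\<^sup>2 / 2) + M' * \<bar>z\<bar> ^ 3"
    using ps(4) by (meson add_left_mono order_trans)
  then show ?thesis unfolding quad_bound_def using ps(1-3) le by (meson order_trans)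
qed

lemma quad_bound_shift:
  "quad_bound mu sg q c e (\<lambda>y. f (y + a)) M x \<longleftrightarrow> quad_bound mu sg q c e f M (x + a)"
  unfolding quad_bound_def by (simp add: ac_simps)

section \<open>Integrals over the time grid and after the horizon\<close>

lemma step_function_integral:
  fixes a :: "nat \<Rightarrow> real" and d :: real
  assumes "0 \<le> d"
  shows "has_bochner_integral lborel (\<lambda>s. \<Sum>k<N. indicator {real k * d..<real (Suc k) * d} s * a k) (\<Sum>k<N. d * a k)"
proof (intro has_bochner_integral_sum)
  fix k
  have "has_bochner_integral lborel (\<lambda>s. indicator {real k * d..<real (Suc k) * d} s *\<^sub>R a k) (measure lborel {real k * d..<real (Suc k) * d} *\<^sub>R a k)"
    using assms by (intro has_bochner_integral_indicator) (auto simp: mult_right_mono)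
  then show "has_bochner_integral lborel (\<lambda>s. indicator {real k * d..<real (Suc k) * d} s * a k) (d * a k)"
    using assms by (simp add: mult_right_mono algebra_simps)
qed

lemma step_function_eval:
  fixes a :: "nat \<Rightarrow> real"
  assumes "0 < d" "k < N" "real k * d \<le> s" "s < real (Suc k) * d"
  shows "(\<Sum>k<N. indicator {real k * d..<real (Suc k) * d} s * a k) = a k"
proof -
  have "indicator {real j * d..<real (Suc j) * d} s * a j = (if j = k then a k else 0)" for j
  proof (cases j k rule: linorder_cases)
    case less
    then have "real (Suc j) * d \<le> real k * d" using assms(1) by (intro mult_right_mono) auto
    then have "s \<notin> {real j * d..<real (Suc j) * d}"
      using assms(3) by (meson atLeastLessThan_iff not_less order_trans)
    then show ?thesis using less by simp
  next
    case greater
    then have "real (Suc k) * d \<le> real j * d" using assms(1) by (intro mult_right_mono) auto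
    then have "s \<notin> {real j * d..<real (Suc j) * d}"
      using assms(4) by (meson atLeastLessThan_iff not_less order_trans)
    then show ?thesis using greater by simp
  qed (use assms in \<open>auto simp: indicator_def\<close>)
  then show ?thesis using assms(2) by simp
qed

lemma grid_cell_exists:
  fixes d s :: real
  assumes "0 < d" "0 \<le> s"
  obtains k :: nat where "real k * d \<le> s" "s < real (Suc k) * d"
proof
  define k where "k = nat \<lfloor>s / d\<rfloor>"
  have k: "real k = of_int \<lfloor>s / d\<rfloor>" using assms by (simp add: k_def)
  have "of_int \<lfloor>s / d\<rfloor> \<le> s / d" by (rule of_int_floor_le)
  then show "real k * d \<le> s" unfolding k pos_le_divide_eq[OF assms(1)] .
  have "s / d < real k + 1" using floor_correct[of "s / d"] by (simp add: k)
  then show "s < real (Suc k) * d" using assms by (simp add: pos_divide_less_eq algebra_simps)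
qed

text \<open>With \<open>c\<close> the top rate this is \<open>K * exp (- q * T)\<close>, a bound for
  any payoff after the horizon \<open>T\<close>.\<close>

lemma exp_tail_integral:
  fixes q c T :: real
  assumes q_pos: "0 < q"
  shows "has_bochner_integral lborel (\<lambda>s. indicator {T..} s * (c * exp (- q * s))) (c * (exp (- q * T) / q))"
proof -
  have "has_bochner_integral lborel (\<lambda>s. indicator {T..} s *\<^sub>R exp (- (s * q))) (exp (- (T * q)) / q)"
  proof (rule has_bochner_integral_nn_integral)
    have "(\<integral>\<^sup>+s. ennreal (exp (- (s * q))) * indicator {T..} s \<partial>lborel) = ennreal (0 - (- exp (- (T * q)) / q))"
    proof (rule nn_integral_FTC_atLeast)
      show "DERIV (\<lambda>s. - exp (- (s * q)) / q) s :> exp (- (s * q))" for s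
        using q_pos by (auto intro!: derivative_eq_intros)
      have "((\<lambda>s. exp (- (s * q))) \<longlongrightarrow> 0) at_top"
        using q_pos by (intro filterlim_compose[OF exp_at_bot] filterlim_uminus_at_top[THEN iffD1] filterlim_at_top_mult_tendsto_pos[OF tendsto_const] filterlim_ident)
      then show "((\<lambda>s. - exp (- (s * q)) / q) \<longlongrightarrow> 0) at_top" using tendsto_divide[OF tendsto_minus tendsto_const, of _ 0 at_top q] q_pos by simp
    qed auto
    moreover have "(\<integral>\<^sup>+s. ennreal (indicator {T..} s *\<^sub>R exp (- (s * q))) \<partial>lborel) = (\<integral>\<^sup>+s. ennreal (exp (- (s * q))) * indicator {T..} s \<partial>lborel)"
      by (intro nn_integral_cong) (auto simp: indicator_def)
    ultimately show "(\<integral>\<^sup>+s. ennreal (indicator {T..} s *\<^sub>R exp (- (s * q))) \<partial>lborel) = ennreal (exp (- (T * q)) / q)"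
      by simp
  qed (use q_pos in auto)
  then have "has_bochner_integral lborel (\<lambda>s. c * (indicator {T..} s *\<^sub>R exp (- (s * q)))) (c * (exp (- (T * q)) / q))"
    by (rule has_bochner_integral_mult_right)
  then show ?thesis by (simp add: ac_simps)
qed

lemma exp_discount_upper: "exp (- y) * (1 + y) \<le> 1" for y :: real
  using exp_ge_add_one_self[of y] by (simp add: exp_minus field_simps)

lemma grid_index:
  fixes d t :: real
  assumes "0 < d" "real k * d \<le> t" "t < real (Suc k) * d"
  shows "nat \<lfloor>t / d\<rfloor> = k"
proof -
  have "real k \<le> t / d" "t / d < real k + 1"
    using assms by (simp_all add: pos_le_divide_eq pos_divide_less_eq algebra_simps)
  then have "\<lfloor>t / d\<rfloor> = int k" by (intro floor_unique) auto
  then show ?thesis by simp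
qed

text \<open>The starting point \<open>x\<close> is a parameter because \<open>X\<close> and its
  filtration depend on it. The family \<open>v\<close> is a separate parameter, so that one and the
  same family can serve every starting point.\<close>

locale value_family = brownian_surplus M W mu sg x
  for M :: "'a measure" and W :: "real \<Rightarrow> 'a \<Rightarrow> real" and mu sg x :: real +
  fixes q L :: real and n :: nat and cs :: "nat \<Rightarrow> real" and v :: "nat \<Rightarrow> real \<Rightarrow> real"
  assumes q_pos: "0 < q" and n_pos: "1 \<le> n" and cs_nonneg: "0 \<le> cs 1"
    and cs_less: "\<And>j k. 1 \<le> j \<Longrightarrow> j < k \<Longrightarrow> k \<le> n \<Longrightarrow> cs j < cs k"
    and v_top: "v (Suc n) = (\<lambda>_. - 1)"
    and v_sol: "\<And>j. 1 \<le> j \<Longrightarrow> j \<le> n \<Longrightarrow> obstacle_sol mu sg q (cs n / q) L (cs j) (v (Suc j)) (v j)"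
begin

abbreviation K :: real where "K \<equiv> cs n / q"

lemma cs_bounds: "1 \<le> j \<Longrightarrow> j \<le> n \<Longrightarrow> 0 \<le> cs j \<and> cs j \<le> cs n"
  using cs_less[of 1 j] cs_less[of j n] cs_nonneg by (cases "j = 1"; cases "j = n") force+

lemma cs_inj: "1 \<le> j \<Longrightarrow> j \<le> n \<Longrightarrow> 1 \<le> k \<Longrightarrow> k \<le> n \<Longrightarrow> cs j = cs k \<Longrightarrow> j = k"
  using cs_less[of j k] cs_less[of k j] by (cases j k rule: linorder_cases) auto

lemma cs_le_iff: "1 \<le> j \<Longrightarrow> j \<le> n \<Longrightarrow> 1 \<le> k \<Longrightarrow> k \<le> n \<Longrightarrow> cs j \<le> cs k \<longleftrightarrow> j \<le> k"
  using cs_less[of j k] cs_less[of k j] by (cases j k rule: linorder_cases) auto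

lemma v_class: "1 \<le> j \<Longrightarrow> j \<le> n \<Longrightarrow> vclass K L (v j)"
  using v_sol by (simp add: obstacle_sol_def)

lemma v_bounds: "1 \<le> j \<Longrightarrow> j \<le> n \<Longrightarrow> 0 \<le> v j y \<and> v j y \<le> K"
  using v_class by (simp add: vclass_def)

lemma v_lip: "1 \<le> j \<Longrightarrow> j \<le> n \<Longrightarrow> \<bar>v j y - v j z\<bar> \<le> L * \<bar>y - z\<bar>"
  using v_class by (simp add: vclass_def)

lemma v_zero: "1 \<le> j \<Longrightarrow> j \<le> n \<Longrightarrow> y \<le> 0 \<Longrightarrow> v j y = 0"
  using v_class by (simp add: vclass_def)

lemma L_nonneg: "0 \<le> L"
  using v_lip[of 1 0 1] n_pos by simp

lemma v_cont: "1 \<le> j \<Longrightarrow> j \<le> n \<Longrightarrow> continuous_on S (v j)"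
  using v_lip L_nonneg by (intro lipschitz_on_continuous_on[of L] lipschitz_onI) (auto simp: dist_real_def)

lemma v_meas [measurable]: "1 \<le> j \<Longrightarrow> j \<le> n \<Longrightarrow> v j \<in> borel_measurable borel"
  using v_cont[of j UNIV] by (rule borel_measurable_continuous_onI)

lemma v_antimono: "1 \<le> j \<Longrightarrow> j \<le> k \<Longrightarrow> k \<le> n \<Longrightarrow> v k y \<le> v j y"
proof (induction k)
  case (Suc k)
  show ?case
  proof (cases "j = Suc k")
    case False
    then have "v k y \<le> v j y" "v (Suc k) y \<le> v k y" using Suc v_sol[of k] by (auto simp: obstacle_sol_def)
    then show ?thesis by simp
  qed simp
qed simp

lemma cbar_nonneg: "0 \<le> cs n"
  using cs_bounds[of n] n_pos by simp

lemma K_nonneg: "0 \<le> K"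
  using cbar_nonneg q_pos by simp

definition step_sum :: real where
  "step_sum = (\<Sum>j\<in>{1..n}. step_const (mu - cs j) sg)"

lemma step_sum_nonneg: "0 \<le> step_sum"
  unfolding step_sum_def by (intro sum_nonneg step_const_nonneg)

lemma integral_index_split:
  fixes g :: "nat \<Rightarrow> 'a \<Rightarrow> real"
  assumes A: "A \<in> events" and J: "J \<in> measurable M (count_space UNIV)" "\<And>\<omega>. \<omega> \<in> space M \<Longrightarrow> J \<omega> \<in> {1..n}"
    and g: "\<And>j. j \<in> {1..n} \<Longrightarrow> g j \<in> borel_measurable M" "\<And>j \<omega>. j \<in> {1..n} \<Longrightarrow> \<omega> \<in> space M \<Longrightarrow> \<bar>g j \<omega>\<bar> \<le> B"
  shows "(\<integral>\<omega>. indicator A \<omega> * g (J \<omega>) \<omega> \<partial>M) = (\<Sum>j\<in>{1..n}. \<integral>\<omega>. indicator (A \<inter> {\<omega> \<in> space M. J \<omega> = j}) \<omega> * g j \<omega> \<partial>M)"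
proof -
  have "(\<integral>\<omega>. indicator A \<omega> * g (J \<omega>) \<omega> \<partial>M) = (\<integral>\<omega>. (\<Sum>j\<in>{1..n}. indicator (A \<inter> {\<omega> \<in> space M. J \<omega> = j}) \<omega> * g j \<omega>) \<partial>M)"
  proof (rule Bochner_Integration.integral_cong[OF refl])
    fix \<omega> assume w: "\<omega> \<in> space M"
    have "(\<Sum>j\<in>{1..n}. indicator (A \<inter> {\<omega> \<in> space M. J \<omega> = j}) \<omega> * g j \<omega>) = (\<Sum>j\<in>{1..n}. if j = J \<omega> then indicator A \<omega> * g j \<omega> else 0)"
      using w by (intro sum.cong) (auto simp: indicator_def)
    also have "\<dots> = indicator A \<omega> * g (J \<omega>) \<omega>" using J(2)[OF w] by simp
    finally show "indicator A \<omega> * g (J \<omega>) \<omega> = (\<Sum>j\<in>{1..n}. indicator (A \<inter> {\<omega> \<in> space M. J \<omega> = j}) \<omega> * g j \<omega>)" by simp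
  qed
  also have "\<dots> = (\<Sum>j\<in>{1..n}. \<integral>\<omega>. indicator (A \<inter> {\<omega> \<in> space M. J \<omega> = j}) \<omega> * g j \<omega> \<partial>M)"
  proof (rule Bochner_Integration.integral_sum)
    fix j assume j: "j \<in> {1..n}"
    have [measurable]: "g j \<in> borel_measurable M" "J \<in> measurable M (count_space UNIV)" "A \<in> events" using g j J A by blast+
    show "integrable M (\<lambda>\<omega>. indicator (A \<inter> {\<omega> \<in> space M. J \<omega> = j}) \<omega> * g j \<omega>)"
      using g(2)[OF j] by (intro integrable_const_bound[where B="\<bar>B\<bar>"]) (fastforce simp: indicator_def)+
  qed
  finally show ?thesis .
qed

text \<open>The level is random, but it is known at time \<open>t\<close> and takes finitely many
  values; on each event where it equals \<open>j\<close> the rate is constant and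
  \<open>expected_step\<close> applies. The probabilities of these events are estimated by 1, so the
  errors add up to \<open>step_sum\<close>.\<close>

lemma family_step:
  assumes t: "0 \<le> t" and d: "0 < d" "d \<le> 1" and A: "A \<in> sets (Filt t)" and xi: "\<xi> \<in> borel_measurable (Filt t)"
    and J: "J \<in> measurable (Filt t) (count_space UNIV)" "\<And>\<omega>. \<omega> \<in> space M \<Longrightarrow> J \<omega> \<in> {1..n}"
    and f: "\<And>j. j \<in> {1..n} \<Longrightarrow> f j \<in> borel_measurable borel" "\<And>j y. j \<in> {1..n} \<Longrightarrow> 0 \<le> f j y \<and> f j y \<le> K"
    and e: "e = 1 \<or> e = - 1" and M0: "0 \<le> M0"
    and qb: "\<And>\<omega>. \<omega> \<in> A \<Longrightarrow> quad_bound mu sg q (cs (J \<omega>)) e (f (J \<omega>)) M0 (\<xi> \<omega>)"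
  shows "e * (\<integral>\<omega>. indicator A \<omega> * f (J \<omega>) (\<xi> \<omega> + (mu - cs (J \<omega>)) * d + sg * (W (t + d) \<omega> - W t \<omega>)) \<partial>M)
      \<le> e * (\<integral>\<omega>. indicator A \<omega> * (f (J \<omega>) (\<xi> \<omega>) * (1 + q * d) - cs (J \<omega>) * d) \<partial>M) + M0 * step_sum * (d * sqrt d)"
proof -
  have Am: "A \<in> events" using A Filt_subset by blast
  have [measurable]: "\<xi> \<in> borel_measurable M" using measurable_Filt_imp[OF xi] .
  have Jm [measurable]: "J \<in> measurable M (count_space UNIV)" using measurable_Filt_imp[OF J(1)] .
  have [measurable]: "W t \<in> borel_measurable M" "W (t + d) \<in> borel_measurable M" using t d by simp_all
  define Aj where "Aj j = A \<inter> {\<omega> \<in> space M. J \<omega> = j}" for j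
  have Aj: "Aj j \<in> sets (Filt t)" for j
  proof -
    have "{\<omega> \<in> space M. J \<omega> = j} = J -` {j} \<inter> space (Filt t)" by auto
    then have "{\<omega> \<in> space M. J \<omega> = j} \<in> sets (Filt t)" using measurable_sets[OF J(1), of "{j}"] by simp
    then show ?thesis unfolding Aj_def using A by blast
  qed
  have L: "(\<integral>\<omega>. indicator A \<omega> * f (J \<omega>) (\<xi> \<omega> + (mu - cs (J \<omega>)) * d + sg * (W (t + d) \<omega> - W t \<omega>)) \<partial>M)
     = (\<Sum>j\<in>{1..n}. \<integral>\<omega>. indicator (Aj j) \<omega> * f j (\<xi> \<omega> + (mu - cs j) * d + sg * (W (t + d) \<omega> - W t \<omega>)) \<partial>M)"
    unfolding Aj_def
  proof (rule integral_index_split[OF Am Jm J(2), where B=K])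
    fix j assume j: "j \<in> {1..n}"
    have [measurable]: "f j \<in> borel_measurable borel" using f j by blast
    show "(\<lambda>\<omega>. f j (\<xi> \<omega> + (mu - cs j) * d + sg * (W (t + d) \<omega> - W t \<omega>))) \<in> borel_measurable M" by measurable
    show "\<bar>f j (\<xi> \<omega> + (mu - cs j) * d + sg * (W (t + d) \<omega> - W t \<omega>))\<bar> \<le> K" for \<omega> using f(2)[OF j] by simp
  qed
  have R: "(\<integral>\<omega>. indicator A \<omega> * (f (J \<omega>) (\<xi> \<omega>) * (1 + q * d) - cs (J \<omega>) * d) \<partial>M)
     = (\<Sum>j\<in>{1..n}. \<integral>\<omega>. indicator (Aj j) \<omega> * (f j (\<xi> \<omega>) * (1 + q * d) - cs j * d) \<partial>M)"
    unfolding Aj_def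
  proof (rule integral_index_split[OF Am Jm J(2), where B="K * (1 + q * d) + cs n * d"])
    fix j assume j: "j \<in> {1..n}"
    have [measurable]: "f j \<in> borel_measurable borel" using f j by blast
    show "(\<lambda>\<omega>. f j (\<xi> \<omega>) * (1 + q * d) - cs j * d) \<in> borel_measurable M" by measurable
    fix \<omega>
    have "0 \<le> f j (\<xi> \<omega>) * (1 + q * d)" "f j (\<xi> \<omega>) * (1 + q * d) \<le> K * (1 + q * d)" "0 \<le> cs j * d" "cs j * d \<le> cs n * d"
      using mult_right_mono[of 0 "f j (\<xi> \<omega>)" "1 + q * d"] mult_right_mono[of "f j (\<xi> \<omega>)" K "1 + q * d"]
        mult_right_mono[of 0 "cs j" d] mult_right_mono[of "cs j" "cs n" d] f(2)[OF j, of "\<xi> \<omega>"] q_pos d cs_bounds[of j] j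
      by simp_all
    then show "\<bar>f j (\<xi> \<omega>) * (1 + q * d) - cs j * d\<bar> \<le> K * (1 + q * d) + cs n * d" by linarith
  qed
  have "e * (\<integral>\<omega>. indicator A \<omega> * f (J \<omega>) (\<xi> \<omega> + (mu - cs (J \<omega>)) * d + sg * (W (t + d) \<omega> - W t \<omega>)) \<partial>M)
     = (\<Sum>j\<in>{1..n}. e * (\<integral>\<omega>. indicator (Aj j) \<omega> * f j (\<xi> \<omega> + (mu - cs j) * d + sg * (W (t + d) \<omega> - W t \<omega>)) \<partial>M))"
    unfolding L by (rule sum_distrib_left)
  also have "\<dots> \<le> (\<Sum>j\<in>{1..n}. e * (\<integral>\<omega>. indicator (Aj j) \<omega> * (f j (\<xi> \<omega>) * (1 + q * d) - cs j * d) \<partial>M) + M0 * step_const (mu - cs j) sg * (d * sqrt d))"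
  proof (rule sum_mono)
    fix j assume j: "j \<in> {1..n}"
    have qbj: "quad_bound mu sg q (cs j) e (f j) M0 (\<xi> \<omega>)" if "\<omega> \<in> Aj j" for \<omega>
      using qb[of \<omega>] that by (auto simp: Aj_def)
    have "e * (\<integral>\<omega>. indicator (Aj j) \<omega> * f j (\<xi> \<omega> + (mu - cs j) * d + sg * (W (t + d) \<omega> - W t \<omega>)) \<partial>M)
      \<le> e * (\<integral>\<omega>. indicator (Aj j) \<omega> * (f j (\<xi> \<omega>) * (1 + q * d) - cs j * d) \<partial>M) + M0 * step_const (mu - cs j) sg * (d * sqrt d) * prob (Aj j)"
      by (rule expected_step[OF t d Aj xi f(1)[OF j] f(2)[OF j] e M0 qbj])
    also have "M0 * step_const (mu - cs j) sg * (d * sqrt d) * prob (Aj j) \<le> M0 * step_const (mu - cs j) sg * (d * sqrt d)"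
      using M0 step_const_nonneg d by (intro mult_left_le) auto
    finally show "e * (\<integral>\<omega>. indicator (Aj j) \<omega> * f j (\<xi> \<omega> + (mu - cs j) * d + sg * (W (t + d) \<omega> - W t \<omega>)) \<partial>M)
      \<le> e * (\<integral>\<omega>. indicator (Aj j) \<omega> * (f j (\<xi> \<omega>) * (1 + q * d) - cs j * d) \<partial>M) + M0 * step_const (mu - cs j) sg * (d * sqrt d)" by simp
  qed
  also have "\<dots> = e * (\<integral>\<omega>. indicator A \<omega> * (f (J \<omega>) (\<xi> \<omega>) * (1 + q * d) - cs (J \<omega>) * d) \<partial>M) + M0 * step_sum * (d * sqrt d)"
    unfolding R step_sum_def by (simp add: sum.distrib sum_distrib_left sum_distrib_right)
  finally show ?thesis .
qed

lemma bounded_integrable: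
  fixes g :: "'a \<Rightarrow> real"
  assumes "g \<in> borel_measurable M" "\<And>\<omega>. \<omega> \<in> space M \<Longrightarrow> \<bar>g \<omega>\<bar> \<le> B"
  shows "integrable M g"
  using assms by (intro integrable_const_bound[where B=B]) auto

lemma index_compose_measurable:
  fixes J :: "'a \<Rightarrow> nat"
  assumes J: "J \<in> measurable N (count_space UNIV)" "\<And>\<omega>. \<omega> \<in> space N \<Longrightarrow> J \<omega> \<in> {1..n}"
    and f: "\<And>j. j \<in> {1..n} \<Longrightarrow> f j \<in> borel_measurable borel" and xi: "\<xi> \<in> borel_measurable N"
  shows "(\<lambda>\<omega>. f (J \<omega>) (\<xi> \<omega>) :: real) \<in> borel_measurable N"
proof -
  have "(\<lambda>\<omega>. (\<lambda>j \<omega>. if j \<in> {1..n} then f j (\<xi> \<omega>) else 0) (J \<omega>) \<omega>) \<in> borel_measurable N"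
  proof (rule measurable_compose_countable[OF _ J(1)])
    fix j show "(\<lambda>\<omega>. if j \<in> {1..n} then f j (\<xi> \<omega>) else 0) \<in> borel_measurable N"
      using measurable_compose[OF xi f[of j]] by (cases "j \<in> {1..n}") auto
  qed
  moreover have "(\<lambda>\<omega>. if J \<omega> \<in> {1..n} then f (J \<omega>) (\<xi> \<omega>) else 0) \<omega> = f (J \<omega>) (\<xi> \<omega>)" if "\<omega> \<in> space N" for \<omega>
    using J(2)[OF that] by simp
  ultimately show ?thesis using measurable_cong by force
qed

lemma constant_admissible: "1 \<le> i \<Longrightarrow> i \<le> n \<Longrightarrow> admissible M X (cs ` {1..n}) (cs i) (\<lambda>_ _. cs i)"
proof -
  assume i: "1 \<le> i" "i \<le> n"
  have "(\<lambda>_. cs i) -` U \<inter> space M \<in> nat_filt M X t" if "U \<in> sets borel" for U :: "real set" and t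
    using measurable_sets[of "\<lambda>_. cs i" "Filt t" borel U] that by (simp add: sets_Filt)
  then show ?thesis unfolding admissible_def using i by (auto simp: monotone_on_def)
qed

subsection \<open>Every control pays at most v\<close>

lemma uniform_quad_bound_above:
  assumes "0 < w" shows "\<exists>M0\<ge>0. \<forall>j\<in>{1..n}. \<forall>y\<ge>w. quad_bound mu sg q (cs j) 1 (v j) M0 y"
proof -
  have "\<forall>j. \<exists>m. j \<in> {1..n} \<longrightarrow> 0 \<le> m \<and> (\<forall>y\<ge>w. quad_bound mu sg q (cs j) 1 (v j) m y)"
    using v_sol assms by (auto simp: obstacle_sol_def)
  then obtain m where m: "\<And>j. j \<in> {1..n} \<Longrightarrow> 0 \<le> m j \<and> (\<forall>y\<ge>w. quad_bound mu sg q (cs j) 1 (v j) (m j) y)" by metis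
  have "m j \<le> (\<Sum>j\<in>{1..n}. m j)" if "j \<in> {1..n}" for j using m that by (intro member_le_sum) auto
  moreover have "0 \<le> (\<Sum>j\<in>{1..n}. m j)" using m by (intro sum_nonneg) auto
  ultimately show ?thesis using m quad_bound_mono by meson
qed

lemma uniform_quad_bound_below:
  assumes "0 < w" shows "\<exists>M0\<ge>0. \<forall>j\<in>{1..n}. \<forall>y>0. v (Suc j) y + w < v j y \<longrightarrow> quad_bound mu sg q (cs j) (- 1) (v j) M0 y"
proof -
  have "\<forall>j. \<exists>m. j \<in> {1..n} \<longrightarrow> 0 \<le> m \<and> (\<forall>y>0. v (Suc j) y + w < v j y \<longrightarrow> quad_bound mu sg q (cs j) (- 1) (v j) m y)"
    using v_sol assms by (auto simp: obstacle_sol_def)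
  then obtain m where m: "\<And>j. j \<in> {1..n} \<Longrightarrow> 0 \<le> m j \<and> (\<forall>y>0. v (Suc j) y + w < v j y \<longrightarrow> quad_bound mu sg q (cs j) (- 1) (v j) (m j) y)" by metis
  have "m j \<le> (\<Sum>j\<in>{1..n}. m j)" if "j \<in> {1..n}" for j using m that by (intro member_le_sum) auto
  moreover have "0 \<le> (\<Sum>j\<in>{1..n}. m j)" using m by (intro sum_nonneg) auto
  ultimately show ?thesis using m quad_bound_mono by meson
qed

definition idx :: "real \<Rightarrow> nat" where
  "idx c = (SOME j. j \<in> {1..n} \<and> cs j = c)"

lemma idx: "c \<in> cs ` {1..n} \<Longrightarrow> idx c \<in> {1..n} \<and> cs (idx c) = c"
  unfolding idx_def by (rule someI_ex) auto

lemma idx_eq_iff: "c \<in> cs ` {1..n} \<Longrightarrow> j \<in> {1..n} \<Longrightarrow> idx c = j \<longleftrightarrow> c = cs j"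
  using idx[of c] cs_inj[of "idx c" j] by auto

context
  fixes C :: "real \<Rightarrow> 'a \<Rightarrow> real" and i :: nat
  assumes adm: "admissible M X (cs ` {1..n}) (cs i) C" and i: "1 \<le> i" "i \<le> n"
begin

lemma C_mono: "\<omega> \<in> space M \<Longrightarrow> 0 \<le> s \<Longrightarrow> s \<le> t \<Longrightarrow> C s \<omega> \<le> C t \<omega>"
  using adm unfolding admissible_def by (metis atLeast_iff mono_onD order_trans)

lemma C_range: "\<omega> \<in> space M \<Longrightarrow> 0 \<le> t \<Longrightarrow> C t \<omega> \<in> cs ` {1..n}"
  and C_ge: "\<omega> \<in> space M \<Longrightarrow> 0 \<le> t \<Longrightarrow> cs i \<le> C t \<omega>"
  using adm unfolding admissible_def by auto

lemma C_bounds: "\<omega> \<in> space M \<Longrightarrow> 0 \<le> t \<Longrightarrow> 0 \<le> C t \<omega> \<and> C t \<omega> \<le> cs n"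
  using C_range[of \<omega> t] cs_bounds by auto

lemma C_Filt: "0 \<le> s \<Longrightarrow> s \<le> t \<Longrightarrow> C s \<in> borel_measurable (Filt t)"
proof -
  assume s: "0 \<le> s" "s \<le> t"
  have "C s \<in> borel_measurable (Filt s)"
    using adm s unfolding admissible_def by (intro measurableI) (auto simp: sets_Filt)
  then show ?thesis using measurable_Filt_mono[OF s(2)] by blast
qed

lemma C_path_integrable: "\<omega> \<in> space M \<Longrightarrow> set_integrable lborel {0..t} (\<lambda>s. C s \<omega>)"
proof -
  assume w: "\<omega> \<in> space M"
  \<comment> \<open>Nothing is known about \<open>C\<close> at negative times; replacing it there by
    its value at 0 gives a monotone, hence Borel, function on the whole line.\<close>
  have "mono (\<lambda>s. C (max 0 s) \<omega>)" by (intro monoI C_mono[OF w]) auto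
  then have [measurable]: "(\<lambda>s. C (max 0 s) \<omega>) \<in> borel_measurable borel" by (rule borel_measurable_mono)
  have "set_integrable lborel {0..t} (\<lambda>s. C (max 0 s) \<omega>)"
    unfolding set_integrable_def
  proof (rule integrableI_bounded_set_indicator[where B="cs n"])
    show "AE s in lborel. s \<in> {0..t} \<longrightarrow> norm (C (max 0 s) \<omega>) \<le> cs n"
      using C_bounds[OF w] by (intro AE_I2) auto
  qed (auto simp: emeasure_lborel_Icc_eq)
  moreover have "set_integrable lborel {0..t} (\<lambda>s. C (max 0 s) \<omega>) \<longleftrightarrow> set_integrable lborel {0..t} (\<lambda>s. C s \<omega>)"
    by (intro set_integrable_cong) (auto simp: max_def)
  ultimately show ?thesis by simp
qed

lemma lower_riemann_sum_le:
  assumes w: "\<omega> \<in> space M" and d: "0 < d"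
  shows "d * (\<Sum>m<l. C (real m * d) \<omega>) \<le> (LINT s:{0..real l * d}|lborel. C s \<omega>)"
proof -
  have "d * (\<Sum>m<l. C (real m * d) \<omega>) = (\<integral>s. (\<Sum>k<l. indicator {real k * d..<real (Suc k) * d} s * C (real k * d) \<omega>) \<partial>lborel)"
    using step_function_integral[of d "\<lambda>k. C (real k * d) \<omega>" l] d
    by (simp add: has_bochner_integral_integral_eq sum_distrib_left)
  also have "\<dots> \<le> (LINT s:{0..real l * d}|lborel. C s \<omega>)"
    unfolding set_lebesgue_integral_def
  proof (rule integral_mono)
    show "integrable lborel (\<lambda>s. \<Sum>k<l. indicator {real k * d..<real (Suc k) * d} s * C (real k * d) \<omega>)"
      using step_function_integral[of d "\<lambda>k. C (real k * d) \<omega>" l] d by (simp add: has_bochner_integral_iff)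
    show "integrable lborel (\<lambda>s. indicat_real {0..real l * d} s *\<^sub>R C s \<omega>)"
      using C_path_integrable[OF w] unfolding set_integrable_def .
    fix s :: real
    show "(\<Sum>k<l. indicator {real k * d..<real (Suc k) * d} s * C (real k * d) \<omega>) \<le> indicat_real {0..real l * d} s *\<^sub>R C s \<omega>"
    proof (cases "0 \<le> s \<and> s < real l * d")
      case True
      obtain k where k: "real k * d \<le> s" "s < real (Suc k) * d" using grid_cell_exists[OF d] True by blast
      have "real k * d < real l * d" using k(1) True by linarith
      then have "k < l" using d by simp
      then have "(\<Sum>k<l. indicator {real k * d..<real (Suc k) * d} s * C (real k * d) \<omega>) = C (real k * d) \<omega>"
        by (rule step_function_eval[OF d _ k])
      also have "\<dots> \<le> C s \<omega>" using d k by (intro C_mono[OF w]) auto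
      finally show ?thesis using True by simp
    next
      case False
      have "s \<notin> {real k * d..<real (Suc k) * d}" if "k < l" for k
      proof (cases "0 \<le> s")
        case True
        have "real (Suc k) * d \<le> real l * d" using that d by (intro mult_right_mono) auto
        then show ?thesis using False True by (meson atLeastLessThan_iff less_le_trans)
      next
        case neg: False
        have "0 \<le> real k * d" using d by simp
        then show ?thesis using neg by (meson atLeastLessThan_iff order_trans)
      qed
      then have "(\<Sum>k<l. indicator {real k * d..<real (Suc k) * d} s * C (real k * d) \<omega>) = 0" by (intro sum.neutral) auto
      moreover have "0 \<le> indicat_real {0..real l * d} s *\<^sub>R C s \<omega>"
        using C_bounds[OF w, of s] by (auto simp: indicator_def)
      ultimately show ?thesis by simp
    qed
  qed
  finally show ?thesis .
qed

text \<open>The left Riemann sum replaces the integral of the control: it is measurable at the grid time and, as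
  the control is non-decreasing, \<open>riemann_surplus\<close> dominates the true surplus, so it is nonnegative before ruin.\<close>

definition riemann_surplus :: "real \<Rightarrow> nat \<Rightarrow> 'a \<Rightarrow> real" where
  "riemann_surplus d k \<omega> = x + mu * (real k * d) + sg * W (real k * d) \<omega> - d * (\<Sum>l<k. C (real l * d) \<omega>)"

definition alive :: "real \<Rightarrow> nat \<Rightarrow> 'a set" where
  "alive d k = {\<omega> \<in> space M. \<forall>l\<le>k. 0 \<le> riemann_surplus d l \<omega>}"

lemma alive_before_ruin:
  assumes w: "\<omega> \<in> space M" and d: "0 < d" and s: "ereal s < ruin_time X C \<omega>" "real k * d \<le> s"
  shows "\<omega> \<in> alive d k"
  unfolding alive_def
proof (intro CollectI conjI allI impI w)
  fix l assume l: "l \<le> k"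
  have "real l * d \<le> s" using l d s(2) by (meson mult_right_mono of_nat_le_iff order_trans less_imp_le)
  then have "ereal (real l * d) < ruin_time X C \<omega>" using s(1) by (metis ereal_less_eq(3) le_less_trans)
  have "\<not> surplusC X C (real l * d) \<omega> < 0"
  proof
    assume "surplusC X C (real l * d) \<omega> < 0"
    then have "ruin_time X C \<omega> \<le> ereal (real l * d)" unfolding ruin_time_def using d by (intro Inf_lower) auto
    then show False using \<open>ereal (real l * d) < ruin_time X C \<omega>\<close> by simp
  qed
  then show "0 \<le> riemann_surplus d l \<omega>"
    using lower_riemann_sum_le[OF w d, of l] by (simp add: surplusC_def riemann_surplus_def Xproc_def)
qed

text \<open>On a cell the payoff rate is at most the discount factor of the left end times the
  control at the right end. Passing to the control at the left end costs \<open>d\<close> times its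
  increase over the cell, and these costs telescope to at most \<open>d * cs n\<close>. After the
  horizon the top rate is the bound.\<close>

lemma payoff_le:
  assumes w: "\<omega> \<in> space M" and d: "0 < d"
  shows "(LINT s:{s. 0 \<le> s \<and> ereal s < ruin_time X C \<omega>}|lborel. exp (- q * s) * C s \<omega>)
     \<le> (\<Sum>k<N. indicator (alive d k) \<omega> * (exp (- q * (real k * d)) * d * C (real k * d) \<omega>)) + d * cs n + exp (- q * (real N * d)) * K"
proof -
  define T where "T = real N * d"
  define H where "H s = (\<Sum>k<N. indicator {real k * d..<real (Suc k) * d} s * (indicator (alive d k) \<omega> * (exp (- q * (real k * d)) * C (real (Suc k) * d) \<omega>)))
      + indicator {T..} s * (cs n * exp (- q * s))" for s
  have Hint: "has_bochner_integral lborel H ((\<Sum>k<N. d * (indicator (alive d k) \<omega> * (exp (- q * (real k * d)) * C (real (Suc k) * d) \<omega>))) + cs n * (exp (- q * T) / q))"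
    unfolding H_def using d by (intro has_bochner_integral_add step_function_integral exp_tail_integral[OF q_pos]) auto
  have le: "indicator {s. 0 \<le> s \<and> ereal s < ruin_time X C \<omega>} s *\<^sub>R (exp (- q * s) * C s \<omega>) \<le> H s" for s
  proof (cases "0 \<le> s \<and> ereal s < ruin_time X C \<omega>")
    case True
    show ?thesis
    proof (cases "s < T")
      case sT: True
      obtain k where k: "real k * d \<le> s" "s < real (Suc k) * d" using grid_cell_exists[OF d] True by blast
      have "real k * d < real N * d" using k(1) sT unfolding T_def by linarith
      then have kN: "k < N" using d by simp
      have al: "\<omega> \<in> alive d k" using alive_before_ruin[OF w d _ k(1)] True by blast
      have "H s = exp (- q * (real k * d)) * C (real (Suc k) * d) \<omega>"
        unfolding H_def using step_function_eval[OF d kN k, of "\<lambda>k. indicator (alive d k) \<omega> * (exp (- q * (real k * d)) * C (real (Suc k) * d) \<omega>)"] al sT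
        by simp
      moreover have "exp (- q * s) * C s \<omega> \<le> exp (- q * (real k * d)) * C (real (Suc k) * d) \<omega>"
        using k q_pos True C_mono[OF w, of s "real (Suc k) * d"] C_bounds[OF w, of s] by (intro mult_mono) (auto simp del: of_nat_Suc)
      ultimately show ?thesis using True by simp
    next
      case False
      have "s \<notin> {real k * d..<real (Suc k) * d}" if "k < N" for k
      proof -
        have "real (Suc k) * d \<le> real N * d" using that d by (intro mult_right_mono) auto
        then show ?thesis using False unfolding T_def by (meson atLeastLessThan_iff less_le_trans)
      qed
      then have "H s = cs n * exp (- q * s)" unfolding H_def using False by (simp add: sum.neutral)
      moreover have "C s \<omega> * exp (- q * s) \<le> cs n * exp (- q * s)" using C_bounds[OF w, of s] True by (intro mult_right_mono) auto
      ultimately show ?thesis using True by (simp add: mult.commute)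
    qed
  next
    case False
    have "0 \<le> H s" unfolding H_def using C_bounds[OF w] d cbar_nonneg
      by (intro add_nonneg_nonneg sum_nonneg mult_nonneg_nonneg) (auto simp del: of_nat_Suc)
    then show ?thesis using False by simp
  qed
  have Hnn: "0 \<le> (\<integral>s. H s \<partial>lborel)"
  proof (rule integral_nonneg_AE, rule AE_I2)
    fix s show "0 \<le> H s" unfolding H_def using C_bounds[OF w] d cbar_nonneg
      by (intro add_nonneg_nonneg sum_nonneg mult_nonneg_nonneg) (auto simp del: of_nat_Suc)
  qed
  have "(LINT s:{s. 0 \<le> s \<and> ereal s < ruin_time X C \<omega>}|lborel. exp (- q * s) * C s \<omega>) \<le> (\<integral>s. H s \<partial>lborel)"
  proof (cases "integrable lborel (\<lambda>s. indicator {s. 0 \<le> s \<and> ereal s < ruin_time X C \<omega>} s *\<^sub>R (exp (- q * s) * C s \<omega>))")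
    case True
    then show ?thesis unfolding set_lebesgue_integral_def using Hint le by (intro integral_mono) (auto simp: has_bochner_integral_iff)
  next
    \<comment> \<open>A non-integrable integrand has integral 0 by convention, so this case follows
      from nonnegativity of \<open>H\<close>.\<close>
    case False
    then show ?thesis using Hnn unfolding set_lebesgue_integral_def by (simp add: not_integrable_integral_eq)
  qed
  also have "\<dots> = (\<Sum>k<N. d * (indicator (alive d k) \<omega> * (exp (- q * (real k * d)) * C (real (Suc k) * d) \<omega>))) + cs n * (exp (- q * T) / q)"
    using Hint by (rule has_bochner_integral_integral_eq)
  also have "(\<Sum>k<N. d * (indicator (alive d k) \<omega> * (exp (- q * (real k * d)) * C (real (Suc k) * d) \<omega>)))
     \<le> (\<Sum>k<N. indicator (alive d k) \<omega> * (exp (- q * (real k * d)) * d * C (real k * d) \<omega>) + d * (C (real (Suc k) * d) \<omega> - C (real k * d) \<omega>))"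
  proof (rule sum_mono)
    fix k
    define a where "a = indicator (alive d k) \<omega> * exp (- q * (real k * d))"
    have a: "0 \<le> a" "a \<le> 1" using q_pos d by (auto simp: a_def indicator_def)
    have mono: "C (real k * d) \<omega> \<le> C (real (Suc k) * d) \<omega>" using d by (intro C_mono[OF w]) (auto simp: mult_right_mono)
    have "a * (d * (C (real (Suc k) * d) \<omega> - C (real k * d) \<omega>)) \<le> 1 * (d * (C (real (Suc k) * d) \<omega> - C (real k * d) \<omega>))"
      using a mono d by (intro mult_right_mono mult_nonneg_nonneg) auto
    then show "d * (indicator (alive d k) \<omega> * (exp (- q * (real k * d)) * C (real (Suc k) * d) \<omega>))
       \<le> indicator (alive d k) \<omega> * (exp (- q * (real k * d)) * d * C (real k * d) \<omega>) + d * (C (real (Suc k) * d) \<omega> - C (real k * d) \<omega>)"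
      unfolding a_def by (simp add: algebra_simps del: of_nat_Suc)
  qed
  also have "\<dots> = (\<Sum>k<N. indicator (alive d k) \<omega> * (exp (- q * (real k * d)) * d * C (real k * d) \<omega>)) + d * (C (real N * d) \<omega> - C 0 \<omega>)"
    using sum_lessThan_telescope[of "\<lambda>k. C (real k * d) \<omega>" N] by (simp add: sum.distrib sum_distrib_left[symmetric] del: of_nat_Suc)
  also have "d * (C (real N * d) \<omega> - C 0 \<omega>) \<le> d * cs n"
    using d C_bounds[OF w, of 0] C_bounds[OF w, of "real N * d"] by (intro mult_left_mono) auto
  finally show ?thesis unfolding T_def by (simp add: mult.commute)
qed

lemma riemann_surplus_Filt: "0 < d \<Longrightarrow> l \<le> k \<Longrightarrow> riemann_surplus d l \<in> borel_measurable (Filt (real k * d))"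
proof -
  assume d: "0 < d" and l: "l \<le> k"
  have "real l * d \<le> real k * d" using l d by simp
  then have [measurable]: "W (real l * d) \<in> borel_measurable (Filt (real k * d))" using d by (intro W_Filt) auto
  have [measurable]: "C (real m * d) \<in> borel_measurable (Filt (real k * d))" if "m < l" for m
    using d that l by (intro C_Filt) auto
  have [measurable]: "(\<lambda>\<omega>. \<Sum>m<l. C (real m * d) \<omega>) \<in> borel_measurable (Filt (real k * d))"
    by (intro borel_measurable_sum) auto
  show ?thesis unfolding riemann_surplus_def [abs_def] by measurable
qed

lemma alive_Filt: "0 < d \<Longrightarrow> alive d k \<in> sets (Filt (real k * d))"
proof -
  assume d: "0 < d"
  have "{\<omega> \<in> space (Filt (real k * d)). \<forall>l\<in>{..k}. 0 \<le> riemann_surplus d l \<omega>} \<in> sets (Filt (real k * d))"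
  proof (rule sets.sets_Collect_finite_All)
    fix l assume "l \<in> {..k}"
    then have [measurable]: "riemann_surplus d l \<in> borel_measurable (Filt (real k * d))" using riemann_surplus_Filt[OF d] by simp
    show "{\<omega> \<in> space (Filt (real k * d)). 0 \<le> riemann_surplus d l \<omega>} \<in> sets (Filt (real k * d))" by measurable
  qed simp
  moreover have "alive d k = {\<omega> \<in> space (Filt (real k * d)). \<forall>l\<in>{..k}. 0 \<le> riemann_surplus d l \<omega>}"
    unfolding alive_def space_Filt by blast
  ultimately show ?thesis by (simp only:)
qed

lemma idx_C_measurable: "0 \<le> t \<Longrightarrow> (\<lambda>\<omega>. idx (C t \<omega>)) \<in> measurable (Filt t) (count_space UNIV)"
proof -
  assume t: "0 \<le> t"
  have [measurable]: "C t \<in> borel_measurable (Filt t)" using C_Filt[OF t order_refl] .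
  have "(\<lambda>\<omega>. idx (C t \<omega>)) -` {j} \<inter> space (Filt t) \<in> sets (Filt t)" for j
  proof (cases "j \<in> {1..n}")
    case True
    have "(\<lambda>\<omega>. idx (C t \<omega>)) -` {j} \<inter> space (Filt t) = {\<omega> \<in> space (Filt t). C t \<omega> = cs j}"
      using idx_eq_iff[OF C_range[OF _ t] True] by auto
    also have "\<dots> \<in> sets (Filt t)" by measurable
    finally show ?thesis .
  next
    case False
    have "(\<lambda>\<omega>. idx (C t \<omega>)) -` {j} \<inter> space (Filt t) = {}"
      using idx[OF C_range[OF _ t]] False by auto
    then show ?thesis by simp
  qed
  then show ?thesis by (simp add: measurable_count_space_eq2_countable)
qed

text \<open>Evaluating \<open>v\<close> at \<open>y + eta\<close> keeps the touching points away from 0 and makes the terminal value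
  nonnegative, whatever the overshoot at ruin.\<close>

lemma upper_grid:
  assumes eta: "0 < eta" and d: "0 < d" "d \<le> 1" and x: "0 \<le> x"
    and M0: "0 \<le> M0" "\<And>j y. j \<in> {1..n} \<Longrightarrow> eta \<le> y \<Longrightarrow> quad_bound mu sg q (cs j) 1 (v j) M0 y"
  shows "(\<Sum>k<N. exp (- q * (real k * d)) * d * (\<integral>\<omega>. indicator (alive d k) \<omega> * C (real k * d) \<omega> \<partial>M))
      \<le> v i (x + eta) + real N * (M0 * step_sum * (d * sqrt d) + q * cs n * d * d)"
proof -
  define f where "f j y = v j (y + eta)" for j y
  define J where "J k \<omega> = idx (C (real k * d) \<omega>)" for k \<omega>
  define g where "g k \<omega> = f (J k \<omega>) (riemann_surplus d k \<omega>)" for k \<omega>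
  define E where "E k = exp (- q * (real k * d))" for k
  \<comment> \<open>\<open>a k\<close> is the discounted expected value on survival and
    \<open>p k\<close> the expected payment of step \<open>k\<close>. The sum of \<open>a\<close>
    and the accumulated payments is nonincreasing up to an error \<open>R\<close> per step.\<close>
  define a where "a k = E k * (\<integral>\<omega>. indicator (alive d k) \<omega> * g k \<omega> \<partial>M)" for k
  define p where "p k = E k * d * (\<integral>\<omega>. indicator (alive d k) \<omega> * C (real k * d) \<omega> \<partial>M)" for k
  \<comment> \<open>The second summand pays for discounting a payment from the start instead of the
    end of its step, as \<open>exp (- (q * d))\<close> falls short of 1 by at most
    \<open>q * d\<close>.\<close>
  define R where "R = M0 * step_sum * (d * sqrt d) + q * cs n * d * d"
  have tk: "0 \<le> real k * d" for k using d by simp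
  have fm: "f j \<in> borel_measurable borel" if "j \<in> {1..n}" for j
  proof -
    have [measurable]: "v j \<in> borel_measurable borel" using v_meas[of j] that by simp
    show ?thesis unfolding f_def [abs_def] by measurable
  qed
  have fb: "0 \<le> f j y \<and> f j y \<le> K" if "j \<in> {1..n}" for j y
    unfolding f_def using v_bounds that by simp
  have JF: "J k \<in> measurable (Filt (real k * d)) (count_space UNIV)" for k
    unfolding J_def using idx_C_measurable[OF tk] .
  have Jr: "J k \<omega> \<in> {1..n}" "cs (J k \<omega>) = C (real k * d) \<omega>" if "\<omega> \<in> space M" for k \<omega>
    using idx[OF C_range[OF that tk, of k]] by (simp_all add: J_def)
  have XF: "riemann_surplus d k \<in> borel_measurable (Filt (real k * d))" for k using riemann_surplus_Filt[OF d(1)] by simp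
  have Xm [measurable]: "riemann_surplus d k \<in> borel_measurable M" for k using measurable_Filt_imp[OF XF] .
  have Cm [measurable]: "C (real k * d) \<in> borel_measurable M" for k
    using measurable_Filt_imp[OF C_Filt[OF tk order_refl]] .
  have Am [measurable]: "alive d k \<in> events" for k using alive_Filt[OF d(1)] Filt_subset by blast
  have gm [measurable]: "g k \<in> borel_measurable M" for k
    unfolding g_def using index_compose_measurable[OF measurable_Filt_imp[OF JF] Jr(1) fm Xm] .
  have gb: "0 \<le> g k \<omega> \<and> g k \<omega> \<le> K" if "\<omega> \<in> space M" for k \<omega> unfolding g_def using fb Jr(1)[OF that] by blast
  have Cb: "0 \<le> C (real k * d) \<omega> \<and> C (real k * d) \<omega> \<le> cs n" if "\<omega> \<in> space M" for k \<omega>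
    using C_bounds[OF that tk] .
  have ig: "integrable M (\<lambda>\<omega>. indicator (alive d k) \<omega> * g k \<omega>)" for k
    using gb by (intro bounded_integrable[where B=K]) (auto simp: indicator_def K_nonneg)
  have iC: "integrable M (\<lambda>\<omega>. indicator (alive d k) \<omega> * C (real k * d) \<omega>)" for k
    using Cb by (intro bounded_integrable[where B="cs n"]) (auto simp: indicator_def cbar_nonneg)
  have sub: "alive d (Suc k) \<subseteq> alive d k" for k by (auto simp: alive_def)
  have ESuc: "E (Suc k) = E k * exp (- (q * d))" for k
    by (simp add: E_def exp_add [symmetric] algebra_simps)
  have E01: "0 < E k" "E k \<le> 1" for k using q_pos d by (auto simp: E_def)
  have rec: "a (Suc k) \<le> a k - p k + R" for k
  proof -
    define nxt where "nxt \<omega> = riemann_surplus d k \<omega> + (mu - cs (J k \<omega>)) * d + sg * (W (real k * d + d) \<omega> - W (real k * d) \<omega>)" for \<omega>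
    have nxt: "riemann_surplus d (Suc k) \<omega> = nxt \<omega>" if "\<omega> \<in> space M" for \<omega>
      unfolding nxt_def Jr(2)[OF that] riemann_surplus_def by (simp add: algebra_simps)
    have step: "1 * (\<integral>\<omega>. indicator (alive d k) \<omega> * f (J k \<omega>) (nxt \<omega>) \<partial>M)
      \<le> 1 * (\<integral>\<omega>. indicator (alive d k) \<omega> * (f (J k \<omega>) (riemann_surplus d k \<omega>) * (1 + q * d) - cs (J k \<omega>) * d) \<partial>M) + M0 * step_sum * (d * sqrt d)"
      unfolding nxt_def
    proof (rule family_step[OF tk d alive_Filt[OF d(1)] XF JF Jr(1) fm fb _ M0(1)])
      fix \<omega> assume "\<omega> \<in> alive d k"
      then have w: "\<omega> \<in> space M" "0 \<le> riemann_surplus d k \<omega>" by (auto simp: alive_def)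
      show "quad_bound mu sg q (cs (J k \<omega>)) 1 (f (J k \<omega>)) M0 (riemann_surplus d k \<omega>)"
        unfolding f_def [abs_def] quad_bound_shift using M0(2)[OF Jr(1)[OF w(1)]] w(2) by simp
    qed auto
    have nm: "(\<lambda>\<omega>. f (J k \<omega>) (nxt \<omega>)) \<in> borel_measurable M"
    proof (rule index_compose_measurable[OF measurable_Filt_imp[OF JF] Jr(1) fm])
      have "riemann_surplus d (Suc k) \<in> borel_measurable M \<longleftrightarrow> nxt \<in> borel_measurable M" using nxt by (rule measurable_cong)
      then show "nxt \<in> borel_measurable M" using Xm by blast
    qed
    have "(\<integral>\<omega>. indicator (alive d (Suc k)) \<omega> * g (Suc k) \<omega> \<partial>M) \<le> (\<integral>\<omega>. indicator (alive d k) \<omega> * f (J k \<omega>) (nxt \<omega>) \<partial>M)"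
    proof (rule integral_mono)
      show "integrable M (\<lambda>\<omega>. indicator (alive d k) \<omega> * f (J k \<omega>) (nxt \<omega>))"
        using nm fb[OF Jr(1)] by (intro bounded_integrable[where B=K]) (auto simp: indicator_def K_nonneg)
      fix \<omega> assume w: "\<omega> \<in> space M"
      \<comment> \<open>A rising control only lowers the value, since the family decreases in the
        level; a path that leaves the survival event gives up a nonnegative value.\<close>
      have "C (real k * d) \<omega> \<le> C (real (Suc k) * d) \<omega>" using d by (intro C_mono[OF w]) (auto simp: mult_right_mono)
      then have "cs (J k \<omega>) \<le> cs (J (Suc k) \<omega>)" using Jr(2)[OF w] by simp
      then have "J k \<omega> \<le> J (Suc k) \<omega>" using Jr(1)[OF w, of k] Jr(1)[OF w, of "Suc k"] cs_le_iff by simp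
      then have "g (Suc k) \<omega> \<le> f (J k \<omega>) (nxt \<omega>)"
        unfolding g_def f_def nxt[OF w, symmetric] using Jr(1)[OF w, of k] Jr(1)[OF w, of "Suc k"] by (intro v_antimono) auto
      then show "indicator (alive d (Suc k)) \<omega> * g (Suc k) \<omega> \<le> indicator (alive d k) \<omega> * f (J k \<omega>) (nxt \<omega>)"
        using sub[of k] gb[OF w, of "Suc k"] by (auto simp: indicator_def)
    qed (rule ig)
    also have "\<dots> \<le> (\<integral>\<omega>. indicator (alive d k) \<omega> * (g k \<omega> * (1 + q * d) - C (real k * d) \<omega> * d) \<partial>M) + M0 * step_sum * (d * sqrt d)"
    proof -
      have "(\<integral>\<omega>. indicator (alive d k) \<omega> * (f (J k \<omega>) (riemann_surplus d k \<omega>) * (1 + q * d) - cs (J k \<omega>) * d) \<partial>M)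
          = (\<integral>\<omega>. indicator (alive d k) \<omega> * (g k \<omega> * (1 + q * d) - C (real k * d) \<omega> * d) \<partial>M)"
        by (rule Bochner_Integration.integral_cong) (auto simp: g_def Jr(2))
      then show ?thesis using step by simp
    qed
    also have "(\<integral>\<omega>. indicator (alive d k) \<omega> * (g k \<omega> * (1 + q * d) - C (real k * d) \<omega> * d) \<partial>M)
       = (1 + q * d) * (\<integral>\<omega>. indicator (alive d k) \<omega> * g k \<omega> \<partial>M) - d * (\<integral>\<omega>. indicator (alive d k) \<omega> * C (real k * d) \<omega> \<partial>M)"
    proof -
      have "(\<integral>\<omega>. indicator (alive d k) \<omega> * (g k \<omega> * (1 + q * d) - C (real k * d) \<omega> * d) \<partial>M)
        = (\<integral>\<omega>. (1 + q * d) * (indicator (alive d k) \<omega> * g k \<omega>) - d * (indicator (alive d k) \<omega> * C (real k * d) \<omega>) \<partial>M)"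
        by (rule Bochner_Integration.integral_cong) (auto simp: algebra_simps)
      also have "\<dots> = (1 + q * d) * (\<integral>\<omega>. indicator (alive d k) \<omega> * g k \<omega> \<partial>M) - d * (\<integral>\<omega>. indicator (alive d k) \<omega> * C (real k * d) \<omega> \<partial>M)"
        using ig[of k] iC[of k] by (simp only: Bochner_Integration.integral_diff integrable_mult_right Bochner_Integration.integral_mult_right)
      finally show ?thesis .
    qed
    finally have main: "(\<integral>\<omega>. indicator (alive d (Suc k)) \<omega> * g (Suc k) \<omega> \<partial>M)
       \<le> (1 + q * d) * (\<integral>\<omega>. indicator (alive d k) \<omega> * g k \<omega> \<partial>M) - d * (\<integral>\<omega>. indicator (alive d k) \<omega> * C (real k * d) \<omega> \<partial>M) + M0 * step_sum * (d * sqrt d)" .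
    define G where "G = (\<integral>\<omega>. indicator (alive d k) \<omega> * g k \<omega> \<partial>M)"
    define H where "H = (\<integral>\<omega>. indicator (alive d k) \<omega> * C (real k * d) \<omega> \<partial>M)"
    have G0: "0 \<le> G" unfolding G_def using gb by (intro integral_nonneg_AE AE_I2) (auto simp: indicator_def)
    have H0: "0 \<le> H" "H \<le> cs n"
    proof -
      show "0 \<le> H" unfolding H_def using Cb by (intro integral_nonneg_AE AE_I2) (auto simp: indicator_def)
      have "H \<le> (\<integral>\<omega>. cs n \<partial>M)" unfolding H_def using iC Cb
        by (intro integral_mono) (auto simp: indicator_def cbar_nonneg)
      then show "H \<le> cs n" by (simp add: prob_space)
    qed
    \<comment> \<open>One step multiplies the value by \<open>1 + q * d\<close> and the discount by
      \<open>m\<close>; their product is at most 1.\<close>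
    define m where "m = exp (- (q * d))"
    have m: "0 < m" "m \<le> 1" "m * (1 + q * d) \<le> 1" "1 - q * d \<le> m"
      using q_pos d exp_discount_upper[of "q * d"] exp_ge_add_one_self[of "- (q * d)"] by (auto simp: m_def)
    define R1 where "R1 = M0 * step_sum * (d * sqrt d)"
    have R1: "0 \<le> R1" unfolding R1_def using M0(1) step_sum_nonneg d by simp
    have "m * ((1 + q * d) * G - d * H + R1) \<le> G - d * H + R"
    proof -
      have "m * (1 + q * d) * G \<le> 1 * G" using m G0 by (intro mult_right_mono) auto
      moreover have "(1 - q * d) * (d * H) \<le> m * (d * H)" using m H0 d by (intro mult_right_mono) auto
      moreover have "m * R1 \<le> 1 * R1" using m R1 by (intro mult_right_mono) auto
      moreover have "q * d * (d * H) \<le> q * d * (d * cs n)" using q_pos d H0 by (intro mult_left_mono) auto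
      ultimately show ?thesis unfolding R_def R1_def [symmetric] by (simp add: algebra_simps)
    qed
    moreover have "m * (\<integral>\<omega>. indicator (alive d (Suc k)) \<omega> * g (Suc k) \<omega> \<partial>M) \<le> m * ((1 + q * d) * G - d * H + R1)"
      using main m unfolding G_def H_def R1_def by (intro mult_left_mono) auto
    ultimately have "m * (\<integral>\<omega>. indicator (alive d (Suc k)) \<omega> * g (Suc k) \<omega> \<partial>M) \<le> G - d * H + R" by linarith
    then have "E k * (m * (\<integral>\<omega>. indicator (alive d (Suc k)) \<omega> * g (Suc k) \<omega> \<partial>M)) \<le> E k * (G - d * H + R)"
      using E01[of k] by (intro mult_left_mono) auto
    also have "\<dots> \<le> E k * G - E k * d * H + R"
    proof -
      have "0 \<le> R" unfolding R_def using R1 q_pos cbar_nonneg d by (simp add: R1_def)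
      then have "E k * R \<le> 1 * R" using E01[of k] by (intro mult_right_mono) auto
      then show ?thesis by (simp add: algebra_simps)
    qed
    finally show ?thesis unfolding a_def p_def ESuc G_def H_def m_def by (simp add: mult.assoc)
  qed
  have "a N + (\<Sum>k<N. p k) \<le> a 0 + real N * R" for N
  proof (induction N)
    case (Suc N)
    then show ?case using rec[of N] by (simp add: algebra_simps)
  qed simp
  then have "a N + (\<Sum>k<N. p k) \<le> a 0 + real N * R" .
  moreover have "0 \<le> a N" unfolding a_def using gb E01[of N]
    by (intro mult_nonneg_nonneg integral_nonneg_AE AE_I2) (auto simp: indicator_def)
  moreover have "a 0 \<le> v i (x + eta)"
  proof -
    have "(\<integral>\<omega>. indicator (alive d 0) \<omega> * g 0 \<omega> \<partial>M) \<le> (\<integral>\<omega>. v i (x + eta) \<partial>M)"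
    proof (rule integral_mono[OF ig])
      fix \<omega> assume w: "\<omega> \<in> space M"
      have "cs i \<le> cs (J 0 \<omega>)" using C_ge[OF w, of 0] Jr(2)[OF w, of 0] by simp
      then have "i \<le> J 0 \<omega>" using Jr(1)[OF w, of 0] i cs_le_iff by simp
      moreover have "riemann_surplus d 0 \<omega> = x" using W_0[OF w] by (simp add: riemann_surplus_def)
      ultimately have "g 0 \<omega> \<le> v i (x + eta)" unfolding g_def f_def using Jr(1)[OF w, of 0] i by (simp add: v_antimono)
      then show "indicator (alive d 0) \<omega> * g 0 \<omega> \<le> v i (x + eta)" using v_bounds[OF i, of "x + eta"] by (auto simp: indicator_def)
    qed simp
    then show ?thesis by (simp add: a_def E_def prob_space)
  qed
  ultimately show ?thesis unfolding p_def E_def R_def by linarith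
qed

lemma Jpay_upper_grid:
  assumes eta: "0 < eta" and d: "0 < d" "d \<le> 1" and x: "0 \<le> x"
    and M0: "0 \<le> M0" "\<And>j y. j \<in> {1..n} \<Longrightarrow> eta \<le> y \<Longrightarrow> quad_bound mu sg q (cs j) 1 (v j) M0 y"
  shows "Jpay M q X C \<le> v i (x + eta) + real N * (M0 * step_sum * (d * sqrt d) + q * cs n * d * d) + d * cs n + exp (- q * (real N * d)) * K"
proof -
  have tk: "0 \<le> real k * d" for k using d by simp
  have [measurable]: "C (real k * d) \<in> borel_measurable M" for k
    using measurable_Filt_imp[OF C_Filt[OF tk order_refl]] .
  have [measurable]: "alive d k \<in> events" for k using alive_Filt[OF d(1)] Filt_subset by blast
  have Cb: "0 \<le> C (real k * d) \<omega> \<and> C (real k * d) \<omega> \<le> cs n" if "\<omega> \<in> space M" for k \<omega>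
    using C_bounds[OF that tk] .
  have iC: "integrable M (\<lambda>\<omega>. indicator (alive d k) \<omega> * C (real k * d) \<omega>)" for k
    using Cb by (intro bounded_integrable[where B="cs n"]) (auto simp: indicator_def cbar_nonneg)
  define P where "P \<omega> = (LINT s:{s. 0 \<le> s \<and> ereal s < ruin_time X C \<omega>}|lborel. exp (- q * s) * C s \<omega>)" for \<omega>
  define D where "D \<omega> = (\<Sum>k<N. exp (- q * (real k * d)) * d * (indicator (alive d k) \<omega> * C (real k * d) \<omega>)) + (d * cs n + exp (- q * (real N * d)) * K)" for \<omega>
  have iD: "integrable M D" unfolding D_def using iC by (intro Bochner_Integration.integrable_add Bochner_Integration.integrable_sum integrable_mult_right) auto
  have "P \<omega> \<le> D \<omega>" if "\<omega> \<in> space M" for \<omega>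
    using payoff_le[OF that d(1), of N] unfolding P_def D_def by (simp add: ac_simps)
  moreover have D0: "0 \<le> (\<integral>\<omega>. D \<omega> \<partial>M)"
  proof (rule integral_nonneg_AE, rule AE_I2)
    fix \<omega> assume "\<omega> \<in> space M"
    then show "0 \<le> D \<omega>" unfolding D_def using Cb d cbar_nonneg K_nonneg
      by (intro add_nonneg_nonneg sum_nonneg mult_nonneg_nonneg) (auto simp: indicator_def)
  qed
  ultimately have "(\<integral>\<omega>. P \<omega> \<partial>M) \<le> (\<integral>\<omega>. D \<omega> \<partial>M)"
  proof (cases "integrable M P")
    case True
    then show ?thesis using iD \<open>\<And>\<omega>. \<omega> \<in> space M \<Longrightarrow> P \<omega> \<le> D \<omega>\<close> by (rule integral_mono)
  next
    \<comment> \<open>The payoff of an arbitrary control is not shown to be measurable; if it is not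
      integrable, its integral is 0 by convention and lies below the nonnegative bound.\<close>
    case False
    then show ?thesis using D0 by (simp add: not_integrable_integral_eq)
  qed
  also have "(\<integral>\<omega>. D \<omega> \<partial>M) = (\<Sum>k<N. exp (- q * (real k * d)) * d * (\<integral>\<omega>. indicator (alive d k) \<omega> * C (real k * d) \<omega> \<partial>M)) + (d * cs n + exp (- q * (real N * d)) * K)"
    unfolding D_def using iC by (simp add: Bochner_Integration.integral_add Bochner_Integration.integral_sum prob_space)
  also have "\<dots> \<le> v i (x + eta) + real N * (M0 * step_sum * (d * sqrt d) + q * cs n * d * d) + (d * cs n + exp (- q * (real N * d)) * K)"
    using upper_grid[OF assms] by (intro add_right_mono)
  finally show ?thesis unfolding Jpay_def P_def by (simp add: add.assoc)
qed

text \<open>\<open>M0\<close> depends on \<open>eta\<close> but not on the mesh, which dictates the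
  order of the limits: mesh, then horizon, then shift. The last one uses continuity of
  \<open>v i\<close>.\<close>

theorem Jpay_le_v:
  assumes x: "0 \<le> x" shows "Jpay M q X C \<le> v i x"
proof -
  have T: "Jpay M q X C \<le> v i (x + eta) + exp (- q * T) * K" if eta: "0 < eta" and T: "0 < T" for eta T
  proof -
    obtain M0 where M0: "0 \<le> M0" "\<And>j y. j \<in> {1..n} \<Longrightarrow> eta \<le> y \<Longrightarrow> quad_bound mu sg q (cs j) 1 (v j) M0 y"
      using uniform_quad_bound_above[OF eta] by blast
    define B where "B d = v i (x + eta) + T * (M0 * step_sum * sqrt d + q * cs n * d) + d * cs n + exp (- q * T) * K" for d
    have "\<forall>\<^sub>F N in sequentially. Jpay M q X C \<le> B (T / real N)"
      using eventually_ge_at_top[of "nat \<lceil>T\<rceil> + 1"]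
    proof eventually_elim
      case (elim N)
      \<comment> \<open>\<open>T \<le> N\<close> makes the mesh at most 1, as the Gaussian step
        requires.\<close>
      have N: "0 < real N" "T \<le> real N" using elim by linarith+
      define d where "d = T / real N"
      have d: "0 < d" "d \<le> 1" "real N * d = T" using N T by (auto simp: d_def)
      have "real N * (M0 * step_sum * (d * sqrt d) + q * cs n * d * d) = (real N * d) * (M0 * step_sum * sqrt d + q * cs n * d)"
        by (simp add: algebra_simps)
      then show ?case using Jpay_upper_grid[OF eta d(1,2) x M0, of N] unfolding B_def d_def [symmetric] d(3) by simp
    qed
    moreover have "(\<lambda>N. B (T / real N)) \<longlonglongrightarrow> B 0"
    proof -
      have "(\<lambda>N. T / real N) \<longlonglongrightarrow> 0" by (rule lim_const_over_n)
      have "isCont B 0" unfolding B_def by (intro continuous_intros)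
      from isCont_tendsto_compose[OF this \<open>(\<lambda>N. T / real N) \<longlonglongrightarrow> 0\<close>] show ?thesis .
    qed
    ultimately have "Jpay M q X C \<le> B 0" by (intro tendsto_lowerbound[of _ "B 0" sequentially]) auto
    then show ?thesis by (simp add: B_def)
  qed
  have "Jpay M q X C \<le> v i (x + eta)" if eta: "0 < eta" for eta
  proof (rule tendsto_lowerbound)
    show "\<forall>\<^sub>F T in at_top. Jpay M q X C \<le> v i (x + eta) + exp (- q * T) * K"
      using eventually_gt_at_top[of 0] by eventually_elim (rule T[OF eta])
    have "((\<lambda>T. exp (- q * T)) \<longlongrightarrow> 0) at_top"
      using q_pos by (intro filterlim_compose[OF exp_at_bot] filterlim_tendsto_neg_mult_at_bot[OF tendsto_const] filterlim_ident) auto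
    then have "((\<lambda>T. v i (x + eta) + exp (- q * T) * K) \<longlongrightarrow> v i (x + eta) + 0 * K) at_top" by (intro tendsto_intros)
    then show "((\<lambda>T. v i (x + eta) + exp (- q * T) * K) \<longlongrightarrow> v i (x + eta)) at_top" by simp
  qed simp
  then have "Jpay M q X C \<le> v i (x + inverse (real (Suc m)))" for m by simp
  moreover have "(\<lambda>m. v i (x + inverse (real (Suc m)))) \<longlonglongrightarrow> v i (x + 0)"
    by (rule continuous_on_tendsto_compose[OF v_cont[OF i, of UNIV] tendsto_add[OF tendsto_const LIMSEQ_inverse_real_of_nat]]) auto
  ultimately show ?thesis by (intro tendsto_lowerbound[of "\<lambda>m. v i (x + inverse (real (Suc m)))" _ sequentially]) auto
qed

end

subsection \<open>A grid control that pays almost v\<close>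

text \<open>The first level from \<open>j\<close> upwards that exceeds its successor by more than \<open>ep\<close>; such a level exists
  because the successor of the top level is \<open>- 1\<close>. Each skipped level costs at most \<open>ep\<close>.\<close>

definition next_level :: "real \<Rightarrow> real \<Rightarrow> nat \<Rightarrow> real \<Rightarrow> nat" where
  "next_level eta ep j y = (LEAST m. j \<le> m \<and> m \<le> n \<and> 1 \<le> m \<and> v (Suc m) (y - eta) + ep < v m (y - eta))"

lemma next_level_props:
  assumes ep: "0 < ep" "ep < 1" and j: "1 \<le> j" "j \<le> n"
  shows "j \<le> next_level eta ep j y" "next_level eta ep j y \<le> n"
    "v (Suc (next_level eta ep j y)) (y - eta) + ep < v (next_level eta ep j y) (y - eta)"
    "v j (y - eta) \<le> v (next_level eta ep j y) (y - eta) + ep * (real (next_level eta ep j y) - real j)"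
proof -
  define Q where "Q m \<longleftrightarrow> j \<le> m \<and> m \<le> n \<and> 1 \<le> m \<and> v (Suc m) (y - eta) + ep < v m (y - eta)" for m
  define r where "r = next_level eta ep j y"
  have r: "r = (LEAST m. Q m)" by (simp add: r_def next_level_def Q_def)
  have "Q n" unfolding Q_def using j n_pos ep v_bounds[of n "y - eta"] by (auto simp: v_top)
  then have Qr: "Q r" unfolding r by (rule LeastI)
  then show "j \<le> next_level eta ep j y" "next_level eta ep j y \<le> n"
    "v (Suc (next_level eta ep j y)) (y - eta) + ep < v (next_level eta ep j y) (y - eta)"
    unfolding r_def Q_def by auto
  have "v j (y - eta) \<le> v m (y - eta) + ep * (real m - real j)" if "j \<le> m" "m \<le> r" for m
    using that
  proof (induction m rule: dec_induct)
    case (step m)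
    have "\<not> Q m" using not_less_Least[of m Q] step unfolding r by simp
    then have "v m (y - eta) \<le> v (Suc m) (y - eta) + ep" using step j Qr unfolding Q_def by auto
    then show ?case using step by (simp add: algebra_simps)
  qed simp
  from this[of r] show "v j (y - eta) \<le> v (next_level eta ep j y) (y - eta) + ep * (real (next_level eta ep j y) - real j)"
    using Qr unfolding Q_def r_def by simp
qed

lemma next_level_measurable [measurable]: "next_level eta ep j \<in> measurable borel (count_space UNIV)"
  unfolding next_level_def [abs_def]
proof (rule measurable_Least)
  fix m
  show "Measurable.pred borel (\<lambda>y. j \<le> m \<and> m \<le> n \<and> 1 \<le> m \<and> v (Suc m) (y - eta) + ep < v m (y - eta))"
  proof (cases "m \<le> n \<and> 1 \<le> m")
    case True
    have [measurable]: "v m \<in> borel_measurable borel" using v_meas True by simp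
    have [measurable]: "v (Suc m) \<in> borel_measurable borel"
      using v_meas[of "Suc m"] True v_top by (cases "m = n") auto
    show ?thesis by measurable
  qed auto
qed

text \<open>The level stored at step \<open>k\<close> is already the updated one and governs the
  cell that starts there; choosing it from the surplus at the start of the cell keeps the control
  adapted.\<close>

primrec grid_state :: "real \<Rightarrow> real \<Rightarrow> real \<Rightarrow> nat \<Rightarrow> nat \<Rightarrow> 'a \<Rightarrow> nat \<times> real" where
  "grid_state eta ep d i 0 = (\<lambda>\<omega>. (next_level eta ep i x, x))"
| "grid_state eta ep d i (Suc k) = (\<lambda>\<omega>. (\<lambda>y. (next_level eta ep (fst (grid_state eta ep d i k \<omega>)) y, y))
     (snd (grid_state eta ep d i k \<omega>) + (mu - cs (fst (grid_state eta ep d i k \<omega>))) * d + sg * (W (real k * d + d) \<omega> - W (real k * d) \<omega>)))"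

context
  fixes eta ep d :: real and i :: nat
  assumes eta: "0 < eta" "eta < x" and ep: "0 < ep" "ep < 1" and d: "0 < d" "d \<le> 1" and i: "1 \<le> i" "i \<le> n"
begin

definition level :: "nat \<Rightarrow> 'a \<Rightarrow> nat" where "level k \<omega> = fst (grid_state eta ep d i k \<omega>)"
definition grid_surplus :: "nat \<Rightarrow> 'a \<Rightarrow> real" where "grid_surplus k \<omega> = snd (grid_state eta ep d i k \<omega>)"

lemma level_0: "level 0 \<omega> = next_level eta ep i x" and grid_surplus_0: "grid_surplus 0 \<omega> = x"
  and level_Suc: "level (Suc k) \<omega> = next_level eta ep (level k \<omega>) (grid_surplus (Suc k) \<omega>)"
  and grid_surplus_Suc: "grid_surplus (Suc k) \<omega> = grid_surplus k \<omega> + (mu - cs (level k \<omega>)) * d + sg * (W (real k * d + d) \<omega> - W (real k * d) \<omega>)"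
  by (simp_all add: level_def grid_surplus_def)

lemma level_range: "1 \<le> level k \<omega> \<and> i \<le> level k \<omega> \<and> level k \<omega> \<le> n"
proof (induction k)
  case 0 show ?case using next_level_props[OF ep i] i by (auto simp: level_0 intro: order_trans)
next
  case (Suc k)
  then show ?case using next_level_props(1,2)[OF ep, where j="level k \<omega>" and y="grid_surplus (Suc k) \<omega>" and eta=eta] by (auto simp: level_Suc)
qed

lemma level_mono: "k \<le> l \<Longrightarrow> level k \<omega> \<le> level l \<omega>"
proof (induction l rule: dec_induct)
  case (step l)
  have "level l \<omega> \<le> level (Suc l) \<omega>" using next_level_props(1)[OF ep, of "level l \<omega>"] level_range[of l \<omega>] by (simp add: level_Suc)
  then show ?case using step by simp
qed simp

text \<open>Every stored level comes out of \<open>next_level\<close>, so the gap condition for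
  touching from below holds at each grid time.\<close>

lemma level_ready: "v (Suc (level k \<omega>)) (grid_surplus k \<omega> - eta) + ep < v (level k \<omega>) (grid_surplus k \<omega> - eta)"
proof (cases k)
  case 0 then show ?thesis using next_level_props(3)[OF ep i] by (simp add: level_0 grid_surplus_0)
next
  case (Suc m)
  then show ?thesis using next_level_props(3)[OF ep, of "level m \<omega>"] level_range[of m \<omega>] by (simp add: level_Suc)
qed

lemma grid_state_Filt:
  "level k \<in> measurable (Filt (real k * d)) (count_space UNIV) \<and> grid_surplus k \<in> borel_measurable (Filt (real k * d))"
proof (induction k)
  case 0
  have "level 0 = (\<lambda>_. next_level eta ep i x)" "grid_surplus 0 = (\<lambda>_. x)" by (auto simp: level_0 grid_surplus_0)
  then show ?case by simp
next
  case (Suc k)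
  define F where "F = Filt (real (Suc k) * d)"
  have le: "real k * d \<le> real (Suc k) * d" using d by (simp add: mult_right_mono)
  have J [measurable]: "level k \<in> measurable F (count_space UNIV)" and X' [measurable]: "grid_surplus k \<in> borel_measurable F"
    using Suc measurable_Filt_mono[OF le] unfolding F_def by blast+
  have [measurable]: "W (real k * d) \<in> borel_measurable F" "W (real k * d + d) \<in> borel_measurable F"
    unfolding F_def using d le by (auto intro!: W_Filt simp: algebra_simps)
  have [measurable]: "(\<lambda>\<omega>. cs (level k \<omega>)) \<in> borel_measurable F" using J by measurable
  have X2 [measurable]: "grid_surplus (Suc k) \<in> borel_measurable F"
    unfolding grid_surplus_Suc [abs_def] by measurable
  have "(\<lambda>\<omega>. next_level eta ep (level k \<omega>) (grid_surplus (Suc k) \<omega>)) \<in> measurable F (count_space UNIV)"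
    by (rule measurable_compose_countable[OF _ J]) measurable
  then have "level (Suc k) \<in> measurable F (count_space UNIV)" unfolding level_Suc [abs_def] .
  then show ?case using X2 unfolding F_def by blast
qed

lemma level_meas [measurable]: "level k \<in> measurable M (count_space UNIV)"
  and grid_surplus_meas [measurable]: "grid_surplus k \<in> borel_measurable M"
  using grid_state_Filt[of k] measurable_Filt_imp by blast+

text \<open>The threshold is \<open>eta\<close> instead of 0 for two reasons: the shifted value
  \<open>v j (y - eta)\<close> vanishes once \<open>y\<close> is at or below it, and the margin
  protects against ruin between grid times.\<close>

definition grid_alive :: "nat \<Rightarrow> 'a set" where
  "grid_alive k = {\<omega> \<in> space M. \<forall>l\<le>k. eta < grid_surplus l \<omega>}"

lemma grid_alive_Filt: "grid_alive k \<in> sets (Filt (real k * d))"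
proof -
  have "{\<omega> \<in> space (Filt (real k * d)). \<forall>l\<in>{..k}. eta < grid_surplus l \<omega>} \<in> sets (Filt (real k * d))"
  proof (rule sets.sets_Collect_finite_All)
    fix l assume "l \<in> {..k}"
    then have "real l * d \<le> real k * d" using d by simp
    then have [measurable]: "grid_surplus l \<in> borel_measurable (Filt (real k * d))"
      using grid_state_Filt[of l] measurable_Filt_mono by blast
    show "{\<omega> \<in> space (Filt (real k * d)). eta < grid_surplus l \<omega>} \<in> sets (Filt (real k * d))" by measurable
  qed simp
  moreover have "grid_alive k = {\<omega> \<in> space (Filt (real k * d)). \<forall>l\<in>{..k}. eta < grid_surplus l \<omega>}"
    unfolding grid_alive_def space_Filt by blast
  ultimately show ?thesis by (simp only:)
qed

text \<open>The counterpart of \<open>upper_grid\<close>. Leaving \<open>grid_alive\<close> loses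
  nothing, as the shifted value is 0 there. A switch costs \<open>ep\<close> per level and levels
  never fall, so all later switches cost at most \<open>ep * real n\<close>; the initial choice
  costs at most as much again, hence the factor 2.\<close>

lemma lower_grid:
  assumes M0: "0 \<le> M0" "\<And>j y. j \<in> {1..n} \<Longrightarrow> 0 < y \<Longrightarrow> v (Suc j) y + ep < v j y \<Longrightarrow> quad_bound mu sg q (cs j) (- 1) (v j) M0 y"
  shows "v i (x - eta) - 2 * ep * real n - real N * (M0 * step_sum * (d * sqrt d) + q\<^sup>2 * d\<^sup>2 * K) - exp (- q * (real N * d)) * K
     \<le> (\<Sum>k<N. exp (- q * (real k * d)) * d * (\<integral>\<omega>. indicator (grid_alive k) \<omega> * cs (level k \<omega>) \<partial>M))"
proof -
  define f where "f j y = v j (y - eta)" for j y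
  define g where "g k \<omega> = f (level k \<omega>) (grid_surplus k \<omega>)" for k \<omega>
  define E where "E k = exp (- q * (real k * d))" for k
  define b where "b k = E k * (\<integral>\<omega>. indicator (grid_alive k) \<omega> * g k \<omega> \<partial>M)" for k
  define p where "p k = E k * d * (\<integral>\<omega>. indicator (grid_alive k) \<omega> * cs (level k \<omega>) \<partial>M)" for k
  \<comment> \<open>The second summand is the defect in
    \<open>(1 - q * d) * (1 + q * d) = 1 - q^2 * d^2\<close>: from below, discount and growth do not
    cancel exactly.\<close>
  define R where "R = M0 * step_sum * (d * sqrt d) + q\<^sup>2 * d\<^sup>2 * K"
  \<comment> \<open>The expected level: its increments measure the cost of switching and
    telescope.\<close>
  define j where "j k = (\<integral>\<omega>. real (level k \<omega>) \<partial>M)" for k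
  have tk: "0 \<le> real k * d" for k using d by simp
  have fm: "f j \<in> borel_measurable borel" if "j \<in> {1..n}" for j
  proof -
    have [measurable]: "v j \<in> borel_measurable borel" using v_meas[of j] that by simp
    show ?thesis unfolding f_def [abs_def] by measurable
  qed
  have fb: "0 \<le> f j y \<and> f j y \<le> K" if "j \<in> {1..n}" for j y
    unfolding f_def using v_bounds that by simp
  have Jr: "level k \<omega> \<in> {1..n}" for k \<omega> using level_range by simp
  have Am [measurable]: "grid_alive k \<in> events" for k using grid_alive_Filt Filt_subset by blast
  have gm [measurable]: "g k \<in> borel_measurable M" for k
    unfolding g_def using index_compose_measurable[OF level_meas Jr fm grid_surplus_meas] .
  have gb: "0 \<le> g k \<omega> \<and> g k \<omega> \<le> K" for k \<omega> unfolding g_def using fb Jr by blast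
  have Cb: "0 \<le> cs (level k \<omega>) \<and> cs (level k \<omega>) \<le> cs n" for k \<omega> using cs_bounds Jr[of k \<omega>] by simp
  have csm [measurable]: "(\<lambda>\<omega>. cs (level k \<omega>)) \<in> borel_measurable M" for k using level_meas by measurable
  have ig: "integrable M (\<lambda>\<omega>. indicator (grid_alive k) \<omega> * g k \<omega>)" for k
    using gb by (intro bounded_integrable[where B=K]) (auto simp: indicator_def K_nonneg)
  have iC: "integrable M (\<lambda>\<omega>. indicator (grid_alive k) \<omega> * cs (level k \<omega>))" for k
    using Cb by (intro bounded_integrable[where B="cs n"]) (auto simp: indicator_def cbar_nonneg)
  have iJ: "integrable M (\<lambda>\<omega>. real (level k \<omega>))" for k
    using Jr by (intro bounded_integrable[where B="real n"]) auto
  have ESuc: "E (Suc k) = E k * exp (- (q * d))" for k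
    by (simp add: E_def exp_add [symmetric] algebra_simps)
  have E01: "0 < E k" "E k \<le> 1" for k using q_pos d by (auto simp: E_def)
  have jmono: "j k \<le> j (Suc k)" for k
    unfolding j_def using level_mono[of k "Suc k"] by (intro integral_mono iJ) auto
  have rec: "b k \<le> b (Suc k) + p k + R + ep * (j (Suc k) - j k)" for k
  proof -
    have step: "- 1 * (\<integral>\<omega>. indicator (grid_alive k) \<omega> * f (level k \<omega>) (grid_surplus k \<omega> + (mu - cs (level k \<omega>)) * d + sg * (W (real k * d + d) \<omega> - W (real k * d) \<omega>)) \<partial>M)
      \<le> - 1 * (\<integral>\<omega>. indicator (grid_alive k) \<omega> * (f (level k \<omega>) (grid_surplus k \<omega>) * (1 + q * d) - cs (level k \<omega>) * d) \<partial>M) + M0 * step_sum * (d * sqrt d)"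
    proof (rule family_step[OF tk d grid_alive_Filt conjunct2[OF grid_state_Filt] conjunct1[OF grid_state_Filt] Jr fm fb _ M0(1)])
      fix \<omega> assume "\<omega> \<in> grid_alive k"
      then have w: "\<omega> \<in> space M" "eta < grid_surplus k \<omega>" by (auto simp: grid_alive_def)
      have "quad_bound mu sg q (cs (level k \<omega>)) (- 1) (v (level k \<omega>)) M0 (grid_surplus k \<omega> + - eta)"
        using M0(2)[OF Jr, of "grid_surplus k \<omega> - eta" k \<omega>] w level_ready[of k \<omega>] by simp
      then show "quad_bound mu sg q (cs (level k \<omega>)) (- 1) (f (level k \<omega>)) M0 (grid_surplus k \<omega>)"
        unfolding f_def [abs_def] quad_bound_shift [symmetric] by simp
    qed auto
    define G where "G = (\<integral>\<omega>. indicator (grid_alive k) \<omega> * g k \<omega> \<partial>M)"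
    define G' where "G' = (\<integral>\<omega>. indicator (grid_alive (Suc k)) \<omega> * g (Suc k) \<omega> \<partial>M)"
    define H where "H = (\<integral>\<omega>. indicator (grid_alive k) \<omega> * cs (level k \<omega>) \<partial>M)"
    define R1 where "R1 = M0 * step_sum * (d * sqrt d)"
    have "(\<integral>\<omega>. indicator (grid_alive k) \<omega> * (f (level k \<omega>) (grid_surplus k \<omega>) * (1 + q * d) - cs (level k \<omega>) * d) \<partial>M) = (1 + q * d) * G - d * H"
    proof -
      have "(\<integral>\<omega>. indicator (grid_alive k) \<omega> * (f (level k \<omega>) (grid_surplus k \<omega>) * (1 + q * d) - cs (level k \<omega>) * d) \<partial>M)
        = (\<integral>\<omega>. (1 + q * d) * (indicator (grid_alive k) \<omega> * g k \<omega>) - d * (indicator (grid_alive k) \<omega> * cs (level k \<omega>)) \<partial>M)"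
        by (rule Bochner_Integration.integral_cong) (auto simp: g_def algebra_simps)
      also have "\<dots> = (1 + q * d) * G - d * H"
        unfolding G_def H_def using ig[of k] iC[of k] by (simp only: Bochner_Integration.integral_diff integrable_mult_right Bochner_Integration.integral_mult_right)
      finally show ?thesis .
    qed
    moreover have "(\<integral>\<omega>. indicator (grid_alive k) \<omega> * f (level k \<omega>) (grid_surplus (Suc k) \<omega>) \<partial>M) \<le> G' + ep * (j (Suc k) - j k)"
    proof -
      have nm: "(\<lambda>\<omega>. f (level k \<omega>) (grid_surplus (Suc k) \<omega>)) \<in> borel_measurable M"
        using index_compose_measurable[OF level_meas Jr fm grid_surplus_meas] .
      have "(\<integral>\<omega>. indicator (grid_alive k) \<omega> * f (level k \<omega>) (grid_surplus (Suc k) \<omega>) \<partial>M)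
         \<le> (\<integral>\<omega>. indicator (grid_alive (Suc k)) \<omega> * g (Suc k) \<omega> + ep * (real (level (Suc k) \<omega>) - real (level k \<omega>)) \<partial>M)"
      proof (rule integral_mono)
        show "integrable M (\<lambda>\<omega>. indicator (grid_alive k) \<omega> * f (level k \<omega>) (grid_surplus (Suc k) \<omega>))"
          using nm fb[OF Jr] by (intro bounded_integrable[where B=K]) (auto simp: indicator_def K_nonneg)
        show "integrable M (\<lambda>\<omega>. indicator (grid_alive (Suc k)) \<omega> * g (Suc k) \<omega> + ep * (real (level (Suc k) \<omega>) - real (level k \<omega>)))"
          using ig iJ by (intro Bochner_Integration.integrable_add integrable_mult_right Bochner_Integration.integrable_diff)
        fix \<omega>
        have e0: "0 \<le> ep * (real (level (Suc k) \<omega>) - real (level k \<omega>))" using ep level_mono[of k "Suc k" \<omega>] by simp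
        have le: "f (level k \<omega>) (grid_surplus (Suc k) \<omega>) \<le> g (Suc k) \<omega> + ep * (real (level (Suc k) \<omega>) - real (level k \<omega>))"
          unfolding f_def g_def using next_level_props(4)[OF ep, where j="level k \<omega>" and y="grid_surplus (Suc k) \<omega>" and eta=eta] level_range[of k \<omega>] by (simp add: level_Suc)
        show "indicator (grid_alive k) \<omega> * f (level k \<omega>) (grid_surplus (Suc k) \<omega>) \<le> indicator (grid_alive (Suc k)) \<omega> * g (Suc k) \<omega> + ep * (real (level (Suc k) \<omega>) - real (level k \<omega>))"
        proof (cases "\<omega> \<in> grid_alive (Suc k)")
          case True
          then have "\<omega> \<in> grid_alive k" by (auto simp: grid_alive_def)
          then show ?thesis using True le by simp
        next
          case False
          show ?thesis
          proof (cases "\<omega> \<in> grid_alive k")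
            case True
            then have "grid_surplus (Suc k) \<omega> \<le> eta" using False by (auto simp: grid_alive_def le_Suc_eq not_less)
            then have "f (level k \<omega>) (grid_surplus (Suc k) \<omega>) = 0" unfolding f_def using v_zero level_range[of k \<omega>] by simp
            then show ?thesis using e0 False by simp
          next
            case F: False then show ?thesis using e0 False by simp
          qed
        qed
      qed
      also have "\<dots> = G' + ep * (j (Suc k) - j k)"
        unfolding G'_def j_def using ig[of "Suc k"] iJ[of k] iJ[of "Suc k"] by simp
      finally show ?thesis .
    qed
    ultimately have main: "(1 + q * d) * G - d * H - R1 \<le> G' + ep * (j (Suc k) - j k)"
      using step unfolding grid_surplus_Suc R1_def by linarith
    have G0: "0 \<le> G" "G \<le> K"
    proof -
      show "0 \<le> G" unfolding G_def using gb by (intro integral_nonneg_AE AE_I2) (auto simp: indicator_def)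
      have "G \<le> (\<integral>\<omega>. K \<partial>M)" unfolding G_def using ig gb
        by (intro integral_mono) (auto simp: indicator_def K_nonneg)
      then show "G \<le> K" by (simp add: prob_space)
    qed
    have H0: "0 \<le> H" unfolding H_def using Cb by (intro integral_nonneg_AE AE_I2) (auto simp: indicator_def)
    define m where "m = exp (- (q * d))"
    have m: "0 < m" "m \<le> 1" "1 - q * d \<le> m"
      using q_pos d exp_ge_add_one_self[of "- (q * d)"] by (auto simp: m_def)
    have R1: "0 \<le> R1" unfolding R1_def using M0(1) step_sum_nonneg d by simp
    have dj: "0 \<le> ep * (j (Suc k) - j k)" using ep jmono by simp
    have "G \<le> m * G' + d * H + R + ep * (j (Suc k) - j k)"
    proof -
      have "m * ((1 + q * d) * G - d * H - R1) \<le> m * (G' + ep * (j (Suc k) - j k))"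
        using main m by (intro mult_left_mono) auto
      moreover have "m * (d * H) \<le> 1 * (d * H)" using m H0 d by (intro mult_right_mono) auto
      moreover have "m * R1 \<le> 1 * R1" using m R1 by (intro mult_right_mono) auto
      moreover have "m * (ep * (j (Suc k) - j k)) \<le> 1 * (ep * (j (Suc k) - j k))" using m dj by (intro mult_right_mono) auto
      moreover have "(1 - q * d) * ((1 + q * d) * G) \<le> m * ((1 + q * d) * G)" using m G0 q_pos d by (intro mult_right_mono) auto
      moreover have "q\<^sup>2 * d\<^sup>2 * G \<le> q\<^sup>2 * d\<^sup>2 * K" using G0 by (intro mult_left_mono) auto
      moreover have "(1 - q * d) * ((1 + q * d) * G) = G - q\<^sup>2 * d\<^sup>2 * G" by (simp add: algebra_simps power2_eq_square)
      moreover have "m * ((1 + q * d) * G - d * H - R1) = m * ((1 + q * d) * G) - m * (d * H) - m * R1" by (simp add: algebra_simps)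
      moreover have "m * (G' + ep * (j (Suc k) - j k)) = m * G' + m * (ep * (j (Suc k) - j k))" by (simp add: algebra_simps)
      moreover have "R = R1 + q\<^sup>2 * d\<^sup>2 * K" by (simp add: R_def R1_def)
      ultimately show ?thesis by linarith
    qed
    then have "E k * G \<le> E k * (m * G' + d * H + R + ep * (j (Suc k) - j k))" using E01[of k] by (intro mult_left_mono) auto
    also have "\<dots> \<le> E k * m * G' + E k * d * H + R + ep * (j (Suc k) - j k)"
    proof -
      have "0 \<le> R" unfolding R_def R1_def [symmetric] using R1 K_nonneg by (intro add_nonneg_nonneg mult_nonneg_nonneg) auto
      then have "E k * (R + ep * (j (Suc k) - j k)) \<le> 1 * (R + ep * (j (Suc k) - j k))" using E01[of k] dj by (intro mult_right_mono) auto
      then show ?thesis by (simp add: algebra_simps)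
    qed
    finally show ?thesis unfolding b_def p_def ESuc G_def G'_def H_def m_def by simp
  qed
  have "b 0 \<le> b N + (\<Sum>k<N. p k) + real N * R + ep * (j N - j 0)" for N
  proof (induction N)
    case (Suc N)
    then show ?case using rec[of N] by (simp add: algebra_simps)
  qed simp
  then have "b 0 \<le> b N + (\<Sum>k<N. p k) + real N * R + ep * (j N - j 0)" .
  moreover have "ep * (j N - j 0) \<le> ep * real n"
  proof -
    have "j N \<le> (\<integral>\<omega>. real n \<partial>M)" unfolding j_def using Jr by (intro integral_mono iJ) auto
    moreover have "0 \<le> j 0" unfolding j_def by (intro integral_nonneg_AE AE_I2) auto
    ultimately show ?thesis using ep by (intro mult_left_mono) (auto simp: prob_space)
  qed
  moreover have "b N \<le> exp (- q * (real N * d)) * K"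
  proof -
    have "(\<integral>\<omega>. indicator (grid_alive N) \<omega> * g N \<omega> \<partial>M) \<le> (\<integral>\<omega>. K \<partial>M)" using ig gb
      by (intro integral_mono) (auto simp: indicator_def K_nonneg)
    then show ?thesis unfolding b_def E_def by (intro mult_left_mono) (auto simp: prob_space)
  qed
  moreover have "v i (x - eta) - ep * real n \<le> b 0"
  proof -
    define r where "r = next_level eta ep i x"
    have r: "i \<le> r" "r \<le> n" "v i (x - eta) \<le> v r (x - eta) + ep * (real r - real i)"
      using next_level_props[OF ep i, where y=x and eta=eta] by (auto simp: r_def)
    have "ep * (real r - real i) \<le> ep * real n" using ep r by (intro mult_left_mono) auto
    moreover have "b 0 = v r (x - eta)"
    proof -
      have "(\<integral>\<omega>. indicator (grid_alive 0) \<omega> * g 0 \<omega> \<partial>M) = (\<integral>\<omega>. v r (x - eta) \<partial>M)"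
        using eta by (intro Bochner_Integration.integral_cong) (auto simp: grid_alive_def grid_surplus_0 g_def f_def level_0 r_def)
      then show ?thesis by (simp add: b_def E_def prob_space)
    qed
    ultimately show ?thesis using r(3) by linarith
  qed
  ultimately show ?thesis unfolding p_def E_def R_def by simp
qed

section \<open>The grid control as a continuous-time control\<close>

definition grid_control :: "real \<Rightarrow> 'a \<Rightarrow> real" where
  "grid_control t \<omega> = cs (level (nat \<lfloor>t / d\<rfloor>) \<omega>)"

lemma level_in: "level k \<omega> \<in> {1..n}"
  using level_range[of k \<omega>] by simp

lemma grid_control_cell: "real k * d \<le> t \<Longrightarrow> t < real (Suc k) * d \<Longrightarrow> grid_control t \<omega> = cs (level k \<omega>)"
  using grid_index[OF d(1)] by (simp add: grid_control_def)

lemma grid_control_bounds: "0 \<le> grid_control t \<omega> \<and> grid_control t \<omega> \<le> cs n"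
  unfolding grid_control_def using cs_bounds level_in by (metis atLeastAtMost_iff)

lemma grid_control_admissible: "admissible M X (cs ` {1..n}) (cs i) grid_control"
  unfolding admissible_def
proof (intro conjI allI impI ballI)
  fix t :: real and U :: "real set" assume t: "0 \<le> t" and U: "U \<in> sets borel"
  obtain k where k: "real k * d \<le> t" "t < real (Suc k) * d" using grid_cell_exists[OF d(1) t] by blast
  have "level k \<in> measurable (Filt t) (count_space UNIV)"
    using conjunct1[OF grid_state_Filt] measurable_Filt_mono[OF k(1)] by blast
  then have "(\<lambda>\<omega>. cs (level k \<omega>)) \<in> borel_measurable (Filt t)" by measurable
  then have "(\<lambda>\<omega>. cs (level k \<omega>)) -` U \<inter> space (Filt t) \<in> sets (Filt t)" using U by (rule measurable_sets)
  moreover have "grid_control t = (\<lambda>\<omega>. cs (level k \<omega>))" using grid_control_cell[OF k] by auto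
  ultimately show "grid_control t -` U \<inter> space M \<in> nat_filt M X t" by (simp add: sets_Filt)
next
  fix \<omega> assume w: "\<omega> \<in> space M"
  show "mono_on {0..} (\<lambda>t. grid_control t \<omega>)"
  proof (rule mono_onI)
    fix r s :: real assume rs: "r \<in> {0..}" "s \<in> {0..}" "r \<le> s"
    have "nat \<lfloor>r / d\<rfloor> \<le> nat \<lfloor>s / d\<rfloor>" using rs d by (intro nat_mono floor_mono divide_right_mono) auto
    then have "level (nat \<lfloor>r / d\<rfloor>) \<omega> \<le> level (nat \<lfloor>s / d\<rfloor>) \<omega>" by (rule level_mono)
    then show "grid_control r \<omega> \<le> grid_control s \<omega>" unfolding grid_control_def using level_in cs_le_iff by (metis atLeastAtMost_iff)
  qed
  fix t :: real assume t: "0 \<le> t"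
  show "grid_control t \<omega> \<in> cs ` {1..n}" unfolding grid_control_def using level_in by blast
  show "cs i \<le> grid_control t \<omega>" unfolding grid_control_def using level_range i cs_le_iff by metis
  obtain k where k: "real k * d \<le> t" "t < real (Suc k) * d" using grid_cell_exists[OF d(1) t] by blast
  have "\<forall>\<^sub>F s in at_right t. grid_control t \<omega> = grid_control s \<omega>"
    unfolding eventually_at_right[OF k(2)]
  proof (intro exI[of _ "real (Suc k) * d"] conjI allI impI k(2))
    fix s assume "t < s" "s < real (Suc k) * d"
    then show "grid_control t \<omega> = grid_control s \<omega>" using grid_control_cell[OF k] grid_control_cell[of k s] k by simp
  qed
  then have "((\<lambda>s. grid_control s \<omega>) \<longlongrightarrow> grid_control t \<omega>) (at_right t)"
    by (rule Lim_transform_eventually[OF tendsto_const])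
  then show "continuous (at_right t) (\<lambda>s. grid_control s \<omega>)" by (simp add: continuous_within)
qed

lemma grid_control_pair_measurable [measurable]: "(\<lambda>(\<omega>, s). grid_control s \<omega>) \<in> borel_measurable (M \<Otimes>\<^sub>M lborel)"
proof -
  have "(\<lambda>p. (\<lambda>k p. cs (level k (fst p))) (nat \<lfloor>snd p / d\<rfloor>) p) \<in> borel_measurable (M \<Otimes>\<^sub>M lborel)"
  proof (rule measurable_compose_countable[where f="\<lambda>k p. cs (level k (fst p))" and g="\<lambda>p. nat \<lfloor>snd p / d\<rfloor>"])
    fix k
    have [measurable]: "level k \<in> measurable M (count_space UNIV)" using level_meas .
    show "(\<lambda>p. cs (level k (fst p))) \<in> borel_measurable (M \<Otimes>\<^sub>M lborel)" by measurable
  next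
    show "(\<lambda>p. nat \<lfloor>snd p / d\<rfloor>) \<in> measurable (M \<Otimes>\<^sub>M lborel) (count_space UNIV)" by measurable
  qed
  then show ?thesis by (simp add: grid_control_def case_prod_beta')
qed

lemma grid_control_integral_mono:
  assumes w: "\<omega> \<in> space M" and rs: "0 \<le> r" "r \<le> s"
  shows "(LINT u:{0..r}|lborel. grid_control u \<omega>) \<le> (LINT u:{0..s}|lborel. grid_control u \<omega>)"
  unfolding set_lebesgue_integral_def
proof (rule integral_mono)
  show "integrable lborel (\<lambda>u. indicat_real {0..r} u *\<^sub>R grid_control u \<omega>)" "integrable lborel (\<lambda>u. indicat_real {0..s} u *\<^sub>R grid_control u \<omega>)"
    using C_path_integrable[OF grid_control_admissible i w] unfolding set_integrable_def by blast+
  show "indicat_real {0..r} u *\<^sub>R grid_control u \<omega> \<le> indicat_real {0..s} u *\<^sub>R grid_control u \<omega>" for u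
    using rs grid_control_bounds[of u \<omega>] by (auto simp: indicator_def)
qed

lemma surplus_measurable: "0 \<le> r \<Longrightarrow> surplusC X grid_control r \<in> borel_measurable M"
proof -
  assume r: "0 \<le> r"
  have "(\<lambda>(\<omega>, s). indicat_real {0..r} s *\<^sub>R grid_control s \<omega>) \<in> borel_measurable (M \<Otimes>\<^sub>M lborel)"
    using grid_control_pair_measurable unfolding case_prod_beta' by measurable
  then have "(\<lambda>\<omega>. LINT s:{0..r}|lborel. grid_control s \<omega>) \<in> borel_measurable M"
    unfolding set_lebesgue_integral_def by (rule lborel.borel_measurable_lebesgue_integral)
  then show ?thesis unfolding surplusC_def [abs_def] using X_meas[OF r] by measurable
qed

lemma W_tendsto_right:
  assumes w: "\<omega> \<in> space M" and t: "0 \<le> t"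
  shows "((\<lambda>s. W s \<omega>) \<longlongrightarrow> W t \<omega>) (at_right t)"
proof -
  have "((\<lambda>s. W s \<omega>) \<longlongrightarrow> W t \<omega>) (at t within {0..})" using W_cont[OF w] t by (simp add: continuous_on)
  then show ?thesis by (rule tendsto_within_subset) (use t in auto)
qed

text \<open>The Brownian path is continuous and the accumulated payments are nondecreasing, so a
  strictly negative surplus stays negative for a while afterwards and rational times suffice. Ruin
  before \<open>a\<close> thus becomes a countable union of events.\<close>

lemma ruin_time_less_iff:
  assumes w: "\<omega> \<in> space M"
  shows "ruin_time X grid_control \<omega> < a \<longleftrightarrow> (\<exists>r\<in>{r\<in>\<rat>. 0 \<le> r \<and> ereal r < a}. surplusC X grid_control r \<omega> < 0)"
proof
  assume "ruin_time X grid_control \<omega> < a"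
  then obtain t where t: "0 \<le> t" "surplusC X grid_control t \<omega> < 0" "ereal t < a"
    unfolding ruin_time_def Inf_less_iff by auto
  have "((\<lambda>s. X s \<omega>) \<longlongrightarrow> X t \<omega>) (at_right t)"
    unfolding Xproc_def by (intro tendsto_intros W_tendsto_right[OF w t(1)])
  then have ev: "\<forall>\<^sub>F s in at_right t. X s \<omega> < X t \<omega> - surplusC X grid_control t \<omega>"
    using t(2) by (intro order_tendstoD) auto
  have "((\<lambda>s. ereal s) \<longlongrightarrow> ereal t) (at_right t)" by (intro tendsto_intros)
  then have "\<forall>\<^sub>F s in at_right t. ereal s < a" using t(3) by (rule order_tendstoD)
  then have "\<forall>\<^sub>F s in at_right t. X s \<omega> < X t \<omega> - surplusC X grid_control t \<omega> \<and> ereal s < a" using ev by eventually_elim simp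
  then obtain b where b: "t < b" "\<And>s. t < s \<Longrightarrow> s < b \<Longrightarrow> X s \<omega> < X t \<omega> - surplusC X grid_control t \<omega> \<and> ereal s < a"
    unfolding eventually_at_right[of t "t + 1", simplified] by blast
  obtain r where r: "r \<in> \<rat>" "t < r" "r < b" using Rats_dense_in_real[OF b(1)] by blast
  have "surplusC X grid_control r \<omega> \<le> X r \<omega> - (X t \<omega> - surplusC X grid_control t \<omega>)"
    using grid_control_integral_mono[OF w t(1), of r] r by (simp add: surplusC_def)
  then have "surplusC X grid_control r \<omega> < 0" using b(2)[OF r(2,3)] by simp
  then show "\<exists>r\<in>{r\<in>\<rat>. 0 \<le> r \<and> ereal r < a}. surplusC X grid_control r \<omega> < 0"
    using b(2)[OF r(2,3)] r t(1) by (intro bexI[of _ r]) auto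
next
  assume "\<exists>r\<in>{r\<in>\<rat>. 0 \<le> r \<and> ereal r < a}. surplusC X grid_control r \<omega> < 0"
  then show "ruin_time X grid_control \<omega> < a" unfolding ruin_time_def Inf_less_iff by auto
qed

lemma ruin_time_measurable [measurable]: "ruin_time X grid_control \<in> borel_measurable M"
  unfolding borel_measurable_ereal_iff_Iio
proof
  fix a :: ereal
  have "{\<omega> \<in> space M. \<exists>r\<in>{r\<in>\<rat>. 0 \<le> r \<and> ereal r < a}. surplusC X grid_control r \<omega> < 0} \<in> sets M"
  proof (rule sets.sets_Collect_countable_Ex')
    fix r assume "r \<in> {r\<in>\<rat>. 0 \<le> r \<and> ereal r < a}"
    then have [measurable]: "surplusC X grid_control r \<in> borel_measurable M" using surplus_measurable by simp
    show "{\<omega> \<in> space M. surplusC X grid_control r \<omega> < 0} \<in> sets M" by measurable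
  next
    show "countable {r\<in>\<rat>. 0 \<le> r \<and> ereal r < a}" by (rule countable_subset[OF _ countable_rat]) auto
  qed
  moreover have "ruin_time X grid_control -` {..<a} \<inter> space M = {\<omega> \<in> space M. \<exists>r\<in>{r\<in>\<rat>. 0 \<le> r \<and> ereal r < a}. surplusC X grid_control r \<omega> < 0}"
    using ruin_time_less_iff by blast
  ultimately show "ruin_time X grid_control -` {..<a} \<inter> space M \<in> sets M" by (simp only:)
qed

definition grid_payoff :: "'a \<Rightarrow> real" where
  "grid_payoff \<omega> = (LINT s:{s. 0 \<le> s \<and> ereal s < ruin_time X grid_control \<omega>}|lborel. exp (- q * s) * grid_control s \<omega>)"

text \<open>For a lower estimate the default value of the integral is of no help, since a
  non-integrable payoff would count as 0. Hence joint measurability in \<open>(\<omega>, s)\<close>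
  is established for the grid control.\<close>

lemma grid_payoff_measurable: "grid_payoff \<in> borel_measurable M"
proof -
  have "(\<lambda>(\<omega>, s). indicat_real {s. 0 \<le> s \<and> ereal s < ruin_time X grid_control \<omega>} s *\<^sub>R (exp (- q * s) * grid_control s \<omega>)) \<in> borel_measurable (M \<Otimes>\<^sub>M lborel)"
  proof -
    have [measurable]: "Measurable.pred (M \<Otimes>\<^sub>M lborel) (\<lambda>p. 0 \<le> snd p \<and> ereal (snd p) < ruin_time X grid_control (fst p))" by measurable
    have [measurable]: "(\<lambda>p. grid_control (snd p) (fst p)) \<in> borel_measurable (M \<Otimes>\<^sub>M lborel)"
      using grid_control_pair_measurable unfolding case_prod_beta' .
    have "(\<lambda>p. (if 0 \<le> snd p \<and> ereal (snd p) < ruin_time X grid_control (fst p) then 1 else 0) * (exp (- q * snd p) * grid_control (snd p) (fst p))) \<in> borel_measurable (M \<Otimes>\<^sub>M lborel)"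
      by measurable
    then show ?thesis by (simp add: case_prod_beta' indicator_def of_bool_def)
  qed
  then show ?thesis unfolding grid_payoff_def [abs_def] set_lebesgue_integral_def
    by (rule lborel.borel_measurable_lebesgue_integral)
qed

lemma grid_payoff_integrand_integrable:
  assumes w: "\<omega> \<in> space M"
  shows "integrable lborel (\<lambda>s. indicat_real {s. 0 \<le> s \<and> ereal s < ruin_time X grid_control \<omega>} s *\<^sub>R (exp (- q * s) * grid_control s \<omega>))"
proof (rule Bochner_Integration.integrable_bound)
  show "integrable lborel (\<lambda>s. indicator {0..} s * (cs n * exp (- q * s)))"
    using exp_tail_integral[OF q_pos, of 0 "cs n"] by (simp add: has_bochner_integral_iff)
  have [measurable]: "(\<lambda>s. grid_control s \<omega>) \<in> borel_measurable borel"
    unfolding grid_control_def by measurable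
  have "Measurable.pred borel (\<lambda>s. 0 \<le> s \<and> ereal s < ruin_time X grid_control \<omega>)" by measurable
  then show "(\<lambda>s. indicat_real {s. 0 \<le> s \<and> ereal s < ruin_time X grid_control \<omega>} s *\<^sub>R (exp (- q * s) * grid_control s \<omega>)) \<in> borel_measurable lborel"
    unfolding pred_def by measurable
  show "AE s in lborel. norm (indicat_real {s. 0 \<le> s \<and> ereal s < ruin_time X grid_control \<omega>} s *\<^sub>R (exp (- q * s) * grid_control s \<omega>)) \<le> norm (indicat_real {0..} s * (cs n * exp (- q * s)))"
    using grid_control_bounds cbar_nonneg by (intro AE_I2) (auto simp: indicator_def abs_mult mult.commute intro!: mult_right_mono)
qed

lemma grid_payoff_bounds:
  assumes w: "\<omega> \<in> space M" shows "0 \<le> grid_payoff \<omega> \<and> grid_payoff \<omega> \<le> K"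
proof
  show "0 \<le> grid_payoff \<omega>" unfolding grid_payoff_def set_lebesgue_integral_def using grid_control_bounds
    by (intro integral_nonneg_AE AE_I2) (auto simp: indicator_def)
  have "grid_payoff \<omega> \<le> (\<integral>s. indicator {0..} s * (cs n * exp (- q * s)) \<partial>lborel)"
    unfolding grid_payoff_def set_lebesgue_integral_def
  proof (rule integral_mono[OF grid_payoff_integrand_integrable[OF w]])
    show "integrable lborel (\<lambda>s. indicator {0..} s * (cs n * exp (- q * s)))"
      using exp_tail_integral[OF q_pos, of 0 "cs n"] by (simp add: has_bochner_integral_iff)
    show "indicat_real {s. 0 \<le> s \<and> ereal s < ruin_time X grid_control \<omega>} s *\<^sub>R (exp (- q * s) * grid_control s \<omega>) \<le> indicator {0..} s * (cs n * exp (- q * s))" for s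
      using grid_control_bounds[of s \<omega>] cbar_nonneg by (auto simp: indicator_def mult.commute intro!: mult_right_mono)
  qed
  also have "\<dots> = K" using has_bochner_integral_integral_eq[OF exp_tail_integral[OF q_pos, of 0 "cs n"]] by simp
  finally show "grid_payoff \<omega> \<le> K" .
qed

section \<open>Ruin between grid times and the payoff of the grid control\<close>

lemma grid_surplus_explicit:
  "\<omega> \<in> space M \<Longrightarrow> grid_surplus k \<omega> = x + mu * (real k * d) + sg * W (real k * d) \<omega> - d * (\<Sum>l<k. cs (level l \<omega>))"
proof (induction k)
  case 0 then show ?case using W_0 by (simp add: grid_surplus_0)
next
  case (Suc k) then show ?case by (simp add: grid_surplus_Suc algebra_simps)
qed

text \<open>The control is constant on each completed cell; on the last, partial cell it is
  estimated by the top rate.\<close>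

lemma grid_control_integral_le:
  assumes w: "\<omega> \<in> space M" and t: "real l * d \<le> t" "t < real (Suc l) * d"
  shows "(LINT u:{0..t}|lborel. grid_control u \<omega>) \<le> d * (\<Sum>m<l. cs (level m \<omega>)) + cs n * (t - real l * d)"
proof -
  define B where "B u = (\<Sum>k<l. indicator {real k * d..<real (Suc k) * d} u * cs (level k \<omega>)) + indicator {real l * d..t} u * cs n" for u
  have "has_bochner_integral lborel (\<lambda>u. indicator {real l * d..t} u *\<^sub>R cs n) (measure lborel {real l * d..t} *\<^sub>R cs n)"
    using t(1) by (intro has_bochner_integral_indicator) auto
  then have hb: "has_bochner_integral lborel (\<lambda>u. indicator {real l * d..t} u * cs n) ((t - real l * d) * cs n)"
    using t(1) by simp
  have Bi: "has_bochner_integral lborel B ((\<Sum>k<l. d * cs (level k \<omega>)) + (t - real l * d) * cs n)"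
    unfolding B_def using d by (intro has_bochner_integral_add step_function_integral hb) auto
  have "(LINT u:{0..t}|lborel. grid_control u \<omega>) \<le> (\<integral>u. B u \<partial>lborel)"
    unfolding set_lebesgue_integral_def
  proof (rule integral_mono)
    show "integrable lborel (\<lambda>u. indicat_real {0..t} u *\<^sub>R grid_control u \<omega>)"
      using C_path_integrable[OF grid_control_admissible i w] unfolding set_integrable_def by blast
    show "integrable lborel B" using Bi by (simp add: has_bochner_integral_iff)
    fix u :: real
    have B0: "0 \<le> B u" unfolding B_def using cs_bounds level_in cbar_nonneg
      by (intro add_nonneg_nonneg sum_nonneg mult_nonneg_nonneg) auto
    show "indicat_real {0..t} u *\<^sub>R grid_control u \<omega> \<le> B u"
    proof (cases "u \<in> {0..t}")
      case True
      then obtain k where k: "real k * d \<le> u" "u < real (Suc k) * d" using grid_cell_exists[OF d(1), of u] by auto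
      have "real k * d < real (Suc l) * d" using k(1) True t(2) by simp
      then have "k \<le> l" using d by simp
      show ?thesis
      proof (cases "k = l")
        case kl: True
        have "0 \<le> (\<Sum>k<l. indicator {real k * d..<real (Suc k) * d} u * cs (level k \<omega>))"
          using cs_bounds level_in by (intro sum_nonneg mult_nonneg_nonneg) auto
        moreover have "indicator {real l * d..t} u * cs n = cs n" using kl k True by simp
        ultimately have "cs n \<le> B u" unfolding B_def by linarith
        then show ?thesis using grid_control_bounds[of u \<omega>] True by simp
      next
        case False
        then have "k < l" using \<open>k \<le> l\<close> by simp
        have "0 \<le> indicator {real l * d..t} u * cs n" using cbar_nonneg by simp
        moreover have "(\<Sum>k<l. indicator {real k * d..<real (Suc k) * d} u * cs (level k \<omega>)) = cs (level k \<omega>)"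
          by (rule step_function_eval[OF d(1) \<open>k < l\<close> k])
        ultimately have "cs (level k \<omega>) \<le> B u" unfolding B_def by linarith
        then show ?thesis using grid_control_cell[OF k] True by simp
      qed
    qed (use B0 in simp)
  qed
  also have "\<dots> = (\<Sum>k<l. d * cs (level k \<omega>)) + (t - real l * d) * cs n" using Bi by (rule has_bochner_integral_integral_eq)
  finally show ?thesis by (simp add: sum_distrib_left mult.commute)
qed

text \<open>Rational times make this an event; by continuity of the paths the bound holds at all times of the
  cell. On this event the surplus cannot be ruined inside a cell that it enters above \<open>eta\<close>.\<close>

definition small_osc :: "nat \<Rightarrow> 'a set" where
  "small_osc N = {\<omega> \<in> space M. \<forall>k\<in>{..<N}. \<forall>r\<in>{r\<in>\<rat>. real k * d \<le> r \<and> r \<le> real (Suc k) * d}. sg * \<bar>W r \<omega> - W (real k * d) \<omega>\<bar> \<le> eta / 2}"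

lemma small_osc_events: "small_osc N \<in> events"
  unfolding small_osc_def
proof (rule sets.sets_Collect_finite_All)
  fix k
  show "{\<omega> \<in> space M. \<forall>r\<in>{r\<in>\<rat>. real k * d \<le> r \<and> r \<le> real (Suc k) * d}. sg * \<bar>W r \<omega> - W (real k * d) \<omega>\<bar> \<le> eta / 2} \<in> events"
  proof (rule sets.sets_Collect_countable_All')
    fix r assume "r \<in> {r\<in>\<rat>. real k * d \<le> r \<and> r \<le> real (Suc k) * d}"
    moreover have kd: "0 \<le> real k * d" using d by simp
    ultimately have [measurable]: "W r \<in> borel_measurable M" "W (real k * d) \<in> borel_measurable M" by auto
    show "{\<omega> \<in> space M. sg * \<bar>W r \<omega> - W (real k * d) \<omega>\<bar> \<le> eta / 2} \<in> events" by measurable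
  next
    show "countable {r\<in>\<rat>. real k * d \<le> r \<and> r \<le> real (Suc k) * d}"
      by (rule countable_subset[OF _ countable_rat]) auto
  qed
qed simp

lemma small_osc_real:
  assumes w: "\<omega> \<in> small_osc N" and k: "k < N" and t: "real k * d \<le> t" "t < real (Suc k) * d"
  shows "sg * \<bar>W t \<omega> - W (real k * d) \<omega>\<bar> \<le> eta / 2"
proof (rule ccontr)
  assume neg: "\<not> sg * \<bar>W t \<omega> - W (real k * d) \<omega>\<bar> \<le> eta / 2"
  have ws: "\<omega> \<in> space M" using w by (simp add: small_osc_def)
  have "0 \<le> real k * d" using d by simp
  then have t0: "0 \<le> t" using t(1) by linarith
  have "((\<lambda>s. sg * \<bar>W s \<omega> - W (real k * d) \<omega>\<bar>) \<longlongrightarrow> sg * \<bar>W t \<omega> - W (real k * d) \<omega>\<bar>) (at_right t)"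
    by (intro tendsto_intros W_tendsto_right[OF ws t0])
  then have "\<forall>\<^sub>F s in at_right t. eta / 2 < sg * \<bar>W s \<omega> - W (real k * d) \<omega>\<bar>"
    using neg by (intro order_tendstoD) auto
  then obtain b where b: "t < b" "\<And>s. t < s \<Longrightarrow> s < b \<Longrightarrow> eta / 2 < sg * \<bar>W s \<omega> - W (real k * d) \<omega>\<bar>"
    unfolding eventually_at_right[OF t(2)] by blast
  obtain r where r: "r \<in> \<rat>" "t < r" "r < min b (real (Suc k) * d)"
    using Rats_dense_in_real[of t "min b (real (Suc k) * d)"] b(1) t(2) by auto
  then have "sg * \<bar>W r \<omega> - W (real k * d) \<omega>\<bar> \<le> eta / 2" using w k t unfolding small_osc_def by auto
  then show False using b(2)[of r] r by auto
qed

text \<open>The margin \<open>eta\<close> is spent in two halves: one covers the Brownian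
  oscillation inside a cell, the other the drift and the payments, at most
  \<open>(cs n + |mu|) * d\<close> in absolute value.\<close>

lemma ruin_after:
  assumes w: "\<omega> \<in> small_osc N" "\<omega> \<in> grid_alive k" and k: "k < N" and small: "(cs n + \<bar>mu\<bar>) * d \<le> eta / 2"
  shows "ereal (real (Suc k) * d) \<le> ruin_time X grid_control \<omega>"
  unfolding ruin_time_def
proof (rule Inf_greatest, safe)
  fix t assume t: "0 \<le> t" "surplusC X grid_control t \<omega> < 0"
  have ws: "\<omega> \<in> space M" using w by (simp add: small_osc_def)
  show "ereal (real (Suc k) * d) \<le> ereal t"
  proof (rule ccontr)
    assume "\<not> ereal (real (Suc k) * d) \<le> ereal t"
    then have tk: "t < real (Suc k) * d" by simp
    obtain l where l: "real l * d \<le> t" "t < real (Suc l) * d" using grid_cell_exists[OF d(1) t(1)] by blast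
    have "real l * d < real (Suc k) * d" using l(1) tk by simp
    then have lk: "l \<le> k" using d by simp
    then have "eta < grid_surplus l \<omega>" using w(2) by (simp add: grid_alive_def)
    moreover have "sg * \<bar>W t \<omega> - W (real l * d) \<omega>\<bar> \<le> eta / 2" using small_osc_real[OF w(1) _ l] lk k by simp
    moreover have "- (sg * \<bar>W t \<omega> - W (real l * d) \<omega>\<bar>) \<le> sg * (W t \<omega> - W (real l * d) \<omega>)"
    proof -
      have "sg * (- \<bar>W t \<omega> - W (real l * d) \<omega>\<bar>) \<le> sg * (W t \<omega> - W (real l * d) \<omega>)"
        using sg_pos by (intro mult_left_mono) auto
      then show ?thesis by simp
    qed
    moreover have "(cs n + \<bar>mu\<bar>) * (t - real l * d) \<le> eta / 2"
    proof -
      have "t - real l * d \<le> d" using l(2) by (simp add: algebra_simps)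
      then have "(cs n + \<bar>mu\<bar>) * (t - real l * d) \<le> (cs n + \<bar>mu\<bar>) * d" using cbar_nonneg by (intro mult_left_mono) auto
      then show ?thesis using small by simp
    qed
    moreover have "- (\<bar>mu\<bar> * (t - real l * d)) \<le> mu * (t - real l * d)"
    proof -
      have "- \<bar>mu\<bar> * (t - real l * d) \<le> mu * (t - real l * d)" using l(1) by (intro mult_right_mono) auto
      then show ?thesis by simp
    qed
    moreover have "grid_surplus l \<omega> + mu * (t - real l * d) + sg * (W t \<omega> - W (real l * d) \<omega>) - cs n * (t - real l * d) \<le> surplusC X grid_control t \<omega>"
      using grid_control_integral_le[OF ws l] grid_surplus_explicit[OF ws, of l] by (simp add: surplusC_def Xproc_def algebra_simps)
    moreover have "(cs n + \<bar>mu\<bar>) * (t - real l * d) = cs n * (t - real l * d) + \<bar>mu\<bar> * (t - real l * d)" by (rule distrib_right)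
    ultimately show False using t(2) by linarith
  qed
qed

text \<open>On \<open>small_osc N\<close> each cell entered above \<open>eta\<close> is survived
  completely, and the discount factor of its right end is a lower bound. Off this event the sum is
  at most \<open>real N * d * cs n\<close>, which the subtracted penalty cancels.\<close>

lemma grid_payoff_ge:
  assumes w: "\<omega> \<in> space M" and small: "(cs n + \<bar>mu\<bar>) * d \<le> eta / 2"
  shows "(\<Sum>k<N. d * (indicator (grid_alive k) \<omega> * (exp (- q * (real (Suc k) * d)) * cs (level k \<omega>)))) - real N * d * cs n * indicator (space M - small_osc N) \<omega> \<le> grid_payoff \<omega>"
proof (cases "\<omega> \<in> small_osc N")
  case True
  define B where "B s = (\<Sum>k<N. indicator {real k * d..<real (Suc k) * d} s * (indicator (grid_alive k) \<omega> * (exp (- q * (real (Suc k) * d)) * cs (level k \<omega>))))" for s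
  have Bi: "has_bochner_integral lborel B (\<Sum>k<N. d * (indicator (grid_alive k) \<omega> * (exp (- q * (real (Suc k) * d)) * cs (level k \<omega>))))"
    unfolding B_def using d by (intro step_function_integral) auto
  have "(\<integral>s. B s \<partial>lborel) \<le> grid_payoff \<omega>" unfolding grid_payoff_def set_lebesgue_integral_def
  proof (rule integral_mono[OF _ grid_payoff_integrand_integrable[OF w]])
    show "integrable lborel B" using Bi by (simp add: has_bochner_integral_iff)
    fix s :: real
    have nn: "0 \<le> indicat_real {s. 0 \<le> s \<and> ereal s < ruin_time X grid_control \<omega>} s *\<^sub>R (exp (- q * s) * grid_control s \<omega>)"
      using grid_control_bounds by (auto simp: indicator_def)
    show "B s \<le> indicat_real {s. 0 \<le> s \<and> ereal s < ruin_time X grid_control \<omega>} s *\<^sub>R (exp (- q * s) * grid_control s \<omega>)"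
    proof (cases "\<exists>k<N. s \<in> {real k * d..<real (Suc k) * d}")
      case False
      then have "B s = 0" unfolding B_def by (intro sum.neutral) auto
      then show ?thesis using nn by simp
    next
      case ex: True
      then obtain k where k: "k < N" "real k * d \<le> s" "s < real (Suc k) * d" by auto
      have Bs: "B s = indicator (grid_alive k) \<omega> * (exp (- q * (real (Suc k) * d)) * cs (level k \<omega>))"
        unfolding B_def by (rule step_function_eval[OF d(1) k])
      show ?thesis
      proof (cases "\<omega> \<in> grid_alive k")
        case ak: True
        have "ereal s < ereal (real (Suc k) * d)" using k(3) by simp
        also have "\<dots> \<le> ruin_time X grid_control \<omega>" by (rule ruin_after[OF True ak k(1) small])
        finally have rt: "ereal s < ruin_time X grid_control \<omega>" .
        have "0 \<le> real k * d" using d by simp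
        then have s0: "0 \<le> s" using k(2) by linarith
        have "exp (- q * (real (Suc k) * d)) * cs (level k \<omega>) \<le> exp (- q * s) * cs (level k \<omega>)"
          using k(3) q_pos cs_bounds[of "level k \<omega>"] level_in[of k \<omega>] by (intro mult_right_mono) auto
        then show ?thesis using Bs ak rt s0 grid_control_cell[OF k(2,3)] by simp
      qed (use Bs nn in simp)
    qed
  qed
  moreover have "(\<integral>s. B s \<partial>lborel) = (\<Sum>k<N. d * (indicator (grid_alive k) \<omega> * (exp (- q * (real (Suc k) * d)) * cs (level k \<omega>))))"
    using Bi by (rule has_bochner_integral_integral_eq)
  ultimately show ?thesis using True by simp
next
  case False
  have "(\<Sum>k<N. d * (indicator (grid_alive k) \<omega> * (exp (- q * (real (Suc k) * d)) * cs (level k \<omega>)))) \<le> (\<Sum>k<N. d * cs n)"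
  proof (intro sum_mono mult_left_mono)
    fix k
    have c: "0 \<le> cs (level k \<omega>)" "cs (level k \<omega>) \<le> cs n" using cs_bounds level_in[of k \<omega>] by auto
    have "exp (- q * (real (Suc k) * d)) * cs (level k \<omega>) \<le> 1 * cs n" using c q_pos d by (intro mult_mono) auto
    then show "indicator (grid_alive k) \<omega> * (exp (- q * (real (Suc k) * d)) * cs (level k \<omega>)) \<le> cs n"
      using cbar_nonneg by (auto simp: indicator_def)
  qed (use d in auto)
  then show ?thesis using grid_payoff_bounds[OF w] False w by simp
qed

lemma Jpay_lower:
  assumes M0: "0 \<le> M0" "\<And>j y. j \<in> {1..n} \<Longrightarrow> 0 < y \<Longrightarrow> v (Suc j) y + ep < v j y \<Longrightarrow> quad_bound mu sg q (cs j) (- 1) (v j) M0 y"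
    and small: "(cs n + \<bar>mu\<bar>) * d \<le> eta / 2"
  shows "v i (x - eta) - 2 * ep * real n - real N * (M0 * step_sum * (d * sqrt d) + q\<^sup>2 * d\<^sup>2 * K) - exp (- q * (real N * d)) * K
      - q * d * (real N * d * cs n) - real N * d * cs n * (1 - prob (small_osc N)) \<le> Jpay M q X grid_control"
proof -
  have [measurable]: "grid_alive k \<in> events" for k using grid_alive_Filt Filt_subset by blast
  have [measurable]: "level k \<in> measurable M (count_space UNIV)" for k using level_meas .
  have [measurable]: "small_osc N \<in> events" by (rule small_osc_events)
  have cb: "0 \<le> cs (level k \<omega>) \<and> cs (level k \<omega>) \<le> cs n" for k \<omega> using cs_bounds level_in[of k \<omega>] by auto
  have iC: "integrable M (\<lambda>\<omega>. indicator (grid_alive k) \<omega> * cs (level k \<omega>))" for k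
  proof (rule bounded_integrable[where B="cs n"])
    show "(\<lambda>\<omega>. indicator (grid_alive k) \<omega> * cs (level k \<omega>)) \<in> borel_measurable M" by measurable
  qed (use cb cbar_nonneg in \<open>auto simp: indicator_def\<close>)
  define H where "H k = (\<integral>\<omega>. indicator (grid_alive k) \<omega> * cs (level k \<omega>) \<partial>M)" for k
  have H: "0 \<le> H k" "H k \<le> cs n" for k
  proof -
    show "0 \<le> H k" unfolding H_def using cb by (intro integral_nonneg_AE AE_I2) (auto simp: indicator_def)
    have "H k \<le> (\<integral>\<omega>. cs n \<partial>M)" unfolding H_def using iC cb
      by (intro integral_mono) (auto simp: indicator_def cbar_nonneg)
    then show "H k \<le> cs n" by (simp add: prob_space)
  qed
  define D where "D \<omega> = (\<Sum>k<N. (d * exp (- q * (real (Suc k) * d))) * (indicator (grid_alive k) \<omega> * cs (level k \<omega>))) - (real N * d * cs n) * indicator (space M - small_osc N) \<omega>" for \<omega>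
  have iD: "integrable M D" unfolding D_def using iC
    by (intro Bochner_Integration.integrable_diff Bochner_Integration.integrable_sum integrable_mult_right) (auto simp: emeasure_eq_measure)
  have iP: "integrable M grid_payoff" using grid_payoff_measurable grid_payoff_bounds by (intro bounded_integrable[where B=K]) auto
  have "(\<integral>\<omega>. D \<omega> \<partial>M) \<le> (\<integral>\<omega>. grid_payoff \<omega> \<partial>M)"
  proof (rule integral_mono[OF iD iP])
    fix \<omega> assume "\<omega> \<in> space M"
    from grid_payoff_ge[OF this small, of N] show "D \<omega> \<le> grid_payoff \<omega>" unfolding D_def by (simp add: ac_simps)
  qed
  moreover have "(\<integral>\<omega>. D \<omega> \<partial>M) = (\<Sum>k<N. (d * exp (- q * (real (Suc k) * d))) * H k) - (real N * d * cs n) * (1 - prob (small_osc N))"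
  proof -
    have "(\<integral>\<omega>. D \<omega> \<partial>M) = (\<Sum>k<N. (d * exp (- q * (real (Suc k) * d))) * H k) - (real N * d * cs n) * prob (space M - small_osc N)"
      unfolding D_def H_def using iC
      by (subst Bochner_Integration.integral_diff)
         (auto intro!: Bochner_Integration.integrable_sum simp: Bochner_Integration.integral_sum emeasure_eq_measure)
    then show ?thesis by (simp add: prob_compl)
  qed
  \<comment> \<open>Moving the discount factor from the right end of a cell back to the left end
    costs at most the fraction \<open>q * d\<close> of each payment.\<close>
  moreover have "(\<Sum>k<N. exp (- q * (real k * d)) * d * H k) - q * d * (real N * d * cs n) \<le> (\<Sum>k<N. (d * exp (- q * (real (Suc k) * d))) * H k)"
  proof -
    have "exp (- q * (real k * d)) * d * H k - q * d * (d * cs n) \<le> (d * exp (- q * (real (Suc k) * d))) * H k" for k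
    proof -
      define e where "e = exp (- q * (real k * d))"
      have e: "0 < e" "e \<le> 1" using q_pos d by (auto simp: e_def)
      have eS: "exp (- q * (real (Suc k) * d)) = e * exp (- (q * d))" by (simp add: e_def exp_add [symmetric] algebra_simps)
      have a: "0 \<le> e * d * H k" "e * d * H k \<le> d * cs n"
      proof -
        show "0 \<le> e * d * H k" using e d H by simp
        have "e * (d * H k) \<le> 1 * (d * cs n)" using e d H by (intro mult_mono mult_left_mono) auto
        then show "e * d * H k \<le> d * cs n" by (simp add: mult.assoc)
      qed
      have "(1 - q * d) * (e * d * H k) \<le> exp (- (q * d)) * (e * d * H k)"
        using exp_ge_add_one_self[of "- (q * d)"] a(1) by (intro mult_right_mono) auto
      moreover have "q * d * (e * d * H k) \<le> q * d * (d * cs n)" using a(2) q_pos d by (intro mult_left_mono) auto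
      ultimately show ?thesis unfolding eS e_def [symmetric] by (simp add: algebra_simps)
    qed
    then have "(\<Sum>k<N. exp (- q * (real k * d)) * d * H k - q * d * (d * cs n)) \<le> (\<Sum>k<N. (d * exp (- q * (real (Suc k) * d))) * H k)"
      by (intro sum_mono)
    then show ?thesis by (simp add: sum_subtractf algebra_simps)
  qed
  moreover have "Jpay M q X grid_control = (\<integral>\<omega>. grid_payoff \<omega> \<partial>M)" by (simp add: Jpay_def grid_payoff_def)
  moreover note lower_grid[OF M0, of N, folded H_def]
  ultimately show ?thesis by linarith
qed

end

text \<open>Each path is uniformly continuous on \<open>[0, T]\<close>, so it belongs to the event
  for all fine meshes, and dominated convergence passes to probabilities. The summand
  \<open>nat \<lceil>T\<rceil>\<close> keeps the mesh at most 1.\<close>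

lemma small_osc_prob_tendsto:
  fixes ep :: real
  assumes eta: "0 < eta" "eta < x" and ep: "0 < ep" "ep < 1" and i: "1 \<le> i" "i \<le> n" and T: "0 < T"
  shows "(\<lambda>N. prob (small_osc eta (T / real (Suc N + nat \<lceil>T\<rceil>)) (Suc N + nat \<lceil>T\<rceil>))) \<longlonglongrightarrow> 1"
proof -
  define m where "m N = Suc N + nat \<lceil>T\<rceil>" for N
  define dd where "dd N = T / real (m N)" for N
  have mp: "0 < real (m N)" "T \<le> real (m N)" for N unfolding m_def by linarith+
  have dd: "0 < dd N" "dd N \<le> 1" "real (m N) * dd N = T" for N using mp[of N] T by (auto simp: dd_def)
  have "(\<lambda>N. \<integral>\<omega>. indicat_real (small_osc eta (dd N) (m N)) \<omega> \<partial>M) \<longlonglongrightarrow> (\<integral>\<omega>. 1 \<partial>M)"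
  proof (rule integral_dominated_convergence[where w="\<lambda>_. 1"])
    show "(\<lambda>\<omega>. indicat_real (small_osc eta (dd N) (m N)) \<omega>) \<in> borel_measurable M" for N
      using small_osc_events[OF eta ep dd(1)[of N] dd(2)[of N] i] by simp
    show "AE \<omega> in M. (\<lambda>N. indicat_real (small_osc eta (dd N) (m N)) \<omega>) \<longlonglongrightarrow> 1"
    proof (rule AE_I2)
      fix \<omega> assume w: "\<omega> \<in> space M"
      have "uniformly_continuous_on {0..T} (\<lambda>t. W t \<omega>)"
        by (rule compact_uniformly_continuous[OF continuous_on_subset[OF W_cont[OF w]]]) auto
      moreover have "0 < eta / (2 * sg)" using eta sg_pos by simp
      ultimately obtain e where e: "0 < e" "\<And>s t. s \<in> {0..T} \<Longrightarrow> t \<in> {0..T} \<Longrightarrow> dist s t < e \<Longrightarrow> dist (W s \<omega>) (W t \<omega>) < eta / (2 * sg)"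
        unfolding uniformly_continuous_on_def by metis
      have "\<forall>\<^sub>F N in sequentially. T / e < real N"
        using filterlim_real_sequentially by (simp add: filterlim_at_top_dense)
      then have "\<forall>\<^sub>F N in sequentially. indicat_real (small_osc eta (dd N) (m N)) \<omega> = 1"
      proof eventually_elim
        case (elim N)
        have "T / e < real (m N)" using elim by (simp add: m_def)
        then have de: "dd N < e" using e(1) mp[of N] T by (simp add: dd_def field_simps)
        have "sg * \<bar>W r \<omega> - W (real k * dd N) \<omega>\<bar> \<le> eta / 2" if k: "k < m N" and r: "real k * dd N \<le> r" "r \<le> real (Suc k) * dd N" for k r
        proof -
          have "real (Suc k) * dd N \<le> real (m N) * dd N" using k dd(1)[of N] by (intro mult_right_mono) auto
          then have rT: "r \<le> T" using r(2) dd(3)[of N] by linarith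
          have k0: "0 \<le> real k * dd N" using dd(1)[of N] by simp
          have r0: "0 \<le> r" using k0 r(1) by linarith
          have "r - real k * dd N \<le> dd N" using r(2) by (simp add: algebra_simps)
          then have "dist r (real k * dd N) < e" using de r(1) by (simp add: dist_real_def)
          moreover have "r \<in> {0..T}" using r0 rT by (simp only: atLeastAtMost_iff)
          moreover have "real k * dd N \<in> {0..T}" using k0 rT r(1) unfolding atLeastAtMost_iff by linarith
          ultimately have "dist (W r \<omega>) (W (real k * dd N) \<omega>) < eta / (2 * sg)" by (intro e(2))
          then have "sg * \<bar>W r \<omega> - W (real k * dd N) \<omega>\<bar> < sg * (eta / (2 * sg))"
            using sg_pos by (intro mult_strict_left_mono) (auto simp: dist_real_def)
          then show ?thesis using sg_pos by simp
        qed
        then show ?case using w unfolding small_osc_def[OF eta ep dd(1)[of N] dd(2)[of N] i] by simp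
      qed
      then show "(\<lambda>N. indicat_real (small_osc eta (dd N) (m N)) \<omega>) \<longlonglongrightarrow> 1"
        by (rule tendsto_eventually)
    qed
  qed auto
  moreover have "small_osc eta (dd N) (m N) \<in> events" for N
    using small_osc_events[OF eta ep dd(1)[of N] dd(2)[of N] i] .
  ultimately show ?thesis unfolding m_def [symmetric] dd_def [symmetric] by (simp add: prob_space)
qed

text \<open>The supremum in \<open>VS\<close> is taken in the reals, where an upper bound has to be
  known before it dominates its members.\<close>

lemma VS_bdd_above:
  assumes x: "0 \<le> x" and i: "1 \<le> i" "i \<le> n"
  shows "bdd_above (Jpay M q X ` {C. admissible M X (cs ` {1..n}) (cs i) C})"
  using Jpay_le_v[OF _ i x] by (intro bdd_aboveI[of _ "v i x"]) auto

text \<open>\<open>Jpay_lower\<close> along meshes tending to 0 with \<open>eta\<close>,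
  \<open>ep\<close> and \<open>T\<close> fixed: \<open>M0\<close> depends on \<open>ep\<close> but
  not on the mesh, and the probability of a large oscillation inside a cell vanishes.\<close>

lemma VS_ge:
  assumes eta: "0 < eta" "eta < x" and ep: "0 < ep" "ep < 1" and i: "1 \<le> i" "i \<le> n" and T: "0 < T"
  shows "v i (x - eta) - 2 * ep * real n - exp (- q * T) * K \<le> VS M W mu sg q (cs ` {1..n}) x (cs i)"
proof -
  obtain M0 where M0: "0 \<le> M0" "\<And>j y. j \<in> {1..n} \<Longrightarrow> 0 < y \<Longrightarrow> v (Suc j) y + ep < v j y \<Longrightarrow> quad_bound mu sg q (cs j) (- 1) (v j) M0 y"
    using uniform_quad_bound_below[OF ep(1)] by blast
  define m where "m N = Suc N + nat \<lceil>T\<rceil>" for N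
  define dd where "dd N = T / real (m N)" for N
  have mp: "0 < real (m N)" "T \<le> real (m N)" for N unfolding m_def by linarith+
  have dd: "0 < dd N" "dd N \<le> 1" "real (m N) * dd N = T" for N using mp[of N] T by (auto simp: dd_def)
  have dd0: "dd \<longlonglongrightarrow> 0"
  proof -
    have "(\<lambda>N. T / real N) \<longlonglongrightarrow> 0" by (rule lim_const_over_n)
    then have "(\<lambda>N. T / real (N + Suc (nat \<lceil>T\<rceil>))) \<longlonglongrightarrow> 0" by (rule LIMSEQ_ignore_initial_segment)
    moreover have "dd = (\<lambda>N. T / real (N + Suc (nat \<lceil>T\<rceil>)))" by (simp add: fun_eq_iff dd_def m_def)
    ultimately show ?thesis by (simp only:)
  qed
  define B where "B N = v i (x - eta) - 2 * ep * real n - T * (M0 * step_sum * sqrt (dd N) + q\<^sup>2 * dd N * K) - exp (- q * T) * K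
      - q * dd N * (T * cs n) - T * cs n * (1 - prob (small_osc eta (dd N) (m N)))" for N
  have "B \<longlonglongrightarrow> v i (x - eta) - 2 * ep * real n - T * (M0 * step_sum * sqrt 0 + q\<^sup>2 * 0 * K) - exp (- q * T) * K
      - q * 0 * (T * cs n) - T * cs n * (1 - 1)"
    unfolding B_def using small_osc_prob_tendsto[OF eta ep i T] dd0 unfolding m_def [symmetric] dd_def [symmetric]
    by (intro tendsto_intros)
  then have lim: "B \<longlonglongrightarrow> v i (x - eta) - 2 * ep * real n - exp (- q * T) * K" by simp
  have "\<forall>\<^sub>F N in sequentially. B N \<le> VS M W mu sg q (cs ` {1..n}) x (cs i)"
  proof -
    have "(\<lambda>N. (cs n + \<bar>mu\<bar>) * dd N) \<longlonglongrightarrow> (cs n + \<bar>mu\<bar>) * 0" using dd0 by (intro tendsto_intros)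
    then have "\<forall>\<^sub>F N in sequentially. (cs n + \<bar>mu\<bar>) * dd N < eta / 2" using eta by (intro order_tendstoD(2)) auto
    then show ?thesis
    proof eventually_elim
      case (elim N)
      have "real (m N) * (M0 * step_sum * (dd N * sqrt (dd N)) + q\<^sup>2 * (dd N)\<^sup>2 * K) = (real (m N) * dd N) * (M0 * step_sum * sqrt (dd N) + q\<^sup>2 * dd N * K)"
        by (simp add: algebra_simps power2_eq_square)
      then have "B N \<le> Jpay M q X (grid_control eta ep (dd N) i)"
        using Jpay_lower[OF eta ep dd(1)[of N] dd(2)[of N] i M0, of "m N"] elim unfolding B_def dd(3) by simp
      also have "\<dots> \<le> VS M W mu sg q (cs ` {1..n}) x (cs i)"
        unfolding VS_def using grid_control_admissible[OF eta ep dd(1)[of N] dd(2)[of N] i] VS_bdd_above[OF _ i] eta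
        by (intro cSUP_upper) auto
      finally show ?case .
    qed
  qed
  then show ?thesis by (intro tendsto_upperbound[OF lim]) auto
qed

theorem VS_eq_v:
  assumes x: "0 \<le> x" and i: "1 \<le> i" "i \<le> n"
  shows "VS M W mu sg q (cs ` {1..n}) x (cs i) = v i x"
proof (rule antisym)
  show "VS M W mu sg q (cs ` {1..n}) x (cs i) \<le> v i x"
    unfolding VS_def using constant_admissible[OF i] Jpay_le_v[OF _ i x] by (intro cSUP_least) auto
  show "v i x \<le> VS M W mu sg q (cs ` {1..n}) x (cs i)"
  proof (cases "x = 0")
    case True
    \<comment> \<open>At 0 there is no admissible shift \<open>eta < x\<close>; instead
      \<open>v\<close> vanishes there and the constant control pays a nonnegative amount.\<close>
    have "v i x = 0" using v_zero[OF i] True by simp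
    also have "0 \<le> Jpay M q X (\<lambda>_ _. cs i)"
      unfolding Jpay_def set_lebesgue_integral_def using cs_bounds[OF i]
      by (intro integral_nonneg_AE AE_I2) (auto simp: indicator_def)
    also have "\<dots> \<le> VS M W mu sg q (cs ` {1..n}) x (cs i)"
      unfolding VS_def using constant_admissible[OF i] VS_bdd_above[OF x i] by (intro cSUP_upper) auto
    finally show ?thesis .
  next
    case False
    then have xp: "0 < x" using x by simp
    define V where "V = VS M W mu sg q (cs ` {1..n}) x (cs i)"
    have 1: "v i (x - eta) - 2 * ep * real n \<le> V" if eta: "0 < eta" "eta < x" and ep: "0 < ep" "ep < 1" for eta ep
    proof (rule tendsto_upperbound)
      show "\<forall>\<^sub>F T in at_top. v i (x - eta) - 2 * ep * real n - exp (- q * T) * K \<le> V"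
        using eventually_gt_at_top[of 0] unfolding V_def by eventually_elim (rule VS_ge[OF eta ep i])
      have "((\<lambda>T. exp (- q * T)) \<longlongrightarrow> 0) at_top"
        using q_pos by (intro filterlim_compose[OF exp_at_bot] filterlim_tendsto_neg_mult_at_bot[OF tendsto_const] filterlim_ident) auto
      then have "((\<lambda>T. v i (x - eta) - 2 * ep * real n - exp (- q * T) * K) \<longlongrightarrow> v i (x - eta) - 2 * ep * real n - 0 * K) at_top"
        by (intro tendsto_intros)
      then show "((\<lambda>T. v i (x - eta) - 2 * ep * real n - exp (- q * T) * K) \<longlongrightarrow> v i (x - eta) - 2 * ep * real n) at_top" by simp
    qed simp
    show ?thesis unfolding V_def [symmetric]
    proof (rule field_le_epsilon)
      fix e :: real assume e: "0 < e"
      \<comment> \<open>The error \<open>e\<close> is split into halves, one for the shift through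
        the Lipschitz constant and one for the tolerance through the number of levels. The caps keep
        \<open>eta < x\<close> and \<open>ep < 1\<close>.\<close>
      define eta where "eta = min (x / 2) (e / (2 * (L + 1)))"
      define ep where "ep = min (1 / 2) (e / (4 * (real n + 1)))"
      have eta: "0 < eta" "eta < x" using xp e L_nonneg by (auto simp: eta_def)
      have ep: "0 < ep" "ep < 1" using e by (auto simp: ep_def)
      have "L * eta \<le> (L + 1) * (e / (2 * (L + 1)))" using L_nonneg eta e by (intro mult_mono) (auto simp: eta_def)
      also have "\<dots> = e / 2" using L_nonneg by (simp add: field_simps)
      finally have Le: "L * eta \<le> e / 2" .
      have "2 * ep * real n \<le> 2 * (e / (4 * (real n + 1))) * (real n + 1)" using e ep by (intro mult_mono) (auto simp: ep_def)
      also have "\<dots> = e / 2" by (simp add: field_simps)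
      finally have ee: "2 * ep * real n \<le> e / 2" .
      have "v i x \<le> v i (x - eta) + L * eta" using v_lip[OF i, of x "x - eta"] eta by simp
      then show "v i x \<le> V + e" using 1[OF eta ep] Le ee by linarith
    qed
  qed
qed

end

theorem mainTheorem9:
  fixes M :: "'a measure" and W :: "real \<Rightarrow> 'a \<Rightarrow> real"
    and mu sg q :: real and n i :: nat and cs :: "nat \<Rightarrow> real"
  assumes "mu > 0" and "sg > 0" and "q > 0"
    and "std_BM M W"
    and "n \<ge> 1"
    and "0 \<le> cs 1"
    and "\<forall>j\<in>{1..<n}. cs j < cs (Suc j)"
    and "1 \<le> i" and "i < n"
  shows "admissible_super mu sg q (cs i) (cs n)
           (\<lambda>x. VS M W mu sg q (cs ` {1..n}) x (cs (Suc i)))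
           (\<lambda>x. VS M W mu sg q (cs ` {1..n}) x (cs i))
       \<and> (\<forall>u. admissible_super mu sg q (cs i) (cs n)
               (\<lambda>x. VS M W mu sg q (cs ` {1..n}) x (cs (Suc i))) u
             \<longrightarrow> (\<forall>x\<ge>0. VS M W mu sg q (cs ` {1..n}) x (cs i) \<le> u x))"
proof -
  have less: "cs j < cs k" if "1 \<le> j" "j < k" "k \<le> n" for j k
    using that(2,3)
  proof (induction k)
    case (Suc k)
    have "cs k < cs (Suc k)" using assms(7) Suc.prems that(1) by simp
    then show ?case using Suc by (cases "j = k") auto
  qed simp
  have bounds: "0 \<le> cs j \<and> cs j \<le> cs n" if "j \<in> {1..n}" for j
    using less[of 1 j] less[of j n] assms(6) that by (cases "j = 1"; cases "j = n") auto
  obtain v L where v: "v (Suc n) = (\<lambda>_. - 1)"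
    "\<And>j. j \<in> {1..n} \<Longrightarrow> obstacle_sol mu sg q (cs n / q) L (cs j) (v (Suc j)) (v j)"
    "\<And>j. j \<in> {1..n} \<Longrightarrow> (v j \<longlongrightarrow> cs n / q) at_top"
    using value_family_exists[OF assms(2,3,5), of cs mu] bounds by blast
  \<comment> \<open>The family \<open>v\<close> is the same for all starting points while the
    surplus process is not, so the locale is interpreted separately for every
    \<open>y\<close>.\<close>
  have VS: "VS M W mu sg q (cs ` {1..n}) y (cs j) = v j y" if "0 \<le> y" "j \<in> {1..n}" for y j
  proof -
    interpret value_family M W mu sg y q L n cs v
      using assms less v by unfold_locales auto
    show ?thesis using VS_eq_v[of j] that by simp
  qed
  have i: "i \<in> {1..n}" "Suc i \<in> {1..n}" using assms(8,9) by auto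
  have "admissible_super mu sg q (cs i) (cs n)
           (\<lambda>x. VS M W mu sg q (cs ` {1..n}) x (cs (Suc i)))
           (\<lambda>x. VS M W mu sg q (cs ` {1..n}) x (cs i))"
    by (rule solution_admissible_super[OF v(2)[OF i(1)] refl v(3)[OF i(1)]])
       (rule VS[OF _ i(2)] VS[OF _ i(1)], assumption)+
  moreover have "VS M W mu sg q (cs ` {1..n}) x (cs i) \<le> u x"
    if u: "admissible_super mu sg q (cs i) (cs n) (\<lambda>x. VS M W mu sg q (cs ` {1..n}) x (cs (Suc i))) u"
      and x: "0 \<le> x" for u x
  proof -
    have "vclass (cs n / q) L (v (Suc i))" using v(2)[OF i(2)] by (simp add: obstacle_sol_def)
    then have "v i x \<le> u x"
      by (rule supersolution_ge_solution[OF v(2)[OF i(1)] assms(3,2) _ VS[OF _ i(2)] u refl x])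
    then show ?thesis using VS[OF x i(1)] by simp
  qed
  ultimately show ?thesis by blast
qed

end
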